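(* Let $p\in(1,\infty)$, $p'=p/(p-1)$, $T>0$ and $H:\mathbb{R}^d\times\mathbb{R}^d\times\mathcal P_p(\mathbb{R}^d)\to\mathbb{R}$. Assume that there exist $C>0$ and a modulus of continuity $\omega$ such that for all $x,y,q\in\mathbb{R}^d$ and $\mu,\nu\in\mathcal P_p(\mathbb{R}^d)$, $$|H(x,q,\mu)|\le C(1+|q|^{p'}),$$ $$|H(x,q,\mu)-H(y,q,\nu)|\le\omega\big((1+|q|)(|x-y|+\mathcal W_p(\mu,\nu))\big),$$ $$|D_qH(x,q,\mu)|\le C(1+|q|^{p'-1}).$$ Let $U,V:[0,T]\times\mathcal P_p(\mathbb{R}^d)\to\mathbb{R}$ be bounded uniformly continuous functions which are respectively a viscosity sub-solution and a viscosity super-solution of $$\partial_tU+\int_{\mathbb{R}^d}H(x,D_\mu U(t,\mu)(x),\mu)\,\mu(dx)=0\quad\text{in }(0,T)\times\mathcal P_p(\mathbb{R}^d),$$ and such that $(U-V)|_{t=0}\le0$. Then $U\le V$.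
   Context: $\mathcal P_p(\mathbb{R}^d)$ is the set of Borel probability measures with finite $p$-th moment, equipped with the $p$-Wasserstein distance $\mathcal W_p$. $\Pi(\cdot,\cdot)$ denotes the set of couplings, $\pi_i$ the projection on the $i$-th coordinate. A modulus of continuity is a continuous concave non-decreasing $\omega:\mathbb{R}_+\to\mathbb{R}_+$, smooth on $(0,\infty)$, with $\omega(0)=0$. For $\Gamma\in\mathcal P((\mathbb{R}^d)^3)$, $\tilde C_p(\Gamma)=(\int|x-y|^p\,\Gamma(dx,dz,dy))^{1/p}$. For $U:[0,T]\times\mathcal P_p(\mathbb{R}^d)\to\mathbb{R}$, $\theta\in\mathbb{R}$ and a measurable $\psi:\mathbb{R}^d\to\mathcal P(\mathbb{R}^d)$, we write $(\theta,\psi)\in\partial^+U(t,\mu)$ if $\int_{\mathbb{R}^{2d}}|z|^{p'}\mu(dx)\psi_x(dz)<\infty$ and there is a modulus of continuity $\omega$ such that for all $(t',\mu')\in[0,T]\times\mathcal P_p(\mathbb{R}^d)$ and all $\Gamma\in\Pi(\mu(dx)\psi_x(dz),\mu'(dy))$, $$U(t',\mu')\le U(t,\mu)+\theta(t'-t)+\int_{\mathbb{R}^{3d}}z\cdot(y-x)\,\Gamma(dx,dz,dy)+\big(|t'-t|+\tilde C_p(\Gamma)\big)\,\omega\big(|t'-t|+\tilde C_p(\Gamma)\big).$$ $\partial^-V(t,\mu)$ is the set of $(-\theta,x\mapsto(-\mathrm{Id})_\#\psi_x)$ with $(\theta,\psi)\in\partial^+(-V)(t,\mu)$. An upper (resp.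 lower) semi-continuous $U$ is a viscosity sub-solution (resp. super-solution) if for any $t\in(0,T]$, $\mu\in\mathcal P_p(\mathbb{R}^d)$ and $(\theta,\psi)\in\partial^+U(t,\mu)$ (resp. $\partial^-U(t,\mu)$), $$\theta+\int_{\mathbb{R}^{2d}}H(x,z,\mu)\,\psi_x(dz)\mu(dx)\le0\quad(\text{resp. }\ge0).$$ *)

theory Defs
  imports "HOL-Probability.Probability"
begin

definition modulus_of_continuity :: "(real \<Rightarrow> real) \<Rightarrow> bool" where
  "modulus_of_continuity \<omega> \<longleftrightarrow>
     continuous_on {0..} \<omega> \<and> concave_on {0..} \<omega> \<and> mono_on {0..} \<omega> \<and> \<omega> 0 = 0 \<and>
     (\<forall>k. (deriv ^^ k) \<omega> differentiable_on {0<..})"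

definition conj_exponent :: "real \<Rightarrow> real" where
  "conj_exponent p = p / (p - 1)"

definition Pp :: "real \<Rightarrow> 'a::euclidean_space measure set" where
  "Pp p = {\<mu>. prob_space \<mu> \<and> sets \<mu> = sets borel \<and> integrable \<mu> (\<lambda>x. norm x powr p)}"

definition couplings :: "'a measure \<Rightarrow> 'b measure \<Rightarrow> ('a \<times> 'b) measure set" where
  "couplings M N =
     {\<Gamma>. prob_space \<Gamma> \<and> sets \<Gamma> = sets (M \<Otimes>\<^sub>M N) \<and> distr \<Gamma> M fst = M \<and> distr \<Gamma> N snd = N}"

(* Only used for measures in Pp p, where the infimum ranges over a nonempty set of
   nonnegative reals and all the integrals are finite. *)
definition wasserstein :: "real \<Rightarrow> 'a::euclidean_space measure \<Rightarrow> 'a measure \<Rightarrow> real" where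
  "wasserstein p \<mu> \<nu> =
     (INF \<gamma> \<in> couplings \<mu> \<nu>. \<integral>(x, y). norm (x - y) powr p \<partial>\<gamma>) powr (1 / p)"

(* The Borel sigma-algebra of the weak topology on the probability measures on a Euclidean
   space is the one generated by the evaluations \<mu> \<mapsto> \<mu>(A), that is, prob_algebra borel. *)
definition kernels :: "('a::euclidean_space \<Rightarrow> 'a measure) set" where
  "kernels = borel \<rightarrow>\<^sub>M prob_algebra borel"

(* The measure \<mu>(dx) \<psi>_x(dz) on pairs (x, z). *)
definition kernel_joint ::
    "'a::euclidean_space measure \<Rightarrow> ('a \<Rightarrow> 'a measure) \<Rightarrow> ('a \<times> 'a) measure" where
  "kernel_joint \<mu> \<psi> = \<mu> \<bind> (\<lambda>x. distr (\<psi> x) (borel \<Otimes>\<^sub>M borel) (Pair x))"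

lemma emeasure_kernel_joint:
  fixes \<mu> :: "'a::euclidean_space measure"
  assumes "prob_space \<mu>" "sets \<mu> = sets borel" "\<psi> \<in> kernels" "A \<in> sets borel" "B \<in> sets borel"
  shows "emeasure (kernel_joint \<mu> \<psi>) (A \<times> B) = (\<integral>\<^sup>+x\<in>A. emeasure (\<psi> x) B \<partial>\<mu>)"
proof -
  interpret prob_space \<mu> by fact
  have psi [measurable]: "\<psi> \<in> borel \<rightarrow>\<^sub>M subprob_algebra borel"
    using assms(3) measurable_prob_algebraD unfolding kernels_def by blast
  have psi_sets [simp]: "sets (\<psi> x) = sets borel" for x
    using measurable_space[OF psi, of x] by (simp add: space_subprob_algebra)
  have [simp]: "space (\<psi> x) = UNIV" for x
    using sets_eq_imp_space_eq[OF psi_sets[of x]] by simp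
  note [measurable_cong] = assms(2)
  have m: "(\<lambda>x. distr (\<psi> x) (borel \<Otimes>\<^sub>M borel) (Pair x)) \<in> \<mu> \<rightarrow>\<^sub>M subprob_algebra (borel \<Otimes>\<^sub>M borel)"
    by (rule measurable_distr2[where M = borel]) measurable
  have AB: "A \<times> B \<in> sets (borel \<Otimes>\<^sub>M (borel :: 'a measure))"
    using assms(4,5) by simp
  have "emeasure (distr (\<psi> x) (borel \<Otimes>\<^sub>M borel) (Pair x)) (A \<times> B)
          = emeasure (\<psi> x) B * indicator A x" for x
  proof -
    have "Pair x \<in> \<psi> x \<rightarrow>\<^sub>M borel \<Otimes>\<^sub>M borel"
      by (subst measurable_cong_sets[OF psi_sets refl]) simp
    then show ?thesis
      by (subst emeasure_distr[OF _ AB]) (auto simp: indicator_def vimage_def)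
  qed
  then show ?thesis
    unfolding kernel_joint_def by (subst emeasure_bind[OF not_empty m AB]) simp
qed

(* Here \<Gamma> is a measure on ((x, z), y), where x, z and y are the three coordinates in the
   order of \<Gamma>(dx, dz, dy). *)
definition Ctilde :: "real \<Rightarrow> (('a::euclidean_space \<times> 'a) \<times> 'a) measure \<Rightarrow> real" where
  "Ctilde p \<Gamma> = (\<integral>((x, z), y). norm (x - y) powr p \<partial>\<Gamma>) powr (1 / p)"

definition superdiff ::
    "real \<Rightarrow> real \<Rightarrow> (real \<Rightarrow> 'a::euclidean_space measure \<Rightarrow> real) \<Rightarrow> real \<Rightarrow> 'a measure
      \<Rightarrow> (real \<times> ('a \<Rightarrow> 'a measure)) set" where
  "superdiff p T U t \<mu> =
     {(\<theta>, \<psi>). \<psi> \<in> kernels \<and>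
        integrable (kernel_joint \<mu> \<psi>) (\<lambda>(x, z). norm z powr conj_exponent p) \<and>
        (\<exists>\<omega>. modulus_of_continuity \<omega> \<and>
          (\<forall>t'\<in>{0..T}. \<forall>\<mu>'\<in>Pp p. \<forall>\<Gamma>\<in>couplings (kernel_joint \<mu> \<psi>) \<mu>'.
             U t' \<mu>' \<le> U t \<mu> + \<theta> * (t' - t) + (\<integral>((x, z), y). z \<bullet> (y - x) \<partial>\<Gamma>)
                        + (\<bar>t' - t\<bar> + Ctilde p \<Gamma>) * \<omega> (\<bar>t' - t\<bar> + Ctilde p \<Gamma>)))}"

definition subdiff ::
    "real \<Rightarrow> real \<Rightarrow> (real \<Rightarrow> 'a::euclidean_space measure \<Rightarrow> real) \<Rightarrow> real \<Rightarrow> 'a measure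
      \<Rightarrow> (real \<times> ('a \<Rightarrow> 'a measure)) set" where
  "subdiff p T V t \<mu> =
     {(- \<theta>, \<lambda>x. distr (\<psi> x) borel uminus) | \<theta> \<psi>. (\<theta>, \<psi>) \<in> superdiff p T (\<lambda>s \<nu>. - V s \<nu>) t \<mu>}"

(* Continuity notions on [0,T] \<times> Pp p refer to the distance |t' - t| + W_p(\<mu>, \<mu>'). *)

definition usc_on_Pp ::
    "real \<Rightarrow> real \<Rightarrow> (real \<Rightarrow> 'a::euclidean_space measure \<Rightarrow> real) \<Rightarrow> bool" where
  "usc_on_Pp p T U \<longleftrightarrow>
     (\<forall>t\<in>{0..T}. \<forall>\<mu>\<in>Pp p. \<forall>\<epsilon>>0. \<exists>\<delta>>0. \<forall>t'\<in>{0..T}. \<forall>\<mu>'\<in>Pp p.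
        \<bar>t' - t\<bar> + wasserstein p \<mu> \<mu>' < \<delta> \<longrightarrow> U t' \<mu>' < U t \<mu> + \<epsilon>)"

definition lsc_on_Pp ::
    "real \<Rightarrow> real \<Rightarrow> (real \<Rightarrow> 'a::euclidean_space measure \<Rightarrow> real) \<Rightarrow> bool" where
  "lsc_on_Pp p T V \<longleftrightarrow>
     (\<forall>t\<in>{0..T}. \<forall>\<mu>\<in>Pp p. \<forall>\<epsilon>>0. \<exists>\<delta>>0. \<forall>t'\<in>{0..T}. \<forall>\<mu>'\<in>Pp p.
        \<bar>t' - t\<bar> + wasserstein p \<mu> \<mu>' < \<delta> \<longrightarrow> V t \<mu> - \<epsilon> < V t' \<mu>')"

definition uniformly_continuous_on_Pp ::
    "real \<Rightarrow> real \<Rightarrow> (real \<Rightarrow> 'a::euclidean_space measure \<Rightarrow> real) \<Rightarrow> bool" where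
  "uniformly_continuous_on_Pp p T U \<longleftrightarrow>
     (\<forall>\<epsilon>>0. \<exists>\<delta>>0. \<forall>t\<in>{0..T}. \<forall>\<mu>\<in>Pp p. \<forall>t'\<in>{0..T}. \<forall>\<mu>'\<in>Pp p.
        \<bar>t' - t\<bar> + wasserstein p \<mu> \<mu>' < \<delta> \<longrightarrow> \<bar>U t' \<mu>' - U t \<mu>\<bar> < \<epsilon>)"

definition bounded_on_Pp ::
    "real \<Rightarrow> real \<Rightarrow> (real \<Rightarrow> 'a::euclidean_space measure \<Rightarrow> real) \<Rightarrow> bool" where
  "bounded_on_Pp p T U \<longleftrightarrow> bounded ((\<lambda>(t, \<mu>). U t \<mu>) ` ({0..T} \<times> Pp p))"

definition viscosity_subsolution ::
    "real \<Rightarrow> real \<Rightarrow> ('a::euclidean_space \<Rightarrow> 'a \<Rightarrow> 'a measure \<Rightarrow> real)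
      \<Rightarrow> (real \<Rightarrow> 'a measure \<Rightarrow> real) \<Rightarrow> bool" where
  "viscosity_subsolution p T H U \<longleftrightarrow>
     usc_on_Pp p T U \<and>
     (\<forall>t\<in>{0<..T}. \<forall>\<mu>\<in>Pp p. \<forall>(\<theta>, \<psi>)\<in>superdiff p T U t \<mu>.
        \<theta> + (\<integral>(x, z). H x z \<mu> \<partial>kernel_joint \<mu> \<psi>) \<le> 0)"

definition viscosity_supersolution ::
    "real \<Rightarrow> real \<Rightarrow> ('a::euclidean_space \<Rightarrow> 'a \<Rightarrow> 'a measure \<Rightarrow> real)
      \<Rightarrow> (real \<Rightarrow> 'a measure \<Rightarrow> real) \<Rightarrow> bool" where
  "viscosity_supersolution p T H V \<longleftrightarrow>
     lsc_on_Pp p T V \<and>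
     (\<forall>t\<in>{0<..T}. \<forall>\<mu>\<in>Pp p. \<forall>(\<theta>, \<psi>)\<in>subdiff p T V t \<mu>.
        \<theta> + (\<integral>(x, z). H x z \<mu> \<partial>kernel_joint \<mu> \<psi>) \<ge> 0)"

end

theory Submission
  imports Defs
begin

text \<open>The proof doubles the variables, but it works with random variables instead of measures. A function of
measures becomes a function of random variables \<open>X\<close> through the law of \<open>X\<close>, and the penalty is
\<open>E(norm (X - Y) powr p) / \<epsilon>\<close>, which dominates the \<open>p\<close>-th power of the Wasserstein distance of the laws
(\<open>wasserstein_law_le\<close>). This penalty is smooth in \<open>X\<close> and in \<open>Y\<close>, with the gradients \<open>Q\<close> and \<open>- Q\<close> for
\<open>Q = p * norm (X - Y) powr (p - 2) * (X - Y) / \<epsilon>\<close>, so no optimal plans have to be chosen.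

Superdifferentials of functions of measures are tested against all couplings \<open>\<Gamma>\<close>. To see all of them with
random variables on one fixed space, the space is the product of uncountably many unit intervals:
each random variable leaves a uniform coordinate independent of it, and disintegration
(\<open>disintegration_unif01\<close>) turns that coordinate into any prescribed conditional law
(\<open>cube_realise_coupling\<close>). The same disintegration turns the joint law of \<open>X\<close> and
a gradient into a kernel \<open>\<psi>\<close> (\<open>kernel_exists\<close>). So maximality among random variables gives elements of the
superdifferential (\<open>superdiff_of_touching\<close>).

Maxima need not exist, as bounded sets of random variables are not compact. The
variational principle \<open>smooth_variational_principle\<close> produces one after subtracting
\<open>\<Sum>i. (1/2) ^ i * E(norm (X - A i) powr p)\<close> and similar terms for the other variables, of total size
at most \<open>\<eta>\<close>. Such a sum is still differentiable in \<open>L\<^sup>p\<close>, because \<open>norm x powr p\<close> has a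
Taylor expansion with a remainder of order \<open>1 + min 1 (p - 1)\<close> (\<open>norm_powr_expansion\<close>), and its gradient
tends to 0 with \<open>\<eta>\<close> in the dual space (\<open>grad_series_Lp\<close>).

Suppose that \<open>U - V\<close> is positive somewhere, and let \<open>l * t\<close> with a small \<open>l > 0\<close> be subtracted as well. At the maximum,
\<open>t\<close> and \<open>s\<close> are positive because of the initial condition, and the two viscosity inequalities, subtracted from each
other, bound \<open>l\<close> by three kinds of terms. The time derivatives and momenta of the perturbation
vanish with \<open>\<eta>\<close>, the momenta by the bound on \<open>D\<^sub>q H\<close> (\<open>H_expected_perturbation\<close>). What is left is the difference of
the integrals of \<open>H\<close> at \<open>X\<close> and at \<open>Y\<close> with the same momentum \<open>Q\<close>, which by the modulus of continuity is
controlled by the distance and the penalty (\<open>H_expected_shift\<close>). Both vanish with \<open>\<epsilon>\<close> since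
\<open>U\<close> and \<open>V\<close> are uniformly continuous. Choosing first \<open>\<epsilon>\<close> and then \<open>\<eta>\<close> small contradicts \<open>l > 0\<close>.\<close>

section \<open>The p-th power of a norm\<close>

lemma powr_mult_le_powr_add:
  fixes x y s t :: real
  assumes "0 \<le> x" "0 \<le> y" "0 \<le> s" "0 \<le> t"
  shows "x powr s * y powr t \<le> x powr (s + t) + y powr (s + t)"
proof (cases "x \<le> y")
  case True
  have "x powr s * y powr t \<le> y powr s * y powr t"
    using assms True by (intro mult_right_mono powr_mono2) auto
  then show ?thesis by (simp add: powr_add[symmetric] add_increasing)
next
  case False
  have "x powr s * y powr t \<le> x powr s * x powr t"
    using assms False by (intro mult_left_mono powr_mono2) auto
  then show ?thesis by (simp add: powr_add[symmetric] add_increasing2)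
qed

lemma powr_add_le:
  fixes x y q :: real
  assumes "0 \<le> x" "0 \<le> y" "0 \<le> q"
  shows "(x + y) powr q \<le> 2 powr q * (x powr q + y powr q)"
proof -
  have "(x + y) powr q \<le> (2 * max x y) powr q"
    using assms by (intro powr_mono2) auto
  also have "\<dots> = 2 powr q * max x y powr q" using assms by (simp add: powr_mult)
  also have "\<dots> \<le> 2 powr q * (x powr q + y powr q)"
    by (intro mult_left_mono) (auto simp: max_def)
  finally show ?thesis .
qed

text \<open>Integrated, this replaces Hoelder's inequality: if the \<open>q\<close>-th moment of \<open>u\<close> is at most
\<open>r powr q\<close>, then the right-hand side has an expectation of order \<open>r powr s\<close>.\<close>

lemma mult_powr_le_scaled:
  fixes u v r q s :: real
  assumes "0 \<le> u" "0 \<le> v" "0 < r" "0 < s" "s \<le> q"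
  shows "u powr s * v powr (q - s) \<le> r powr s * ((u / r) powr q + v powr q)"
proof -
  have "u powr s * v powr (q - s) = r powr s * ((u / r) powr s * v powr (q - s))"
    using assms by (simp add: powr_divide)
  also have "\<dots> \<le> r powr s * ((u / r) powr q + v powr q)"
    using powr_mult_le_powr_add[of "u / r" v s "q - s"] assms by (intro mult_left_mono) auto
  finally show ?thesis .
qed

text \<open>Radial projection is Lipschitz away from the origin. Together with the radial estimate
\<open>powr_diff_le\<close> it controls the map \<open>pgrad\<close> in polar coordinates.\<close>

lemma norm_divide_diff_le:
  fixes a b :: "'a::real_inner"
  assumes "a \<noteq> 0" "b \<noteq> 0"
  shows "norm a * norm (b /\<^sub>R norm b - a /\<^sub>R norm a) \<le> 2 * norm (b - a)"
proof -
  have "norm a *\<^sub>R (b /\<^sub>R norm b - a /\<^sub>R norm a) = (b - a) + (norm a - norm b) *\<^sub>R (b /\<^sub>R norm b)"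
    using assms by (simp add: algebra_simps scaleR_diff_left)
  then have "norm a * norm (b /\<^sub>R norm b - a /\<^sub>R norm a)
      = norm ((b - a) + (norm a - norm b) *\<^sub>R (b /\<^sub>R norm b))"
    by (metis norm_scaleR abs_norm_cancel)
  also have "\<dots> \<le> norm (b - a) + \<bar>norm a - norm b\<bar>"
    using norm_triangle_ineq[of "b - a" "(norm a - norm b) *\<^sub>R (b /\<^sub>R norm b)"] assms
    by (simp add: abs_mult del: scaleR_scaleR)
  also have "\<dots> \<le> 2 * norm (b - a)"
    using norm_triangle_ineq3[of a b] by (simp add: norm_minus_commute)
  finally show ?thesis .
qed

lemma powr_diff_le:
  fixes x y s :: real
  assumes "0 \<le> x" "x \<le> y" "0 < s"
  shows "y powr s - x powr s \<le> max 1 s * (y - x) powr min 1 s * y powr (s - min 1 s)"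
proof (cases "y = 0 \<or> x = y")
  case True then show ?thesis using assms by auto
next
  case False
  then have y: "y > 0" and xy: "x < y" using assms by auto
  show ?thesis
  proof (cases "s \<le> 1")
    case True
    define u where "u = x / y"
    have u: "0 \<le> u" "u < 1" using assms y xy by (auto simp: u_def)
    have 1: "u \<le> u powr s"
      using u assms True powr_mono_both'[of s 1 u u] by (cases "u = 0") (auto)
    have 2: "1 - u \<le> (1 - u) powr s"
      using u assms True powr_mono_both'[of s 1 "1 - u" "1 - u"] by auto
    have "y powr s - x powr s = y powr s * (1 - u powr s)"
      using assms y by (simp add: u_def powr_divide algebra_simps)
    also have "\<dots> \<le> y powr s * (1 - u) powr s"
      using 1 2 by (intro mult_left_mono) auto
    also have "\<dots> = (y - x) powr s"
      using y u assms(1) xy by (simp flip: powr_mult) (simp add: u_def algebra_simps)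
    finally show ?thesis using True y by simp
  next
    case False
    then have s: "s > 1" by simp
    define u where "u = x / y"
    have u: "0 \<le> u" "u < 1" using assms y xy by (auto simp: u_def)
    have "1 - u powr s \<le> s * (1 - u)"
    proof -
      have "u * 1 \<le> u powr s / s + 1 powr (s / (s - 1)) / (s / (s - 1))"
        using s u by (intro Youngs_inequality) (auto simp: field_simps)
      then have "s * u \<le> s * (u powr s / s + (s - 1) / s)" using s by (intro mult_left_mono) auto
      also have "\<dots> = u powr s + (s - 1)" using s by (simp add: distrib_left)
      finally show ?thesis by (simp add: algebra_simps)
    qed
    have "y powr s - x powr s = y powr s * (1 - u powr s)"
      using assms y by (simp add: u_def powr_divide algebra_simps)
    also have "\<dots> \<le> y powr s * (s * (1 - u))"
      using \<open>1 - u powr s \<le> s * (1 - u)\<close> by (intro mult_left_mono) auto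
    also have "\<dots> = s * (y - x) * y powr (s - 1)"
      using y by (simp add: u_def field_simps powr_diff)
    finally show ?thesis using s xy by (simp add: mult.assoc)
  qed
qed
text \<open>The gradient of \<open>a \<mapsto> norm a powr p\<close>. At the origin the factor is \<open>0 powr (p - 2) = 0\<close>, so the
formula gives the right value there for every \<open>p > 1\<close>.\<close>

definition pgrad :: "real \<Rightarrow> 'a::real_inner \<Rightarrow> 'a" where
  "pgrad p a = (p * norm a powr (p - 2)) *\<^sub>R a"

lemma norm_pgrad: "0 \<le> p \<Longrightarrow> norm (pgrad p a) = p * norm a powr (p - 1)"
  by (cases "a = 0") (auto simp: pgrad_def powr_diff power2_eq_square)

lemma pgrad_minus: "pgrad p (- a) = - pgrad p a"
  by (simp add: pgrad_def)

lemma pgrad_inner_self: "0 \<le> p \<Longrightarrow> pgrad p a \<bullet> a = p * norm a powr p"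
  by (cases "a = 0") (auto simp: pgrad_def powr_diff dot_square_norm)

text \<open>The tangent inequality of a convex function. By homogeneity it is Young's inequality for
\<open>norm b powr (p - 1)\<close> and \<open>norm a\<close>.\<close>

lemma norm_powr_convex:
  fixes a b :: "'a::real_inner"
  assumes p: "1 < p"
  shows "norm b powr p - norm a powr p \<le> pgrad p b \<bullet> (b - a)"
proof -
  have "pgrad p b \<bullet> a \<le> norm (pgrad p b) * norm a" by (rule norm_cauchy_schwarz)
  also have "\<dots> = p * (norm a * norm b powr (p - 1))" using p by (simp add: norm_pgrad)
  also have "norm a * norm b powr (p - 1)
      \<le> norm a powr p / p + (norm b powr (p - 1)) powr (p / (p - 1)) / (p / (p - 1))"
    using p by (intro Youngs_inequality) (auto simp: field_simps)
  also have "\<dots> = norm a powr p / p + norm b powr p * (p - 1) / p"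
    using p by (simp add: powr_powr)
  also have "p * \<dots> = norm a powr p + norm b powr p * (p - 1)" using p by (simp add: field_simps)
  finally show ?thesis using p by (simp add: inner_diff_right pgrad_inner_self algebra_simps)
qed

text \<open>The gradient is Hoelder continuous with exponent \<open>p - 1\<close> if \<open>p \<le> 2\<close> and locally Lipschitz if
\<open>p \<ge> 2\<close>; the exponent \<open>min 1 (p - 1)\<close> covers both. Write \<open>a\<close> and \<open>b\<close> as length times
direction: the change of length is \<open>powr_diff_le\<close>. The change of direction is at most 2, which
suffices if \<open>b - a\<close> is longer than \<open>a\<close>, and otherwise \<open>norm_divide_diff_le\<close> applies.\<close>

lemma norm_pgrad_diff_le_aux:
  fixes a b :: "'a::real_inner"
  assumes p: "1 < p" and le: "norm a \<le> norm b"
  defines "\<alpha> \<equiv> min 1 (p - 1)"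
  shows "norm (pgrad p b - pgrad p a)
     \<le> p * (p + 2) * (norm (b - a) powr \<alpha> * norm b powr (p - 1 - \<alpha>))"
proof -
  define s where "s = p - 1"
  have s: "0 < s" using p by (simp add: s_def)
  have al: "0 < \<alpha>" "\<alpha> \<le> 1" "\<alpha> \<le> s" "\<alpha> = min 1 s" using p by (auto simp: \<alpha>_def s_def)
  show ?thesis
  proof (cases "b = 0 \<or> a = b")
    case True then show ?thesis using le p by (auto simp: pgrad_def)
  next
    case False
    then have b: "b \<noteq> 0" and nab: "a \<noteq> b" by auto
    have first: "norm b powr s - norm a powr s \<le> p * (norm (b - a) powr \<alpha> * norm b powr (s - \<alpha>))"
    proof -
      have "norm b powr s - norm a powr s
          \<le> max 1 s * (norm b - norm a) powr \<alpha> * norm b powr (s - \<alpha>)"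
        using powr_diff_le[of "norm a" "norm b" s] le s al by simp
      also have "\<dots> \<le> p * norm (b - a) powr \<alpha> * norm b powr (s - \<alpha>)"
        using le p al norm_triangle_ineq2[of b a]
        by (intro mult_right_mono mult_mono powr_mono2) (auto simp: s_def)
      finally show ?thesis by (simp add: mult.assoc)
    qed
    show ?thesis
    proof (cases "a = 0")
      case True
      then show ?thesis using first p s
        by (simp add: norm_pgrad s_def[symmetric] pgrad_def[of p 0] mult.assoc powr_add[symmetric])
           (use p in \<open>simp add: distrib_right\<close>)
    next
      case False
      have pg: "pgrad p x = p *\<^sub>R (norm x powr s *\<^sub>R (x /\<^sub>R norm x))" if "x \<noteq> 0" for x :: 'a
        using that by (simp add: pgrad_def s_def powr_diff power2_eq_square field_simps)
      have second: "norm a powr s * norm (b /\<^sub>R norm b - a /\<^sub>R norm a)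
          \<le> 2 * (norm (b - a) powr \<alpha> * norm b powr (s - \<alpha>))"
      proof -
        have "norm a powr s * norm (b /\<^sub>R norm b - a /\<^sub>R norm a)
            \<le> 2 * (norm (b - a) powr \<alpha> * norm a powr (s - \<alpha>))"
        proof (cases "norm a \<le> norm (b - a)")
          case True
          have "norm (b /\<^sub>R norm b - a /\<^sub>R norm a) \<le> 2"
            by (rule order_trans[OF norm_triangle_ineq4]) (use False b in simp)
          then have "norm a powr s * norm (b /\<^sub>R norm b - a /\<^sub>R norm a) \<le> norm a powr s * 2"
            by (intro mult_left_mono) auto
          also have "\<dots> = 2 * (norm a powr \<alpha> * norm a powr (s - \<alpha>))"
            by (simp add: powr_add[symmetric])
          also have "\<dots> \<le> 2 * (norm (b - a) powr \<alpha> * norm a powr (s - \<alpha>))"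
            using True al by (intro mult_left_mono mult_right_mono powr_mono2) auto
          finally show ?thesis .
        next
          case F: False
          have h: "0 < norm (b - a)" using nab by auto
          have "norm a powr s * norm (b /\<^sub>R norm b - a /\<^sub>R norm a)
            = norm a powr (s - 1) * (norm a * norm (b /\<^sub>R norm b - a /\<^sub>R norm a))"
            using False by (simp add: powr_diff)
          also have "\<dots> \<le> norm a powr (s - 1) * (2 * norm (b - a))"
            using norm_divide_diff_le[OF False b] by (intro mult_left_mono) auto
          also have "\<dots> = 2 * (norm a powr (s - 1) * (norm (b - a) powr \<alpha> * norm (b - a) powr (1 - \<alpha>)))"
            using h by (simp add: powr_add[symmetric])
          also have "\<dots> \<le> 2 * (norm a powr (s - 1) * (norm (b - a) powr \<alpha> * norm a powr (1 - \<alpha>)))"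
            using F al by (intro mult_left_mono powr_mono2) auto
          also have "\<dots> = 2 * (norm (b - a) powr \<alpha> * norm a powr (s - \<alpha>))"
            by (simp add: powr_add[symmetric] mult.left_commute)
          finally show ?thesis .
        qed
        also have "\<dots> \<le> 2 * (norm (b - a) powr \<alpha> * norm b powr (s - \<alpha>))"
          using le al by (intro mult_left_mono powr_mono2) auto
        finally show ?thesis .
      qed
      have "pgrad p b - pgrad p a = p *\<^sub>R ((norm b powr s - norm a powr s) *\<^sub>R (b /\<^sub>R norm b)
          + norm a powr s *\<^sub>R (b /\<^sub>R norm b - a /\<^sub>R norm a))"
        by (simp only: pg[OF b] pg[OF False]) (simp add: algebra_simps)
      then have "norm (pgrad p b - pgrad p a) = p * norm ((norm b powr s - norm a powr s) *\<^sub>R (b /\<^sub>R norm b)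
          + norm a powr s *\<^sub>R (b /\<^sub>R norm b - a /\<^sub>R norm a))"
        using p by (simp del: scaleR_scaleR)
      also have "\<dots> \<le> p * (\<bar>norm b powr s - norm a powr s\<bar>
          + norm a powr s * norm (b /\<^sub>R norm b - a /\<^sub>R norm a))"
        using p b by (intro mult_left_mono order_trans[OF norm_triangle_ineq]) (auto simp del: scaleR_scaleR)
      also have "\<bar>norm b powr s - norm a powr s\<bar> = norm b powr s - norm a powr s"
        using le s by (simp add: powr_mono2)
      also have "p * (norm b powr s - norm a powr s
          + norm a powr s * norm (b /\<^sub>R norm b - a /\<^sub>R norm a))
          \<le> p * ((p + 2) * (norm (b - a) powr \<alpha> * norm b powr (s - \<alpha>)))"
        using first second p by (intro mult_left_mono) (auto simp: algebra_simps)
      finally show ?thesis by (simp add: s_def mult.assoc)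
    qed
  qed
qed

lemma norm_pgrad_diff_le:
  fixes a h :: "'a::real_inner"
  assumes p: "1 < p"
  defines "\<alpha> \<equiv> min 1 (p - 1)"
  shows "norm (pgrad p (a + h) - pgrad p a)
     \<le> p * (p + 2) * (norm h powr \<alpha> * (norm a + norm h) powr (p - 1 - \<alpha>))"
proof -
  have al: "\<alpha> \<le> p - 1" by (auto simp: \<alpha>_def)
  define m where "m = max (norm a) (norm (a + h))"
  have m: "0 \<le> m" "m \<le> norm a + norm h"
    using norm_triangle_ineq[of a h] by (auto simp: m_def le_max_iff_disj)
  have "norm (pgrad p (a + h) - pgrad p a) \<le> p * (p + 2) * (norm h powr \<alpha> * m powr (p - 1 - \<alpha>))"
  proof (cases "norm a \<le> norm (a + h)")
    case True
    then show ?thesis using norm_pgrad_diff_le_aux[OF p True] by (simp add: m_def \<alpha>_def max_def)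
  next
    case False
    then have "norm (a + h) \<le> norm a" by simp
    then show ?thesis using norm_pgrad_diff_le_aux[OF p, of "a + h" a]
      by (simp add: m_def \<alpha>_def max_def norm_minus_commute)
  qed
  also have "\<dots> \<le> p * (p + 2) * (norm h powr \<alpha> * (norm a + norm h) powr (p - 1 - \<alpha>))"
    using m al p by (intro mult_left_mono powr_mono2) auto
  finally show ?thesis .
qed

text \<open>A one-sided Taylor expansion: convexity bounds the increment by the gradient at the end point,
and the gradient is Hoelder continuous. The free scale \<open>r\<close> is meant to be the \<open>L\<^sup>p\<close> size of
\<open>h\<close>, so that the remainder has an expectation of order \<open>r powr (1 + min 1 (p - 1))\<close>.\<close>

lemma norm_powr_expansion:
  fixes a h :: "'a::real_inner"
  assumes p: "1 < p" and r: "0 < r"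
  shows "norm (a + h) powr p \<le> norm a powr p + pgrad p a \<bullet> h
     + p * (p + 2) * r powr (1 + min 1 (p - 1)) * ((norm h / r) powr p + (norm a + norm h) powr p)"
proof -
  define \<alpha> where "\<alpha> = min 1 (p - 1)"
  have al: "0 < \<alpha>" "\<alpha> \<le> p - 1" using p by (auto simp: \<alpha>_def)
  have "norm (a + h) powr p - norm a powr p \<le> pgrad p (a + h) \<bullet> h"
    using norm_powr_convex[OF p, of "a + h" a] by simp
  also have "\<dots> = pgrad p a \<bullet> h + (pgrad p (a + h) - pgrad p a) \<bullet> h"
    by (simp add: inner_diff_left)
  also have "(pgrad p (a + h) - pgrad p a) \<bullet> h \<le> norm (pgrad p (a + h) - pgrad p a) * norm h"
    by (rule norm_cauchy_schwarz)
  also have "\<dots> \<le> p * (p + 2) * (norm h powr \<alpha> * (norm a + norm h) powr (p - 1 - \<alpha>)) * norm h"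
    using norm_pgrad_diff_le[OF p, of a h] by (intro mult_right_mono) (auto simp: \<alpha>_def)
  also have "\<dots> = p * (p + 2) * (norm h powr (1 + \<alpha>) * (norm a + norm h) powr (p - (1 + \<alpha>)))"
    using al by (cases "h = 0") (auto simp: powr_add algebra_simps)
  also have "\<dots> \<le> p * (p + 2) * (r powr (1 + \<alpha>) * ((norm h / r) powr p + (norm a + norm h) powr p))"
    using p r al by (intro mult_left_mono mult_powr_le_scaled) auto
  finally show ?thesis by (simp add: \<alpha>_def mult.assoc)
qed

lemma norm_powr_diff_le:
  fixes a b :: "'a::real_inner"
  assumes p: "1 < p" and r: "0 < r"
  shows "norm b powr p - norm a powr p \<le> p * r * ((norm (b - a) / r) powr p + norm b powr p)"
proof -
  have "norm b powr p - norm a powr p \<le> pgrad p b \<bullet> (b - a)" by (rule norm_powr_convex[OF p])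
  also have "\<dots> \<le> norm (pgrad p b) * norm (b - a)" by (rule norm_cauchy_schwarz)
  also have "\<dots> = p * (norm (b - a) powr 1 * norm b powr (p - 1))" using p by (simp add: norm_pgrad)
  also have "\<dots> \<le> p * (r powr 1 * ((norm (b - a) / r) powr p + norm b powr p))"
    using p r by (intro mult_left_mono mult_powr_le_scaled) auto
  finally show ?thesis using r by simp
qed

section \<open>Random variables with a finite p-th moment\<close>

definition Lp :: "'w measure \<Rightarrow> real \<Rightarrow> ('w \<Rightarrow> 'a::euclidean_space) set" where
  "Lp M p = {X \<in> borel_measurable M. integrable M (\<lambda>w. norm (X w) powr p)}"

text \<open>The \<open>p\<close>-th power of the \<open>L\<^sup>p\<close> distance. The power is kept because it is the quantity that
is differentiable; the quasi-triangle inequality \<open>pdist_triangle\<close> does the work of Minkowski's.\<close>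

definition pdist :: "'w measure \<Rightarrow> real \<Rightarrow> ('w \<Rightarrow> 'a::euclidean_space) \<Rightarrow> ('w \<Rightarrow> 'a) \<Rightarrow> real" where
  "pdist M p X Y = (\<integral>w. norm (X w - Y w) powr p \<partial>M)"

lemma Lp_add:
  assumes "X \<in> Lp M p" "Y \<in> Lp M p" "0 \<le> p"
  shows "(\<lambda>w. X w + Y w) \<in> Lp M p"
proof -
  have [measurable]: "X \<in> borel_measurable M" "Y \<in> borel_measurable M"
    using assms by (auto simp: Lp_def)
  have "integrable M (\<lambda>w. 2 powr p * (norm (X w) powr p + norm (Y w) powr p))"
    using assms by (auto simp: Lp_def)
  then have "integrable M (\<lambda>w. norm (X w + Y w) powr p)"
  proof (rule Bochner_Integration.integrable_bound)
    have "norm (X w + Y w) powr p \<le> 2 powr p * (norm (X w) powr p + norm (Y w) powr p)" for w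
      using powr_mono2[OF \<open>0 \<le> p\<close> _ norm_triangle_ineq[of "X w" "Y w"]] assms(3)
        powr_add_le[of "norm (X w)" "norm (Y w)" p] by auto
    then show "AE w in M. norm (norm (X w + Y w) powr p)
        \<le> norm (2 powr p * (norm (X w) powr p + norm (Y w) powr p))" by auto
  qed measurable
  then show ?thesis by (simp add: Lp_def)
qed

lemma Lp_minus: "X \<in> Lp M p \<Longrightarrow> (\<lambda>w. - X w) \<in> Lp M p"
  by (auto simp: Lp_def)

lemma Lp_diff: "X \<in> Lp M p \<Longrightarrow> Y \<in> Lp M p \<Longrightarrow> 0 \<le> p \<Longrightarrow> (\<lambda>w. X w - Y w) \<in> Lp M p"
  using Lp_add[of X M p "\<lambda>w. - Y w"] Lp_minus[of Y] by simp

lemma Lp_integrable_diff: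
  "X \<in> Lp M p \<Longrightarrow> Y \<in> Lp M p \<Longrightarrow> 0 \<le> p \<Longrightarrow> integrable M (\<lambda>w. norm (X w - Y w) powr p)"
  using Lp_diff[of X M p Y] by (simp add: Lp_def)

lemma pdist_nonneg: "0 \<le> pdist M p X Y"
  unfolding pdist_def by (rule integral_nonneg_AE) auto

lemma pdist_self [simp]: "pdist M p X X = 0"
  by (simp add: pdist_def)

lemma pdist_commute: "pdist M p X Y = pdist M p Y X"
  by (simp add: pdist_def norm_minus_commute)

lemma pdist_triangle:
  assumes "X \<in> Lp M p" "Y \<in> Lp M p" "Z \<in> Lp M p" "0 \<le> p"
  shows "pdist M p X Z \<le> 2 powr p * (pdist M p X Y + pdist M p Y Z)"
proof -
  have "norm (X w - Z w) powr p \<le> 2 powr p * (norm (X w - Y w) powr p + norm (Y w - Z w) powr p)" for w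
    using powr_mono2[OF \<open>0 \<le> p\<close> _ norm_triangle_ineq[of "X w - Y w" "Y w - Z w"]] assms(4)
      powr_add_le[of "norm (X w - Y w)" "norm (Y w - Z w)" p] by auto
  then have "pdist M p X Z \<le> (\<integral>w. 2 powr p * (norm (X w - Y w) powr p + norm (Y w - Z w) powr p) \<partial>M)"
    unfolding pdist_def by (intro integral_mono) (auto intro!: Lp_integrable_diff assms)
  also have "\<dots> = 2 powr p * (pdist M p X Y + pdist M p Y Z)"
    unfolding pdist_def using assms by (simp add: Lp_integrable_diff)
  finally show ?thesis .
qed

lemma pdist_diff_le:
  assumes "X \<in> Lp M p" "Y \<in> Lp M p" "W \<in> Lp M p" "1 < p" "0 < r" "pdist M p X Y \<le> r powr p"
  shows "pdist M p X W - pdist M p Y W \<le> p * r * (1 + pdist M p X W)"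
proof -
  have "norm (X w - W w) powr p \<le> norm (Y w - W w) powr p
      + p * r * (norm (X w - Y w) powr p / r powr p + norm (X w - W w) powr p)" for w
    using norm_powr_diff_le[OF assms(4,5), of "X w - W w" "Y w - W w"] assms(5)
    by (simp add: powr_divide)
  then have "pdist M p X W \<le> (\<integral>w. norm (Y w - W w) powr p
      + p * r * (norm (X w - Y w) powr p / r powr p + norm (X w - W w) powr p) \<partial>M)"
    unfolding pdist_def using assms
    by (intro integral_mono Bochner_Integration.integrable_add integrable_mult_right
        integrable_divide Lp_integrable_diff) auto
  also have "\<dots> = pdist M p Y W + p * r * (pdist M p X Y / r powr p + pdist M p X W)"
    unfolding pdist_def using assms by (simp add: Lp_integrable_diff)
  also have "\<dots> \<le> pdist M p Y W + p * r * (1 + pdist M p X W)"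
    using assms by (intro add_left_mono mult_left_mono add_right_mono) auto
  finally show ?thesis by simp
qed

lemma pdist_tendsto:
  assumes p: "1 < p" and X: "\<And>n. X n \<in> Lp M p" "Y \<in> Lp M p" "W \<in> Lp M p"
    and lim: "(\<lambda>n. pdist M p (X n) Y) \<longlonglongrightarrow> 0"
  shows "(\<lambda>n. pdist M p (X n) W) \<longlonglongrightarrow> pdist M p Y W"
proof (rule LIMSEQ_I)
  fix e :: real assume e: "0 < e"
  define A where "A = pdist M p Y W"
  define K where "K = p * (1 + A + 2 powr p * (1 + A))"
  have A: "0 \<le> A" by (simp add: A_def pdist_nonneg)
  then have K: "0 < K" using p by (auto simp: K_def intro!: mult_pos_pos add_pos_nonneg)
  define r where "r = min 1 (e / (2 * K))"
  have r: "0 < r" "r \<le> 1" "r * K < e" using e K by (auto simp: r_def min_def field_simps)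
  obtain N where N: "\<And>n. n \<ge> N \<Longrightarrow> pdist M p (X n) Y < r powr p"
    using LIMSEQ_D[OF lim, of "r powr p"] r by (auto simp: abs_of_nonneg[OF pdist_nonneg])
  show "\<exists>no. \<forall>n\<ge>no. norm (pdist M p (X n) W - pdist M p Y W) < e"
  proof (intro exI[of _ N] allI impI)
    fix n assume "n \<ge> N"
    then have d: "pdist M p (X n) Y \<le> r powr p" using N by force
    then have d': "pdist M p Y (X n) \<le> r powr p" by (simp add: pdist_commute)
    have r1: "r powr p \<le> 1" using r p powr_mono2[of p r 1] by simp
    have B: "pdist M p (X n) W \<le> 2 powr p * (1 + A)"
    proof -
      have "pdist M p (X n) W \<le> 2 powr p * (pdist M p (X n) Y + pdist M p Y W)"
        by (rule pdist_triangle) (use X p in auto)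
      also have "\<dots> \<le> 2 powr p * (1 + A)"
        using d r1 by (intro mult_left_mono) (auto simp: A_def)
      finally show ?thesis .
    qed
    have "pdist M p (X n) W - A \<le> p * r * (1 + pdist M p (X n) W)"
      unfolding A_def by (rule pdist_diff_le[OF X(1,2,3) p r(1) d])
    also have "\<dots> \<le> p * r * (1 + A + 2 powr p * (1 + A))"
      using B p r A by (intro mult_left_mono) auto
    also have "\<dots> = r * K" by (simp add: K_def)
    finally have 1: "pdist M p (X n) W - A < e" using r by simp
    have "A - pdist M p (X n) W \<le> p * r * (1 + A)"
      unfolding A_def by (rule pdist_diff_le[OF X(2,1,3) p r(1) d'])
    also have "\<dots> \<le> p * r * (1 + A + 2 powr p * (1 + A))"
      using p r A by (intro mult_left_mono) auto
    also have "\<dots> = r * K" by (simp add: K_def)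
    finally have "A - pdist M p (X n) W < e" using r by simp
    then show "norm (pdist M p (X n) W - pdist M p Y W) < e" using 1 by (auto simp: A_def)
  qed
qed

lemma integrable_nonneg_series:
  fixes f :: "nat \<Rightarrow> 'w \<Rightarrow> real"
  assumes int: "\<And>i. integrable M (f i)" and nn: "\<And>i w. 0 \<le> f i w"
    and sm: "summable (\<lambda>i. integral\<^sup>L M (f i))"
  shows "AE w in M. summable (\<lambda>i. f i w)"
    and "integrable M (\<lambda>w. \<Sum>i. f i w)"
    and "(\<integral>w. (\<Sum>i. f i w) \<partial>M) = (\<Sum>i. integral\<^sup>L M (f i))"
proof -
  have [measurable]: "f i \<in> borel_measurable M" for i using int by auto
  have "(\<integral>\<^sup>+w. (\<Sum>i. ennreal (f i w)) \<partial>M) = (\<Sum>i. \<integral>\<^sup>+w. ennreal (f i w) \<partial>M)"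
    by (rule nn_integral_suminf) measurable
  also have "\<dots> = (\<Sum>i. ennreal (integral\<^sup>L M (f i)))"
    by (intro suminf_cong nn_integral_eq_integral int) (simp add: nn)
  also have "\<dots> = ennreal (\<Sum>i. integral\<^sup>L M (f i))"
    by (intro suminf_ennreal2 sm integral_nonneg_AE) (auto simp: nn)
  finally have "(\<integral>\<^sup>+w. (\<Sum>i. ennreal (f i w)) \<partial>M) \<noteq> \<infinity>" by simp
  then have "AE w in M. (\<Sum>i. ennreal (f i w)) \<noteq> \<infinity>"
    by (intro nn_integral_PInf_AE) auto
  then show ae: "AE w in M. summable (\<lambda>i. f i w)"
    by eventually_elim (auto intro!: summable_suminf_not_top nn)
  have ae': "AE w in M. summable (\<lambda>i. norm (f i w))" using ae by eventually_elim (simp add: nn)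
  have sm': "summable (\<lambda>i. \<integral>w. norm (f i w) \<partial>M)" using sm by (simp add: nn)
  show "integrable M (\<lambda>w. \<Sum>i. f i w)" by (rule integrable_suminf[OF int ae' sm'])
  show "(\<integral>w. (\<Sum>i. f i w) \<partial>M) = (\<Sum>i. integral\<^sup>L M (f i))" by (rule integral_suminf[OF int ae' sm'])
qed

text \<open>The increments have \<open>p\<close>-th moments so small that \<open>B = (\<Sum>n. 2 powr (n * p) * norm (X (n + 1) - X n) powr p)\<close>
is integrable. Then \<open>norm (X (n + 1) - X n) \<le> (1/2) ^ n * B powr (1 / p)\<close> almost surely, which gives
both the pointwise limit and a dominating function for the rate of convergence.\<close>

lemma Lp_complete:
  fixes X :: "nat \<Rightarrow> 'w \<Rightarrow> 'a::euclidean_space"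
  assumes p: "1 < p" and X: "\<And>n. X n \<in> Lp M p"
    and fast: "\<And>n. pdist M p (X (Suc n)) (X n) \<le> (4 powr - p) ^ n"
  shows "\<exists>Y\<in>Lp M p. (\<lambda>n. pdist M p (X n) Y) \<longlonglongrightarrow> 0"
proof -
  have [measurable]: "X n \<in> borel_measurable M" for n using X by (simp add: Lp_def)
  define h where "h n w = norm (X (Suc n) w - X n w)" for n w
  define f where "f = (\<lambda>n w. (2 powr p) ^ n * h n w powr p)"
  define B where "B w = (\<Sum>n. f n w)" for w
  have fint: "integrable M (f n)" for n
    unfolding f_def h_def using X p by (auto intro!: Lp_integrable_diff)
  have f0: "0 \<le> f n w" for n w by (simp add: f_def)
  have "integral\<^sup>L M (f n) \<le> (2 powr - p) ^ n" for n
  proof -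
    have "integral\<^sup>L M (f n) = (2 powr p) ^ n * pdist M p (X (Suc n)) (X n)"
      by (simp add: f_def h_def pdist_def)
    also have "\<dots> \<le> (2 powr p) ^ n * (4 powr - p) ^ n" using fast by (intro mult_left_mono) auto
    also have "\<dots> = (2 powr - p) ^ n"
    proof -
      have "(4::real) powr - p = 2 powr - p * 2 powr - p" using powr_mult[of 2 2 "-p"] by simp
      then have "2 powr p * 4 powr - p = (2::real) powr - p" by (simp add: powr_minus)
      then show ?thesis by (simp flip: power_mult_distrib)
    qed
    finally show ?thesis .
  qed
  moreover have "(2::real) powr - p < 1" using p powr_less_mono[of "-p" 0 "2::real"] by simp
  ultimately have sm: "summable (\<lambda>n. integral\<^sup>L M (f n))"
    by (intro summable_comparison_test'[OF summable_geometric[of "2 powr - p"], of 0])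
       (auto simp: abs_of_nonneg[OF integral_nonneg_AE] f0)
  note ser = integrable_nonneg_series[OF fint f0 sm]
  have hB: "h n w \<le> (1/2) ^ n * B w powr (1 / p)" if "summable (\<lambda>n. f n w)" for n w
  proof -
    have "f n w \<le> B w" unfolding B_def using sum_le_suminf[OF that, of "{n}"] f0 by simp
    then have "f n w powr (1 / p) \<le> B w powr (1 / p)" using p f0 by (intro powr_mono2) auto
    moreover have "f n w powr (1 / p) = 2 ^ n * h n w"
      using p by (simp add: f_def h_def powr_mult powr_powr powr_power flip: powr_realpow)
    ultimately show ?thesis by (simp add: field_simps power_divide)
  qed
  have lim_ex: "\<exists>l. (\<lambda>n. X n w) \<longlonglongrightarrow> l \<and> (\<forall>n. norm (X n w - l) \<le> 2 * (1/2) ^ n * B w powr (1 / p))"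
    if "summable (\<lambda>n. f n w)" for w
  proof -
    have le: "norm (X (Suc n) w - X n w) \<le> (1/2) ^ n * B w powr (1 / p)" for n
      using hB[OF that, of n] by (simp add: h_def)
    have gs: "summable (\<lambda>n. (1/2) ^ n * B w powr (1 / p))" by (intro summable_mult2 summable_geometric) auto
    have sn: "summable (\<lambda>n. norm (X (Suc n) w - X n w))"
      using gs by (rule summable_comparison_test'[where N = 0]) (use le in auto)
    then have sd: "summable (\<lambda>n. X (Suc n) w - X n w)" by (rule summable_norm_cancel)
    then have "(\<lambda>n. \<Sum>i<n. X (Suc i) w - X i w) \<longlonglongrightarrow> (\<Sum>i. X (Suc i) w - X i w)"
      by (rule summable_LIMSEQ)
    then have "(\<lambda>n. X n w - X 0 w) \<longlonglongrightarrow> (\<Sum>i. X (Suc i) w - X i w)"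
      by (simp only: sum_lessThan_telescope[of "\<lambda>n. X n w"])
    from tendsto_add[OF this tendsto_const[of "X 0 w"]]
    obtain l where l: "(\<lambda>n. X n w) \<longlonglongrightarrow> l" by auto
    have "norm (X n w - l) \<le> 2 * (1/2) ^ n * B w powr (1 / p)" for n
    proof -
      have "norm (X (k + n) w - X n w) \<le> 2 * (1/2) ^ n * B w powr (1 / p)" for k
      proof -
        have "norm (X (k + n) w - X n w) \<le> (2 * (1/2) ^ n - 2 * (1/2) ^ (k + n)) * B w powr (1 / p)"
        proof (induction k)
          case (Suc k)
          have "norm (X (Suc k + n) w - X n w)
              \<le> norm (X (Suc (k + n)) w - X (k + n) w) + norm (X (k + n) w - X n w)"
            using norm_triangle_ineq[of "X (Suc (k + n)) w - X (k + n) w" "X (k + n) w - X n w"] by simp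
          also have "\<dots> \<le> (1/2) ^ (k + n) * B w powr (1 / p)
              + (2 * (1/2) ^ n - 2 * (1/2) ^ (k + n)) * B w powr (1 / p)"
            by (intro add_mono le Suc.IH)
          also have "\<dots> = (2 * (1/2) ^ n - 2 * (1/2) ^ (Suc k + n)) * B w powr (1 / p)"
            by (simp add: algebra_simps)
          finally show ?case .
        qed simp
        also have "\<dots> \<le> 2 * (1/2) ^ n * B w powr (1 / p)" by (intro mult_right_mono) auto
        finally show ?thesis .
      qed
      then have "\<And>k. norm (X n w - X (k + n) w) \<le> 2 * (1/2) ^ n * B w powr (1 / p)"
        by (simp add: norm_minus_commute)
      moreover have "(\<lambda>k. norm (X n w - X (k + n) w)) \<longlonglongrightarrow> norm (X n w - l)"
        by (intro tendsto_intros LIMSEQ_ignore_initial_segment l)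
      ultimately show ?thesis by (intro LIMSEQ_le_const2) auto
    qed
    with l show ?thesis by blast
  qed
  define Y where "Y w = lim (\<lambda>n. X n w)" for w
  have [measurable]: "Y \<in> borel_measurable M" unfolding Y_def by (rule borel_measurable_lim_metric) measurable
  have [measurable]: "B \<in> borel_measurable M" using ser(2) unfolding B_def by auto
  have bd: "AE w in M. norm (X n w - Y w) powr p \<le> (2 * (1/2) ^ n) powr p * B w" for n
    using ser(1)
  proof eventually_elim
    case (elim w)
    have B0: "0 \<le> B w" unfolding B_def by (intro suminf_nonneg elim f0)
    have "norm (X n w - Y w) \<le> 2 * (1/2) ^ n * B w powr (1 / p)"
      using lim_ex[OF elim] by (auto simp: Y_def limI)
    then have "norm (X n w - Y w) powr p \<le> (2 * (1/2) ^ n * B w powr (1 / p)) powr p"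
      using p by (intro powr_mono2) auto
    also have "\<dots> = (2 * (1/2) ^ n) powr p * B w"
      using p B0 by (simp add: powr_mult powr_powr)
    finally show ?case .
  qed
  have intXY: "integrable M (\<lambda>w. norm (X n w - Y w) powr p)" for n
  proof (rule Bochner_Integration.integrable_bound)
    show "integrable M (\<lambda>w. (2 * (1/2) ^ n) powr p * B w)"
      using ser(2) by (simp add: B_def)
    show "AE w in M. norm (norm (X n w - Y w) powr p) \<le> norm ((2 * (1/2) ^ n) powr p * B w)"
      using bd[of n] by eventually_elim auto
  qed measurable
  have "(\<lambda>w. X 0 w - Y w) \<in> Lp M p" using intXY[of 0] by (simp add: Lp_def)
  from Lp_diff[OF X[of 0] this] have Y: "Y \<in> Lp M p" using p by simp
  have bound: "pdist M p (X n) Y \<le> (2 * (1/2) ^ n) powr p * integral\<^sup>L M B" for n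
  proof -
    have "pdist M p (X n) Y \<le> (\<integral>w. (2 * (1/2) ^ n) powr p * B w \<partial>M)"
      unfolding pdist_def using ser(2) by (intro integral_mono_AE intXY bd) (simp add: B_def)
    then show ?thesis by simp
  qed
  have lim0: "(\<lambda>n. (2 * (1/2) ^ n) powr p * integral\<^sup>L M B) \<longlonglongrightarrow> 0"
  proof -
    have "(\<lambda>n. (2 * (1/2) ^ n :: real)) \<longlonglongrightarrow> 0"
      using tendsto_mult[OF tendsto_const[of 2] LIMSEQ_realpow_zero[of "1/2::real"]] by simp
    then have "(\<lambda>n. (2 * (1/2) ^ n :: real) powr p) \<longlonglongrightarrow> 0"
      using p by (intro tendsto_zero_powrI[where b = p]) auto
    then show ?thesis using tendsto_mult_left_zero by blast
  qed
  have "(\<lambda>n. pdist M p (X n) Y) \<longlonglongrightarrow> 0"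
    by (rule Lim_null_comparison[OF _ lim0]) (use bound in \<open>simp add: abs_of_nonneg[OF pdist_nonneg]\<close>)
  with Y show ?thesis by blast
qed

section \<open>The gradient of a weighted sum of distance powers\<close>

lemma integrable_pgrad_inner:
  assumes "1 < p" "A \<in> Lp M p" "h \<in> Lp M p"
  shows "integrable M (\<lambda>w. pgrad p (A w) \<bullet> h w)"
    and "(\<integral>w. \<bar>pgrad p (A w) \<bullet> h w\<bar> \<partial>M) \<le> p * ((\<integral>w. norm (A w) powr p \<partial>M) + (\<integral>w. norm (h w) powr p \<partial>M))"
proof -
  have [measurable]: "A \<in> borel_measurable M" "h \<in> borel_measurable M"
    using assms by (auto simp: Lp_def)
  have le: "\<bar>pgrad p (A w) \<bullet> h w\<bar> \<le> p * (norm (A w) powr p + norm (h w) powr p)" for w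
  proof -
    have "\<bar>pgrad p (A w) \<bullet> h w\<bar> \<le> norm (pgrad p (A w)) * norm (h w)" by (rule Cauchy_Schwarz_ineq2)
    also have "\<dots> = p * (norm (A w) powr (p - 1) * norm (h w) powr 1)" using assms by (simp add: norm_pgrad)
    also have "\<dots> \<le> p * (norm (A w) powr (p - 1 + 1) + norm (h w) powr (p - 1 + 1))"
      using assms by (intro mult_left_mono powr_mult_le_powr_add) auto
    finally show ?thesis by simp
  qed
  have int: "integrable M (\<lambda>w. p * (norm (A w) powr p + norm (h w) powr p))"
    using assms by (auto simp: Lp_def)
  show 1: "integrable M (\<lambda>w. pgrad p (A w) \<bullet> h w)"
    by (rule Bochner_Integration.integrable_bound[OF int]) (use le order_trans[OF _ abs_ge_self] in \<open>auto simp: pgrad_def intro!: AE_I2\<close>)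
  have "(\<integral>w. \<bar>pgrad p (A w) \<bullet> h w\<bar> \<partial>M) \<le> (\<integral>w. p * (norm (A w) powr p + norm (h w) powr p) \<partial>M)"
    using 1 by (intro integral_mono int le) auto
  also have "\<dots> = p * ((\<integral>w. norm (A w) powr p \<partial>M) + (\<integral>w. norm (h w) powr p \<partial>M))"
    using assms by (simp add: Lp_def)
  finally show "(\<integral>w. \<bar>pgrad p (A w) \<bullet> h w\<bar> \<partial>M) \<le> \<dots>" .
qed

lemma pdist_expansion:
  assumes p: "1 < p" and X: "X \<in> Lp M p" "X' \<in> Lp M p" "W \<in> Lp M p"
    and r: "0 < r" "r \<le> 1" "pdist M p X' X \<le> r powr p"
  shows "pdist M p X' W \<le> pdist M p X W + (\<integral>w. pgrad p (X w - W w) \<bullet> (X' w - X w) \<partial>M)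
     + p * (p + 2) * (1 + 2 powr p * (pdist M p X W + 1)) * r powr (1 + min 1 (p - 1))"
proof -
  define R where "R = r powr (1 + min 1 (p - 1))"
  have X': "(\<lambda>w. X' w - X w) \<in> Lp M p" "(\<lambda>w. X w - W w) \<in> Lp M p" using X p by (auto intro!: Lp_diff)
  note int = Lp_integrable_diff[OF X(1,3)] Lp_integrable_diff[OF X(2,3)] Lp_integrable_diff[OF X(2,1)]
    integrable_pgrad_inner(1)[OF p X'(2,1)]
  have r1: "r powr p \<le> 1" using r p powr_mono2[of p r 1] by simp
  have "norm (X' w - W w) powr p \<le> norm (X w - W w) powr p + pgrad p (X w - W w) \<bullet> (X' w - X w)
     + p * (p + 2) * R * (norm (X' w - X w) powr p / r powr p
        + 2 powr p * (norm (X w - W w) powr p + norm (X' w - X w) powr p))" for w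
  proof -
    have "norm (X' w - W w) powr p \<le> norm (X w - W w) powr p + pgrad p (X w - W w) \<bullet> (X' w - X w)
     + p * (p + 2) * R * (norm (X' w - X w) powr p / r powr p
        + (norm (X w - W w) + norm (X' w - X w)) powr p)"
      using norm_powr_expansion[OF p r(1), of "X w - W w" "X' w - X w"] r by (simp add: R_def powr_divide)
    also have "\<dots> \<le> norm (X w - W w) powr p + pgrad p (X w - W w) \<bullet> (X' w - X w)
     + p * (p + 2) * R * (norm (X' w - X w) powr p / r powr p
        + 2 powr p * (norm (X w - W w) powr p + norm (X' w - X w) powr p))"
      using p by (intro add_left_mono mult_left_mono powr_add_le) (auto simp: R_def)
    finally show ?thesis .
  qed
  then have "pdist M p X' W \<le> (\<integral>w. norm (X w - W w) powr p + pgrad p (X w - W w) \<bullet> (X' w - X w)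
     + p * (p + 2) * R * (norm (X' w - X w) powr p / r powr p
        + 2 powr p * (norm (X w - W w) powr p + norm (X' w - X w) powr p)) \<partial>M)"
    unfolding pdist_def using p int
    by (intro integral_mono Bochner_Integration.integrable_add integrable_mult_right integrable_divide) auto
  also have "\<dots> = pdist M p X W + (\<integral>w. pgrad p (X w - W w) \<bullet> (X' w - X w) \<partial>M)
     + p * (p + 2) * R * (pdist M p X' X / r powr p + 2 powr p * (pdist M p X W + pdist M p X' X))"
    unfolding pdist_def using p int by simp
  also have "\<dots> \<le> pdist M p X W + (\<integral>w. pgrad p (X w - W w) \<bullet> (X' w - X w) \<partial>M)
     + p * (p + 2) * R * (1 + 2 powr p * (pdist M p X W + 1))"
    using p r r1 by (intro add_left_mono mult_left_mono add_mono) (auto simp: R_def)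
  finally show ?thesis by (simp add: R_def mult_ac)
qed

text \<open>The gradient at \<open>X\<close> of \<open>\<lambda>X. \<Sum>i. c i * pdist M p X (W i)\<close>, taken pointwise.\<close>

definition grad_series :: "real \<Rightarrow> (nat \<Rightarrow> real) \<Rightarrow> ('w \<Rightarrow> 'a) \<Rightarrow> (nat \<Rightarrow> 'w \<Rightarrow> 'a) \<Rightarrow> 'w \<Rightarrow> 'a::euclidean_space" where
  "grad_series p c X W w = (\<Sum>i. c i *\<^sub>R pgrad p (X w - W i w))"

lemma grad_series_measurable:
  assumes "X \<in> borel_measurable M" "\<And>i. W i \<in> borel_measurable M"
  shows "grad_series p c X W \<in> borel_measurable M"
proof -
  note [measurable] = assms
  show ?thesis unfolding grad_series_def[abs_def] pgrad_def by measurable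
qed

context
  fixes M :: "'w measure" and p :: real and c :: "nat \<Rightarrow> real"
    and X :: "'w \<Rightarrow> 'a::euclidean_space" and W :: "nat \<Rightarrow> 'w \<Rightarrow> 'a"
  assumes p: "1 < p" and c: "\<And>i. 0 \<le> c i" and X: "X \<in> Lp M p" and W: "\<And>i. W i \<in> Lp M p"
    and sc: "summable c" and scp: "summable (\<lambda>i. c i powr (1 / p))"
    and sd: "summable (\<lambda>i. c i * pdist M p X (W i))"
begin

lemma weighted_dist_integrable:
  "integrable M (\<lambda>w. c i * norm (X w - W i w) powr p)"
  using p by (auto intro!: Lp_integrable_diff X W)

lemma weighted_dist_series:
  "AE w in M. summable (\<lambda>i. c i * norm (X w - W i w) powr p)"
  "integrable M (\<lambda>w. \<Sum>i. c i * norm (X w - W i w) powr p)"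
  "(\<integral>w. (\<Sum>i. c i * norm (X w - W i w) powr p) \<partial>M) = (\<Sum>i. c i * pdist M p X (W i))"
  using integrable_nonneg_series[of M "\<lambda>i w. c i * norm (X w - W i w) powr p"]
    weighted_dist_integrable c sd by (auto simp: pdist_def)

text \<open>Let \<open>D\<close> be the weighted sum of the \<open>p\<close>-th powers. Each term \<open>c i * norm (X w - W i w) powr p\<close>
is at most \<open>D\<close>; raised to the power \<open>(p - 1) / p\<close> this bounds the \<open>i\<close>-th summand of the gradient by
\<open>p * c i powr (1 / p) * D powr ((p - 1) / p)\<close>. This is why the weights must have
summable \<open>p\<close>-th roots, as geometric weights do.\<close>

lemma grad_series_pointwise:
  assumes sw: "summable (\<lambda>i. c i * norm (X w - W i w) powr p)"
  shows "summable (\<lambda>i. norm (c i *\<^sub>R pgrad p (X w - W i w)))"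
    and "norm (grad_series p c X W w) powr conj_exponent p
       \<le> (p * (\<Sum>i. c i powr (1 / p))) powr conj_exponent p * (\<Sum>i. c i * norm (X w - W i w) powr p)"
proof -
  define D where "D = (\<Sum>i. c i * norm (X w - W i w) powr p)"
  have D0: "0 \<le> D" unfolding D_def using c by (intro suminf_nonneg sw) auto
  have le: "norm (c i *\<^sub>R pgrad p (X w - W i w)) \<le> p * c i powr (1 / p) * D powr ((p - 1) / p)" for i
  proof -
    define a where "a = norm (X w - W i w)"
    have "c i * a powr p \<le> D" unfolding D_def a_def using sum_le_suminf[OF sw, of "{i}"] c by simp
    then have "(c i * a powr p) powr ((p - 1) / p) \<le> D powr ((p - 1) / p)"
      using p c by (intro powr_mono2) auto
    moreover have "(c i * a powr p) powr ((p - 1) / p) = c i powr ((p - 1) / p) * a powr (p - 1)"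
      using p c by (simp add: powr_mult powr_powr a_def)
    ultimately have "c i powr (1 / p) * (c i powr ((p - 1) / p) * a powr (p - 1))
        \<le> c i powr (1 / p) * D powr ((p - 1) / p)"
      by (intro mult_left_mono) auto
    moreover have "c i powr (1 / p) * (c i powr ((p - 1) / p) * a powr (p - 1)) = c i * a powr (p - 1)"
    proof -
      have "1 / p + (p - 1) / p = 1" using p by (simp add: field_simps)
      then have "c i powr (1 / p) * c i powr ((p - 1) / p) = c i"
        using c by (simp add: powr_add[symmetric])
      then show ?thesis by (simp add: mult.assoc[symmetric])
    qed
    ultimately have "p * (c i * a powr (p - 1)) \<le> p * (c i powr (1 / p) * D powr ((p - 1) / p))"
      using p by (intro mult_left_mono) auto
    then show ?thesis using p c by (simp add: norm_pgrad a_def mult_ac)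
  qed
  have sm: "summable (\<lambda>i. p * c i powr (1 / p) * D powr ((p - 1) / p))"
    by (intro summable_mult2 summable_mult scp)
  show sn: "summable (\<lambda>i. norm (c i *\<^sub>R pgrad p (X w - W i w)))"
    using sm by (rule summable_comparison_test'[where N = 0]) (use le in auto)
  have "norm (grad_series p c X W w) \<le> (\<Sum>i. norm (c i *\<^sub>R pgrad p (X w - W i w)))"
    unfolding grad_series_def by (rule summable_norm[OF sn])
  also have "\<dots> \<le> (\<Sum>i. p * c i powr (1 / p) * D powr ((p - 1) / p))"
    by (intro suminf_le le sn sm)
  also have "\<dots> = p * (\<Sum>i. c i powr (1 / p)) * D powr ((p - 1) / p)"
    using scp by (simp add: suminf_mult suminf_mult2[symmetric] summable_mult)
  finally have "norm (grad_series p c X W w) powr conj_exponent p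
      \<le> (p * (\<Sum>i. c i powr (1 / p)) * D powr ((p - 1) / p)) powr conj_exponent p"
    using p by (intro powr_mono2) (auto simp: conj_exponent_def)
  also have "\<dots> = (p * (\<Sum>i. c i powr (1 / p))) powr conj_exponent p * D"
    using p D0 scp by (simp add: powr_mult powr_powr conj_exponent_def suminf_nonneg)
  finally show "norm (grad_series p c X W w) powr conj_exponent p
       \<le> (p * (\<Sum>i. c i powr (1 / p))) powr conj_exponent p * (\<Sum>i. c i * norm (X w - W i w) powr p)"
    by (simp add: D_def)
qed

text \<open>A small weighted sum of distances forces a small gradient: this makes the perturbations of the
variational principle harmless.\<close>

lemma grad_series_Lp:
  "integrable M (\<lambda>w. norm (grad_series p c X W w) powr conj_exponent p)"
  "(\<integral>w. norm (grad_series p c X W w) powr conj_exponent p \<partial>M)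
     \<le> (p * (\<Sum>i. c i powr (1 / p))) powr conj_exponent p * (\<Sum>i. c i * pdist M p X (W i))"
proof -
  have [measurable]: "grad_series p c X W \<in> borel_measurable M"
    using X W by (intro grad_series_measurable) (auto simp: Lp_def)
  let ?K = "(p * (\<Sum>i. c i powr (1 / p))) powr conj_exponent p"
  have int: "integrable M (\<lambda>w. ?K * (\<Sum>i. c i * norm (X w - W i w) powr p))"
    using weighted_dist_series(2) by simp
  have le: "AE w in M. norm (grad_series p c X W w) powr conj_exponent p
       \<le> ?K * (\<Sum>i. c i * norm (X w - W i w) powr p)"
    using weighted_dist_series(1) by eventually_elim (rule grad_series_pointwise)
  show 1: "integrable M (\<lambda>w. norm (grad_series p c X W w) powr conj_exponent p)"
  proof (rule Bochner_Integration.integrable_bound[OF int])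
    show "AE w in M. norm (norm (grad_series p c X W w) powr conj_exponent p)
       \<le> norm (?K * (\<Sum>i. c i * norm (X w - W i w) powr p))"
      using le by eventually_elim (simp add: order_trans[OF _ abs_ge_self])
  qed measurable
  have "(\<integral>w. norm (grad_series p c X W w) powr conj_exponent p \<partial>M)
      \<le> (\<integral>w. ?K * (\<Sum>i. c i * norm (X w - W i w) powr p) \<partial>M)"
    by (rule integral_mono_AE[OF 1 int le])
  then show "(\<integral>w. norm (grad_series p c X W w) powr conj_exponent p \<partial>M)
     \<le> ?K * (\<Sum>i. c i * pdist M p X (W i))"
    using weighted_dist_series(2,3) by simp
qed

lemma grad_series_expansion:
  assumes X': "X' \<in> Lp M p"
    and r: "0 < r" "r \<le> 1" "pdist M p X' X \<le> r powr p"
  shows "summable (\<lambda>i. c i * pdist M p X' (W i))"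
    and "(\<Sum>i. c i * pdist M p X' (W i))
      \<le> (\<Sum>i. c i * pdist M p X (W i)) + (\<integral>w. grad_series p c X W w \<bullet> (X' w - X w) \<partial>M)
       + (\<Sum>i. c i * (p * (p + 2) * (1 + 2 powr p * (pdist M p X (W i) + 1)))) * r powr (1 + min 1 (p - 1))"
proof -
  define h where "h = (\<lambda>w. X' w - X w)"
  have h: "h \<in> Lp M p" unfolding h_def using X X' p by (intro Lp_diff) auto
  define g where "g i w = c i * (pgrad p (X w - W i w) \<bullet> h w)" for i w
  have XW: "(\<lambda>w. X w - W i w) \<in> Lp M p" for i using X W p by (intro Lp_diff) auto
  have gint: "integrable M (g i)" for i
    unfolding g_def using integrable_pgrad_inner(1)[OF p XW h] by simp
  have AEs: "AE w in M. summable (\<lambda>i. norm (g i w))"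
    using weighted_dist_series(1)
  proof eventually_elim
    case (elim w)
    have "summable (\<lambda>i. norm (c i *\<^sub>R pgrad p (X w - W i w)) * norm (h w))"
      by (intro summable_mult2 grad_series_pointwise elim)
    then show ?case
    proof (rule summable_comparison_test'[where N = 0])
      show "norm (norm (g i w)) \<le> norm (c i *\<^sub>R pgrad p (X w - W i w)) * norm (h w)" for i
        using Cauchy_Schwarz_ineq2[of "c i *\<^sub>R pgrad p (X w - W i w)" "h w"]
        by (simp add: g_def)
    qed
  qed
  have sI: "summable (\<lambda>i. \<integral>w. norm (g i w) \<partial>M)"
  proof (rule summable_comparison_test'[where N = 0])
    show "summable (\<lambda>i. p * (c i * pdist M p X (W i) + c i * (\<integral>w. norm (h w) powr p \<partial>M)))"
      using sc sd by (intro summable_mult summable_add summable_mult2)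
    fix i
    have "(\<integral>w. norm (g i w) \<partial>M) = c i * (\<integral>w. \<bar>pgrad p (X w - W i w) \<bullet> h w\<bar> \<partial>M)"
      using c[of i] by (simp add: g_def abs_mult)
    also have "\<dots> \<le> c i * (p * (pdist M p X (W i) + (\<integral>w. norm (h w) powr p \<partial>M)))"
      unfolding pdist_def using c by (intro mult_left_mono integrable_pgrad_inner p XW h)
    also have "\<dots> = p * (c i * pdist M p X (W i) + c i * (\<integral>w. norm (h w) powr p \<partial>M))"
      by (simp add: algebra_simps)
    finally show "norm (\<integral>w. norm (g i w) \<partial>M) \<le> \<dots>" by simp
  qed
  have sumg: "AE w in M. (\<Sum>i. g i w) = grad_series p c X W w \<bullet> h w"
    using weighted_dist_series(1)
  proof eventually_elim
    case (elim w)
    have "summable (\<lambda>i. c i *\<^sub>R pgrad p (X w - W i w))"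
      by (intro summable_norm_cancel[OF grad_series_pointwise(1)] elim)
    then show ?case
      unfolding grad_series_def g_def
      using bounded_linear.suminf[OF bounded_linear_inner_left[of "h w"]] by fastforce
  qed
  have gm: "grad_series p c X W \<in> borel_measurable M"
    using X W by (intro grad_series_measurable) (auto simp: Lp_def)
  have sumI: "(\<Sum>i. integral\<^sup>L M (g i)) = (\<integral>w. grad_series p c X W w \<bullet> h w \<partial>M)"
  proof -
    have "(\<integral>w. (\<Sum>i. g i w) \<partial>M) = (\<integral>w. grad_series p c X W w \<bullet> h w \<partial>M)"
      using gm h sumg by (intro integral_cong_AE) (auto simp: Lp_def intro!: borel_measurable_suminf borel_measurable_integrable[OF gint])
    then show ?thesis using integral_suminf[OF gint AEs sI] by simp
  qed
  have sgI: "summable (\<lambda>i. integral\<^sup>L M (g i))" by (rule summable_integral[OF gint AEs sI])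
  define k where "k i = c i * (p * (p + 2) * (1 + 2 powr p * (pdist M p X (W i) + 1)))" for i
  have sk: "summable k"
  proof -
    have "k = (\<lambda>i. p * (p + 2) * (c i * (1 + 2 powr p) + 2 powr p * (c i * pdist M p X (W i))))"
      by (simp add: k_def fun_eq_iff algebra_simps)
    then show ?thesis using sc sd by (simp add: summable_add summable_mult summable_mult2)
  qed
  let ?R = "r powr (1 + min 1 (p - 1))"
  have le: "c i * pdist M p X' (W i) \<le> c i * pdist M p X (W i) + integral\<^sup>L M (g i) + k i * ?R" for i
  proof -
    have "c i * pdist M p X' (W i) \<le> c i * (pdist M p X (W i) + (\<integral>w. pgrad p (X w - W i w) \<bullet> (X' w - X w) \<partial>M)
     + p * (p + 2) * (1 + 2 powr p * (pdist M p X (W i) + 1)) * ?R)"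
      by (intro mult_left_mono c pdist_expansion p X X' W r)
    also have "\<dots> = c i * pdist M p X (W i) + c i * (\<integral>w. pgrad p (X w - W i w) \<bullet> (X' w - X w) \<partial>M)
       + c i * (p * (p + 2) * (1 + 2 powr p * (pdist M p X (W i) + 1))) * ?R"
      by (simp only: distrib_left[of "c i"] mult.assoc)
    also have "c i * (\<integral>w. pgrad p (X w - W i w) \<bullet> (X' w - X w) \<partial>M) = integral\<^sup>L M (g i)"
      by (simp add: g_def[abs_def] h_def)
    finally show ?thesis unfolding k_def .
  qed
  have sr: "summable (\<lambda>i. c i * pdist M p X (W i) + integral\<^sup>L M (g i) + k i * ?R)"
    by (intro summable_add sd sgI summable_mult2 sk)
  show s': "summable (\<lambda>i. c i * pdist M p X' (W i))"
    using sr by (rule summable_comparison_test'[where N = 0]) (use le c in \<open>auto simp: pdist_nonneg\<close>)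
  have "(\<Sum>i. c i * pdist M p X' (W i)) \<le> (\<Sum>i. c i * pdist M p X (W i) + integral\<^sup>L M (g i) + k i * ?R)"
    by (intro suminf_le le s' sr)
  also have "\<dots> = (\<Sum>i. c i * pdist M p X (W i)) + (\<Sum>i. integral\<^sup>L M (g i)) + (\<Sum>i. k i) * ?R"
    using sd sgI sk by (simp add: suminf_add[symmetric] summable_add summable_mult2 suminf_mult2)
  finally show "(\<Sum>i. c i * pdist M p X' (W i))
      \<le> (\<Sum>i. c i * pdist M p X (W i)) + (\<integral>w. grad_series p c X W w \<bullet> (X' w - X w) \<partial>M)
       + (\<Sum>i. c i * (p * (p + 2) * (1 + 2 powr p * (pdist M p X (W i) + 1)))) * ?R"
    by (simp add: sumI k_def h_def)
qed

end

section \<open>A smooth variational principle\<close>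

text \<open>The Borwein--Preiss principle, for maxima. Bounded functions on a complete space need not
attain their supremum, but a small smooth perturbation does. The points are
chosen recursively: \<open>x (n + 1)\<close> nearly maximises \<open>f\<close> minus the first \<open>n + 1\<close> penalties
\<open>d i * \<rho> z (x i)\<close>, and its value is no less than the one at \<open>x n\<close>. Near-maximality of \<open>x n\<close> for the
previous function then bounds the new penalty at \<open>x (n + 1)\<close>, so the sequence converges rapidly, and the
limit maximises the limit function. In the application the gauge \<open>\<rho>\<close> is a sum
of \<open>p\<close>-th powers and squares, which makes the perturbation differentiable.\<close>

lemma smooth_variational_principle:
  fixes f :: "'s \<Rightarrow> real" and \<rho> :: "'s \<Rightarrow> 's \<Rightarrow> real" and d c :: "nat \<Rightarrow> real"
  assumes \<rho>0: "\<And>x. \<rho> x x = 0" and \<rho>nn: "\<And>x y. 0 \<le> \<rho> x y"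
    and ne: "S \<noteq> {}" and bdd: "\<And>x. x \<in> S \<Longrightarrow> f x \<le> B"
    and d: "\<And>n. 0 < d n" and c: "\<And>n. 0 < c n" and dc: "(\<lambda>n. d n * c n) \<longlonglongrightarrow> 0"
    and complete: "\<And>x. (\<And>n. x n \<in> S) \<Longrightarrow> (\<And>n. \<rho> (x (Suc n)) (x n) \<le> c n) \<Longrightarrow>
       \<exists>y\<in>S. (\<lambda>n. f (x n)) \<longlonglongrightarrow> f y \<and> (\<forall>z\<in>S. (\<lambda>n. \<rho> (x n) z) \<longlonglongrightarrow> \<rho> y z)"
    and \<eta>: "0 < \<eta>"
  obtains x y where "\<And>n. x n \<in> S" "y \<in> S"
    "summable (\<lambda>i. d i * \<rho> y (x i))" "(\<Sum>i. d i * \<rho> y (x i)) \<le> \<eta>"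
    "\<And>z. z \<in> S \<Longrightarrow> f z - \<eta> \<le> f y"
    "\<And>z. z \<in> S \<Longrightarrow> summable (\<lambda>i. d i * \<rho> z (x i)) \<Longrightarrow>
       f z - (\<Sum>i. d i * \<rho> z (x i)) \<le> f y - (\<Sum>i. d i * \<rho> y (x i))"
proof -
  have near: "\<exists>y\<in>S. (\<forall>z\<in>S. g z \<le> g y + e) \<and> g x \<le> g y"
    if g: "\<And>z. z \<in> S \<Longrightarrow> g z \<le> B" and x: "x \<in> S" and e: "0 < e" for g :: "'s \<Rightarrow> real" and x e
  proof -
    have bb: "bdd_above (g ` S)" using g by (auto intro!: bdd_aboveI[of _ B])
    have "(SUP z\<in>S. g z) - e < (SUP z\<in>S. g z)" using e by simp
    then obtain y0 where y0: "y0 \<in> S" "(SUP z\<in>S. g z) - e < g y0"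
      using less_cSUP_iff[OF _ bb] ne by auto
    have sup: "g z \<le> (SUP z\<in>S. g z)" if "z \<in> S" for z by (rule cSUP_upper[OF that bb])
    show ?thesis
    proof (cases "g x \<le> g y0")
      case True have "g z \<le> g y0 + e" if "z \<in> S" for z using sup[OF that] y0(2) by linarith
      then show ?thesis using True y0 by blast
    next
      case False have "g z \<le> g x + e" if "z \<in> S" for z using sup[OF that] y0(2) False by linarith
      then show ?thesis using x by blast
    qed
  qed
  \<comment> \<open>The state of the recursion is the current point and the current perturbed function.\<close>
  define P where "P n s \<longleftrightarrow> fst s \<in> S \<and> (\<forall>z\<in>S. snd s z \<le> B)
      \<and> (\<forall>z\<in>S. snd s z \<le> snd s (fst s) + d n * c n) \<and> (n = 0 \<longrightarrow> snd s = f \<and> (\<forall>z\<in>S. f z \<le> f (fst s) + \<eta>))"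
    for n and s :: "'s \<times> ('s \<Rightarrow> real)"
  define Q where "Q n s s' \<longleftrightarrow> snd s' = (\<lambda>z. snd s z - d n * \<rho> z (fst s))
      \<and> snd s (fst s) \<le> snd s' (fst s')" for n and s s' :: "'s \<times> ('s \<Rightarrow> real)"
  have "\<exists>s. \<forall>n. P n (s n) \<and> Q n (s n) (s (Suc n))"
  proof (rule dependent_nat_choice)
    obtain x0 where "x0 \<in> S" using ne by auto
    moreover have "0 < min (d 0 * c 0) \<eta>" using mult_pos_pos[OF d c, of 0 0] \<eta> by simp
    ultimately obtain y where y: "y \<in> S" "\<forall>z\<in>S. f z \<le> f y + min (d 0 * c 0) \<eta>"
      using near[of f x0 "min (d 0 * c 0) \<eta>"] bdd by blast
    have "f z \<le> f y + d 0 * c 0 \<and> f z \<le> f y + \<eta>" if "z \<in> S" for z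
    proof -
      have "f z \<le> f y + min (d 0 * c 0) \<eta>" using y(2) that by blast
      then show ?thesis by linarith
    qed
    then have "P 0 (y, f)" using bdd y(1) by (simp add: P_def)
    then show "\<exists>s. P 0 s" ..
  next
    fix s n assume s: "P n s"
    define g where "g z = snd s z - d n * \<rho> z (fst s)" for z
    have "g z \<le> B" if "z \<in> S" for z
    proof -
      have "snd s z \<le> B" using s that by (simp add: P_def)
      moreover have "0 \<le> d n * \<rho> z (fst s)" using d[of n] \<rho>nn by simp
      ultimately show ?thesis by (simp add: g_def)
    qed
    moreover have "fst s \<in> S" using s by (simp add: P_def)
    ultimately obtain y where y: "y \<in> S" "\<forall>z\<in>S. g z \<le> g y + d (Suc n) * c (Suc n)" "g (fst s) \<le> g y"
      using near[of g "fst s" "d (Suc n) * c (Suc n)"] mult_pos_pos[OF d c, of "Suc n" "Suc n"] by blast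
    have "P (Suc n) (y, g)" using y \<open>\<And>z. z \<in> S \<Longrightarrow> g z \<le> B\<close> by (simp add: P_def)
    moreover have "Q n s (y, g)" using y by (auto simp: Q_def g_def \<rho>0)
    ultimately show "\<exists>s'. P (Suc n) s' \<and> Q n s s'" by blast
  qed
  then obtain s where s: "\<And>n. P n (s n)" "\<And>n. Q n (s n) (s (Suc n))" by blast
  define x where "x n = fst (s n)" for n
  define F where "F n = snd (s n)" for n
  have xS: "x n \<in> S" for n using s(1)[of n] by (simp add: P_def x_def)
  have F0: "F 0 = f" and x0: "\<And>z. z \<in> S \<Longrightarrow> f z \<le> f (x 0) + \<eta>"
    using s(1)[of 0] by (auto simp: P_def F_def x_def)
  have FS: "F (Suc n) z = F n z - d n * \<rho> z (x n)" for n z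
    using s(2)[of n] by (simp add: Q_def F_def x_def)
  have near': "F n z \<le> F n (x n) + d n * c n" if "z \<in> S" for n z
    using s(1)[of n] that by (simp add: P_def x_def F_def)
  have up: "F n (x n) \<le> F (Suc n) (x (Suc n))" for n
    using s(2)[of n] unfolding Q_def F_def x_def by blast
  have Feq: "F n z = f z - (\<Sum>i<n. d i * \<rho> z (x i))" for n z
    by (induction n) (simp_all add: F0 FS)
  have nn': "0 \<le> d i * \<rho> z (x i)" for i z using less_imp_le[OF d, of i] \<rho>nn by simp
  have Fanti: "F m z \<le> F n z" if "n \<le> m" for n m z
    unfolding Feq using that nn' by (intro diff_left_mono sum_mono2) auto
  define L where "L n = F n (x n)" for n
  have Linc: "incseq L" unfolding L_def by (intro incseq_SucI up)
  have "\<rho> (x (Suc n)) (x n) \<le> c n" for n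
  proof -
    have "d n * \<rho> (x (Suc n)) (x n) = F n (x (Suc n)) - F (Suc n) (x (Suc n))" by (simp add: FS)
    also have "\<dots> \<le> d n * c n" using near'[OF xS, of n "Suc n"] up[of n] by simp
    finally show ?thesis using d[of n] by simp
  qed
  from complete[OF xS this] obtain y where y: "y \<in> S" "(\<lambda>n. f (x n)) \<longlonglongrightarrow> f y"
    "\<And>z. z \<in> S \<Longrightarrow> (\<lambda>n. \<rho> (x n) z) \<longlonglongrightarrow> \<rho> y z" by blast
  have Fy: "L n \<le> F k y" for n k
  proof -
    have "(\<lambda>m. F k (x m)) \<longlonglongrightarrow> F k y"
      unfolding Feq by (intro tendsto_intros y xS)
    moreover have "L n \<le> F k (x m)" if "m \<ge> max n k" for m
    proof -
      have "L n \<le> L m" using Linc that by (simp add: incseqD)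
      also have "\<dots> \<le> F k (x m)" unfolding L_def using that by (intro Fanti) auto
      finally show ?thesis .
    qed
    ultimately show ?thesis by (intro LIMSEQ_le_const) blast+
  qed
  have part: "(\<Sum>i<k. d i * \<rho> y (x i)) \<le> f y - L n" for k n
    using Fy[of n k] by (simp add: Feq)
  have L0: "L 0 = f (x 0)" by (simp add: L_def F0)
  have sy: "summable (\<lambda>i. d i * \<rho> y (x i))"
    by (rule summableI_nonneg_bounded[OF nn' part[of _ 0]])
  have suml: "(\<Sum>i. d i * \<rho> y (x i)) \<le> f y - L n" for n
    using summable_LIMSEQ[OF sy] part by (intro LIMSEQ_le_const2) auto
  show thesis
  proof (rule that[OF xS y(1) sy])
    show "(\<Sum>i. d i * \<rho> y (x i)) \<le> \<eta>" using suml[of 0] x0[OF y(1)] by (simp add: L0)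
    have "0 \<le> (\<Sum>i. d i * \<rho> y (x i))" by (intro suminf_nonneg sy nn')
    then show "f z - \<eta> \<le> f y" if "z \<in> S" for z using suml[of 0] x0[OF that] by (simp add: L0)
    fix z assume z: "z \<in> S" and sz: "summable (\<lambda>i. d i * \<rho> z (x i))"
    have "f z - (\<Sum>i. d i * \<rho> z (x i)) \<le> f y - (\<Sum>i. d i * \<rho> y (x i)) + d n * c n" for n
    proof -
      have "(\<Sum>i<n. d i * \<rho> z (x i)) \<le> (\<Sum>i. d i * \<rho> z (x i))"
        by (intro sum_le_suminf sz) (auto simp: nn')
      then have "f z - (\<Sum>i. d i * \<rho> z (x i)) \<le> F n z" by (simp add: Feq)
      also have "\<dots> \<le> L n + d n * c n" unfolding L_def by (rule near'[OF z])
      also have "L n \<le> f y - (\<Sum>i. d i * \<rho> y (x i))" using suml[of n] by simp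
      finally show ?thesis by simp
    qed
    moreover have "(\<lambda>n. f y - (\<Sum>i. d i * \<rho> y (x i)) + d n * c n) \<longlonglongrightarrow> f y - (\<Sum>i. d i * \<rho> y (x i))"
      using tendsto_add[OF tendsto_const dc] by simp
    ultimately show "f z - (\<Sum>i. d i * \<rho> z (x i)) \<le> f y - (\<Sum>i. d i * \<rho> y (x i))"
      by (intro LIMSEQ_le_const) auto
  qed
qed

section \<open>Coding Euclidean space by real numbers\<close>

text \<open>A countable family of sets is recorded in the ternary digits of one real number. Only the
digits 0 and 1 occur, so the tail of the expansion is at most one half of the last place and
the digits can be read off again by a Borel function.\<close>

definition ternary_code :: "(nat \<Rightarrow> 'x set) \<Rightarrow> 'x \<Rightarrow> real" where
  "ternary_code A x = (\<Sum>n. indicator (A n) x * (1/3) ^ n)"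

definition ternary_digit_set :: "nat \<Rightarrow> real set" where
  "ternary_digit_set n = {r. \<lfloor>3 ^ n * r\<rfloor> mod 3 = 1}"

lemma ternary_digit_set_measurable [measurable]: "ternary_digit_set n \<in> sets borel"
  unfolding ternary_digit_set_def by measurable

lemma ternary_code_measurable:
  assumes "\<And>n. A n \<in> sets M"
  shows "ternary_code A \<in> borel_measurable M"
proof -
  note [measurable] = assms
  show ?thesis unfolding ternary_code_def[abs_def] by measurable
qed

lemma ternary_code_summable: "summable (\<lambda>n. indicator (A n) x * (1/3 :: real) ^ n)"
  by (rule summable_comparison_test'[OF summable_geometric[of "1/3"], of 0]) (auto simp: indicator_def)

lemma ternary_code_bounds: "0 \<le> ternary_code A x" "ternary_code A x \<le> 2"
proof -
  show "0 \<le> ternary_code A x"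
    unfolding ternary_code_def by (intro suminf_nonneg ternary_code_summable) auto
  have "ternary_code A x \<le> (\<Sum>n. (1/3) ^ n)"
    unfolding ternary_code_def
    by (intro suminf_le ternary_code_summable summable_geometric) (auto simp: indicator_def)
  also have "\<dots> \<le> 2" by (subst suminf_geometric) auto
  finally show "ternary_code A x \<le> 2" .
qed

lemma ternary_code_digit: "ternary_code A x \<in> ternary_digit_set n \<longleftrightarrow> x \<in> A n"
proof -
  define a :: "nat \<Rightarrow> int" where "a m = (if x \<in> A m then 1 else 0)" for m
  have a: "indicator (A m) x = real_of_int (a m)" for m by (simp add: a_def indicator_def)
  have sm: "summable (\<lambda>m. real_of_int (a m) * (1/3) ^ m)"
    using ternary_code_summable[of A x] by (simp only: a)
  define N where "N = (\<Sum>m\<le>n. a m * 3 ^ (n - m))"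
  define R where "R = (\<Sum>m. real_of_int (a (m + Suc n)) * (1/3) ^ Suc m)"
  have sR: "summable (\<lambda>m. real_of_int (a (m + Suc n)) * (1/3) ^ Suc m)"
    by (rule summable_comparison_test'[of "\<lambda>m. (1/3) ^ m" 0]) (auto simp: a_def intro: summable_geometric)
  have split: "3 ^ n * ternary_code A x = real_of_int N + R"
  proof -
    have "ternary_code A x = (\<Sum>m. real_of_int (a (m + Suc n)) * (1/3) ^ (m + Suc n))
        + (\<Sum>m<Suc n. real_of_int (a m) * (1/3) ^ m)"
      unfolding ternary_code_def a by (rule suminf_split_initial_segment[OF sm])
    moreover have "3 ^ n * (\<Sum>m<Suc n. real_of_int (a m) * (1/3) ^ m) = real_of_int N"
      unfolding N_def sum_distrib_left of_int_sum lessThan_Suc_atMost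
    proof (intro sum.cong refl)
      fix m assume "m \<in> {..n}"
      then have "(3::real) ^ n = 3 ^ (n - m) * 3 ^ m" by (simp flip: power_add)
      then show "3 ^ n * (real_of_int (a m) * (1/3) ^ m) = real_of_int (a m * 3 ^ (n - m))"
        by (simp add: power_one_over)
    qed
    moreover have "3 ^ n * (\<Sum>m. real_of_int (a (m + Suc n)) * (1/3) ^ (m + Suc n)) = R"
    proof -
      have "R = (\<Sum>m. 3 ^ n * (real_of_int (a (m + Suc n)) * (1/3) ^ (m + Suc n)))"
        unfolding R_def by (intro suminf_cong) (simp add: power_add power_one_over)
      also have "\<dots> = 3 ^ n * (\<Sum>m. real_of_int (a (m + Suc n)) * (1/3) ^ (m + Suc n))"
        by (intro suminf_mult summable_ignore_initial_segment[OF sm])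
      finally show ?thesis ..
    qed
    ultimately show ?thesis by (simp add: distrib_left)
  qed
  have R0: "0 \<le> R" unfolding R_def by (intro suminf_nonneg sR) (auto simp: a_def)
  have "R \<le> (\<Sum>m. (1/3) * (1/3) ^ m)"
    unfolding R_def by (intro suminf_le sR summable_mult summable_geometric) (auto simp: a_def)
  also have "\<dots> = (1/3) * (1 / (1 - 1/3))" by (subst suminf_mult) (auto simp: suminf_geometric summable_geometric)
  finally have R1: "R < 1" by simp
  have "\<lfloor>3 ^ n * ternary_code A x\<rfloor> = N"
    unfolding split using R0 R1 by linarith
  moreover have "N mod 3 = a n"
  proof -
    have "N = a n + (\<Sum>m<n. a m * 3 ^ (n - m))"
      unfolding N_def by (simp add: lessThan_Suc_atMost[symmetric])
    moreover have "3 dvd (\<Sum>m<n. a m * 3 ^ (n - m))"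
      by (intro dvd_sum) (auto intro!: dvd_mult dvd_power)
    ultimately have "N mod 3 = a n mod 3" by (metis dvd_imp_mod_0 mod_add_right_eq add.right_neutral)
    then show ?thesis by (simp add: a_def)
  qed
  ultimately show ?thesis by (simp add: ternary_digit_set_def a_def)
qed

text \<open>The coded sets are the half-spaces \<open>{x. q < x \<bullet> b}\<close> for rational \<open>q\<close> and basis vectors \<open>b\<close>. The
coordinate \<open>x \<bullet> b\<close> is the supremum of the rationals \<open>q\<close> whose digit is 1, so decoding is measurable.
This reduces disintegration on a Euclidean space to the real line.\<close>

lemma euclidean_borel_code:
  obtains e :: "'a::euclidean_space \<Rightarrow> real" and g :: "real \<Rightarrow> 'a"
  where "e \<in> borel_measurable borel" "g \<in> borel_measurable borel" "\<And>x. g (e x) = x"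
    "\<And>x. 0 \<le> e x" "\<And>x. e x \<le> 2"
proof -
  define A :: "nat \<Rightarrow> 'a set" where
    "A n = (case from_nat_into (Basis \<times> \<rat>) n of (b, q) \<Rightarrow> {x. q < x \<bullet> b})" for n
  have cnt: "countable ((Basis :: 'a set) \<times> (\<rat> :: real set))"
    by (intro countable_SIGMA countable_finite countable_rat) auto
  define idx where "idx = to_nat_on ((Basis :: 'a set) \<times> (\<rat> :: real set))"
  have idx: "A (idx (b, q)) = {x. q < x \<bullet> b}" if "b \<in> Basis" "q \<in> \<rat>" for b q
    unfolding A_def idx_def using that cnt by simp
  have [measurable]: "A n \<in> sets borel" for n unfolding A_def by (simp split: prod.split)
  define G where "G b r = (SUP q\<in>\<rat>. if r \<in> ternary_digit_set (idx (b, q)) then ereal q else -\<infinity>)"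
    for b :: 'a and r :: real
  define g where "g r = (\<Sum>b\<in>Basis. real_of_ereal (G b r) *\<^sub>R b)" for r
  have Gm: "G b \<in> borel_measurable borel" for b
    unfolding G_def[abs_def] by (intro borel_measurable_SUP countable_rat) measurable
  have "g \<in> borel_measurable borel"
    unfolding g_def[abs_def] using Gm by (intro borel_measurable_sum borel_measurable_scaleR borel_measurable_real_of_ereal) auto
  moreover have "g (ternary_code A x) = x" for x
  proof -
    have "G b (ternary_code A x) = ereal (x \<bullet> b)" if b: "b \<in> Basis" for b
    proof -
      have "G b (ternary_code A x) = (SUP q\<in>\<rat>. if q < x \<bullet> b then ereal q else -\<infinity>)"
        unfolding G_def by (intro SUP_cong) (auto simp: ternary_code_digit idx b)
      also have "\<dots> = ereal (x \<bullet> b)"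
      proof (rule antisym)
        show "(SUP q\<in>\<rat>. if q < x \<bullet> b then ereal q else -\<infinity>) \<le> ereal (x \<bullet> b)"
          by (intro SUP_least) auto
        show "ereal (x \<bullet> b) \<le> (SUP q\<in>\<rat>. if q < x \<bullet> b then ereal q else -\<infinity>)"
        proof (rule le_SUP_iff[THEN iffD2], intro allI impI)
          fix y :: ereal assume "y < ereal (x \<bullet> b)"
          then obtain z where z: "y < ereal z" "z < x \<bullet> b" using ereal_dense2 by (metis ereal_less_eq(3) less_ereal.simps(1))
          obtain q where "q \<in> \<rat>" "z < q" "q < x \<bullet> b" using Rats_dense_in_real[OF z(2)] by auto
          then show "\<exists>q\<in>\<rat>. y < (if q < x \<bullet> b then ereal q else -\<infinity>)"
            using z by (intro bexI[of _ q]) (auto intro: less_trans)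
        qed
      qed
      finally show ?thesis .
    qed
    then show ?thesis by (simp add: g_def euclidean_representation)
  qed
  ultimately show thesis
    using ternary_code_measurable[of A borel] ternary_code_bounds[of A]
    by (intro that[of "ternary_code A" g]) auto
qed

section \<open>Disintegration by uniform noise\<close>

lemma measure_eqI_Times:
  assumes M: "finite_measure M" "sets M = sets (S \<Otimes>\<^sub>M T)" and N: "sets N = sets (S \<Otimes>\<^sub>M T)"
    and eq: "\<And>A B. A \<in> sets S \<Longrightarrow> B \<in> sets T \<Longrightarrow> emeasure M (A \<times> B) = emeasure N (A \<times> B)"
  shows "M = N"
proof (rule measure_eqI_generator_eq[OF Int_stable_pair_measure_generator[of S T]])
  show "{a \<times> b |a b. a \<in> sets S \<and> b \<in> sets T} \<subseteq> Pow (space S \<times> space T)"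
    using sets.space_closed[of S] sets.space_closed[of T] by blast
  show "sets M = sigma_sets (space S \<times> space T) {a \<times> b |a b. a \<in> sets S \<and> b \<in> sets T}"
    "sets N = sigma_sets (space S \<times> space T) {a \<times> b |a b. a \<in> sets S \<and> b \<in> sets T}"
    using M N by (simp_all add: sets_pair_measure)
  show "emeasure M X = emeasure N X" if "X \<in> {a \<times> b |a b. a \<in> sets S \<and> b \<in> sets T}" for X
    using that eq by auto
  show "range (\<lambda>i::nat. space S \<times> space T) \<subseteq> {a \<times> b |a b. a \<in> sets S \<and> b \<in> sets T}" by auto
  show "emeasure M (space S \<times> space T) \<noteq> \<infinity>" using finite_measure.emeasure_finite[OF M(1)] by auto
qed auto

lemma AE_le_of_nn_integral_le:
  assumes [measurable]: "f \<in> borel_measurable M" "g \<in> borel_measurable M"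
    and fin: "(\<integral>\<^sup>+x. f x \<partial>M) \<noteq> \<infinity>"
    and le: "\<And>A. A \<in> sets M \<Longrightarrow> (\<integral>\<^sup>+x\<in>A. f x \<partial>M) \<le> (\<integral>\<^sup>+x\<in>A. g x \<partial>M)"
  shows "AE x in M. f x \<le> g x"
proof -
  define A where "A = {x \<in> space M. g x < f x}"
  have [measurable]: "A \<in> sets M" unfolding A_def by measurable
  have ff: "(\<integral>\<^sup>+x\<in>A. f x \<partial>M) \<noteq> \<infinity>"
  proof -
    have "(\<integral>\<^sup>+x\<in>A. f x \<partial>M) \<le> (\<integral>\<^sup>+x. f x \<partial>M)"
      by (intro nn_integral_mono) (auto simp: indicator_def)
    then show ?thesis using fin by (auto simp: top_unique)
  qed
  have ptw: "g x * indicator A x \<le> f x * indicator A x" for x by (auto simp: A_def indicator_def)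
  then have "(\<integral>\<^sup>+x\<in>A. g x \<partial>M) \<le> (\<integral>\<^sup>+x\<in>A. f x \<partial>M)" by (intro nn_integral_mono)
  with le[of A] have eq: "(\<integral>\<^sup>+x\<in>A. f x \<partial>M) = (\<integral>\<^sup>+x\<in>A. g x \<partial>M)" by simp
  have "(\<integral>\<^sup>+x. f x * indicator A x - g x * indicator A x \<partial>M) = (\<integral>\<^sup>+x\<in>A. f x \<partial>M) - (\<integral>\<^sup>+x\<in>A. g x \<partial>M)"
    using ff eq ptw by (intro nn_integral_diff) auto
  also have "\<dots> = 0" using eq ff by (simp add: ennreal_minus_eq_0)
  finally have "AE x in M. f x * indicator A x - g x * indicator A x = 0"
    by (subst (asm) nn_integral_0_iff_AE) auto
  then show ?thesis
  proof (rule AE_mp, intro AE_I2 impI)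
    fix x assume x: "x \<in> space M" and 0: "f x * indicator A x - g x * indicator A x = 0"
    show "f x \<le> g x"
    proof (rule ccontr)
      assume "\<not> f x \<le> g x"
      then have "x \<in> A" "g x < f x" using x by (auto simp: A_def)
      then show False using 0 ennreal_minus_eq_0[of "f x" "g x"] by auto
    qed
  qed
qed

definition unif01 :: "real measure" where
  "unif01 = uniform_measure lborel {0..1}"

lemma sets_unif01 [simp, measurable_cong]: "sets unif01 = sets borel"
  by (simp add: unif01_def)

lemma space_unif01 [simp]: "space unif01 = UNIV"
  by (simp add: unif01_def)

lemma prob_space_unif01: "prob_space unif01"
  unfolding unif01_def by (rule prob_space_uniform_measure) auto

lemma unif01_below:
  assumes "c \<le> 1"
  shows "emeasure unif01 {u. ennreal u < c} = c"
proof -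
  have "c < \<infinity>" using assms by (rule order.strict_trans1) simp
  then obtain k where k: "c = ennreal k" "0 \<le> k" by (cases c) auto
  then have k1: "k \<le> 1" using assms by (simp add: ennreal_le_1)
  have "{u::real. ennreal u < c} \<in> sets borel" by measurable
  then have "emeasure unif01 {u. ennreal u < c} = emeasure lborel ({0..1} \<inter> {u. ennreal u < c}) / emeasure lborel {0..1::real}"
    unfolding unif01_def by (intro emeasure_uniform_measure) auto
  also have "{0..1} \<inter> {u. ennreal u < c} = {0..<k}"
    using k k1 by (auto simp: ennreal_less_iff)
  finally show ?thesis using k by (simp add: divide_ennreal_def)
qed

lemma emeasure_distr_graph:
  assumes h: "h \<in> S \<Otimes>\<^sub>M borel \<rightarrow>\<^sub>M T" and \<gamma>: "sets \<gamma> = sets S"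
    and A: "A \<in> sets S" and B: "B \<in> sets T"
  shows "emeasure (distr (\<gamma> \<Otimes>\<^sub>M unif01) (S \<Otimes>\<^sub>M T) (\<lambda>(s, u). (s, h (s, u)))) (A \<times> B)
    = (\<integral>\<^sup>+s\<in>A. emeasure unif01 {u. h (s, u) \<in> B} \<partial>\<gamma>)"
proof -
  interpret U: prob_space unif01 by (rule prob_space_unif01)
  have sets_prod: "sets (\<gamma> \<Otimes>\<^sub>M unif01) = sets (S \<Otimes>\<^sub>M borel)"
    using \<gamma> by (intro sets_pair_measure_cong) auto
  have map: "(\<lambda>(s, u). (s, h (s, u))) \<in> \<gamma> \<Otimes>\<^sub>M unif01 \<rightarrow>\<^sub>M S \<Otimes>\<^sub>M T"
    using h by (subst measurable_cong_sets[OF sets_prod refl]) (simp add: split_beta')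
  have AB: "A \<times> B \<in> sets (S \<Otimes>\<^sub>M T)" using A B by simp
  have "emeasure (distr (\<gamma> \<Otimes>\<^sub>M unif01) (S \<Otimes>\<^sub>M T) (\<lambda>(s, u). (s, h (s, u)))) (A \<times> B)
      = emeasure (\<gamma> \<Otimes>\<^sub>M unif01) ((\<lambda>(s, u). (s, h (s, u))) -` (A \<times> B) \<inter> space (\<gamma> \<Otimes>\<^sub>M unif01))"
    by (rule emeasure_distr[OF map AB])
  also have "\<dots> = (\<integral>\<^sup>+s. emeasure unif01 (Pair s -` ((\<lambda>(s, u). (s, h (s, u))) -` (A \<times> B) \<inter> space (\<gamma> \<Otimes>\<^sub>M unif01))) \<partial>\<gamma>)"
    by (intro U.emeasure_pair_measure_alt measurable_sets[OF map AB])
  also have "\<dots> = (\<integral>\<^sup>+s\<in>A. emeasure unif01 {u. h (s, u) \<in> B} \<partial>\<gamma>)"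
  proof (intro nn_integral_cong)
    fix s assume "s \<in> space \<gamma>"
    then have "Pair s -` ((\<lambda>(s, u). (s, h (s, u))) -` (A \<times> B) \<inter> space (\<gamma> \<Otimes>\<^sub>M unif01))
        = (if s \<in> A then {u. h (s, u) \<in> B} else {})"
      by (auto simp: space_pair_measure)
    then show "emeasure unif01 (Pair s -` ((\<lambda>(s, u). (s, h (s, u))) -` (A \<times> B) \<inter> space (\<gamma> \<Otimes>\<^sub>M unif01)))
        = emeasure unif01 {u. h (s, u) \<in> B} * indicator A s" by (simp add: indicator_def)
  qed
  finally show ?thesis .
qed

text \<open>The conditional quantile transform. For each rational \<open>q\<close> the function \<open>G q\<close> is the conditional probability that
the second coordinate exceeds \<open>q\<close>, obtained as a Radon--Nikodym derivative; then
\<open>h (s, u) = Sup {q. u < G q s}\<close>, applied to uniform \<open>u\<close>, has the conditional law given \<open>s\<close>. Indeed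
\<open>h (s, u)\<close> exceeds \<open>r\<close> if and only if \<open>u < G q s\<close> for some \<open>q > r\<close>, and these events increase as \<open>q\<close>
decreases to \<open>r\<close>. Bounded second coordinates keep the supremum finite everywhere; the value 0 stands in
for the supremum of the empty set.\<close>

lemma real_disintegration:
  fixes \<Gamma> :: "('s \<times> real) measure" and K :: real
  assumes \<Gamma>: "prob_space \<Gamma>" "sets \<Gamma> = sets (S \<Otimes>\<^sub>M borel)"
    and bd: "AE x in \<Gamma>. 0 \<le> snd x \<and> snd x \<le> K"
  obtains h where "h \<in> borel_measurable (S \<Otimes>\<^sub>M borel)"
    "distr (distr \<Gamma> S fst \<Otimes>\<^sub>M unif01) (S \<Otimes>\<^sub>M borel) (\<lambda>(s, u). (s, h (s, u))) = \<Gamma>"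
proof -
  interpret \<Gamma>: prob_space \<Gamma> by fact
  interpret U: prob_space unif01 by (rule prob_space_unif01)
  note [measurable_cong] = \<Gamma>(2)
  have spG: "space \<Gamma> = space S \<times> UNIV" using sets_eq_imp_space_eq[OF \<Gamma>(2)] by (simp add: space_pair_measure)
  define \<gamma> where "\<gamma> = distr \<Gamma> S fst"
  have sg [simp, measurable_cong]: "sets \<gamma> = sets S" by (simp add: \<gamma>_def)
  interpret \<gamma>: prob_space \<gamma> unfolding \<gamma>_def by (rule \<Gamma>.prob_space_distr) simp
  have tail: "A \<times> B \<in> sets \<Gamma>" if "A \<in> sets S" "B \<in> sets borel" for A and B :: "real set"
    using that by (simp add: \<Gamma>(2))
  have g_emeasure: "emeasure \<gamma> A = emeasure \<Gamma> (A \<times> UNIV)" if "A \<in> sets S" for A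
    unfolding \<gamma>_def using that sets.sets_into_space[OF that]
    by (subst emeasure_distr) (auto simp: spG intro!: arg_cong[where f = "emeasure \<Gamma>"])
  define N where "N q = distr (density \<Gamma> (indicator (space S \<times> {q<..}))) S fst" for q
  have sets_N: "sets (N q) = sets S" for q by (simp add: N_def)
  have N_emeasure: "emeasure (N q) A = emeasure \<Gamma> (A \<times> {q<..})" if A: "A \<in> sets S" for A q
  proof -
    have [measurable]: "space S \<times> {q<..} \<in> sets \<Gamma>" by (rule tail) auto
    have "emeasure (N q) A = emeasure (density \<Gamma> (indicator (space S \<times> {q<..}))) (A \<times> UNIV)"
      unfolding N_def using A sets.sets_into_space[OF A]
      by (subst emeasure_distr) (auto simp: spG intro!: arg_cong2[where f = emeasure])
    also have "\<dots> = (\<integral>\<^sup>+x. indicator (space S \<times> {q<..}) x * indicator (A \<times> UNIV) x \<partial>\<Gamma>)"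
      using tail[OF A, of UNIV] by (subst emeasure_density) auto
    also have "\<dots> = (\<integral>\<^sup>+x. indicator (A \<times> {q<..}) x \<partial>\<Gamma>)"
      using sets.sets_into_space[OF A] by (intro nn_integral_cong) (auto simp: indicator_def)
    also have "\<dots> = emeasure \<Gamma> (A \<times> {q<..})" using tail[OF A] by simp
    finally show ?thesis .
  qed
  define G where "G q = RN_deriv \<gamma> (N q)" for q
  have Gm [measurable]: "G q \<in> borel_measurable S" for q
    unfolding G_def using borel_measurable_RN_deriv[of \<gamma> "N q"] measurable_cong_sets[OF sg refl] by blast
  have GN: "(\<integral>\<^sup>+x\<in>A. G q x \<partial>\<gamma>) = emeasure \<Gamma> (A \<times> {q<..})" if A: "A \<in> sets S" for A q
  proof -
    have "absolutely_continuous \<gamma> (N q)"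
    proof (unfold absolutely_continuous_def, rule subsetI)
      fix B assume B: "B \<in> null_sets \<gamma>"
      then have BS: "B \<in> sets S" by (auto simp: null_sets_def)
      have "emeasure \<Gamma> (B \<times> {q<..}) \<le> emeasure \<Gamma> (B \<times> UNIV)"
        by (intro emeasure_mono tail BS) auto
      then show "B \<in> null_sets (N q)"
        using B BS sets_N by (auto simp: null_sets_def g_emeasure N_emeasure)
    qed
    then have "density \<gamma> (G q) = N q"
      unfolding G_def by (intro \<gamma>.density_RN_deriv) (auto simp: N_def)
    then have "emeasure (density \<gamma> (G q)) A = emeasure \<Gamma> (A \<times> {q<..})" using N_emeasure[OF A] by simp
    then show ?thesis using A by (subst (asm) emeasure_density) auto
  qed
  have Gfin: "(\<integral>\<^sup>+x. G q x \<partial>\<gamma>) \<noteq> \<infinity>" for q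
  proof -
    have "(\<integral>\<^sup>+x. G q x \<partial>\<gamma>) = (\<integral>\<^sup>+x\<in>space S. G q x \<partial>\<gamma>)"
      using sets_eq_imp_space_eq[OF sg] by (intro nn_integral_cong) (auto simp: indicator_def)
    then show ?thesis using GN[of "space S" q] by simp
  qed
  have Gmono: "AE s in \<gamma>. G q' s \<le> G q s" if "q \<le> q'" for q q'
  proof (rule AE_le_of_nn_integral_le[OF _ _ Gfin])
    fix A assume "A \<in> sets \<gamma>"
    then have A: "A \<in> sets S" by simp
    show "(\<integral>\<^sup>+x\<in>A. G q' x \<partial>\<gamma>) \<le> (\<integral>\<^sup>+x\<in>A. G q x \<partial>\<gamma>)"
      unfolding GN[OF A] using that by (intro emeasure_mono tail A) auto
  qed measurable
  have G1: "AE s in \<gamma>. G q s \<le> 1" for q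
  proof (rule AE_le_of_nn_integral_le[OF _ _ Gfin])
    fix A assume "A \<in> sets \<gamma>"
    then have A: "A \<in> sets S" by simp
    have "(\<integral>\<^sup>+x\<in>A. 1 \<partial>\<gamma>) = emeasure \<Gamma> (A \<times> UNIV)" using A by (simp add: g_emeasure)
    moreover have "emeasure \<Gamma> (A \<times> {q<..}) \<le> emeasure \<Gamma> (A \<times> UNIV)"
      by (intro emeasure_mono tail A) auto
    ultimately show "(\<integral>\<^sup>+x\<in>A. G q x \<partial>\<gamma>) \<le> (\<integral>\<^sup>+x\<in>A. 1 \<partial>\<gamma>)"
      unfolding GN[OF A] by simp
  qed measurable
  define Q where "Q = \<rat> \<inter> {0..max 0 K}"
  have Q: "countable Q" "0 \<in> Q" by (auto simp: Q_def countable_rat intro: countable_subset[OF _ countable_rat])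
  define f where "f q x = (if ennreal (snd x) < G q (fst x) then q else 0)" for q and x :: "'s \<times> real"
  define h where "h x = (SUP q\<in>Q. f q x)" for x
  have fb: "bdd_above ((\<lambda>q. f q x) ` Q)" for x
    by (rule bdd_aboveI[of _ "max 0 K"]) (auto simp: f_def Q_def)
  have fm: "f q \<in> borel_measurable (S \<Otimes>\<^sub>M borel)" for q unfolding f_def[abs_def] by measurable
  have hm: "h \<in> borel_measurable (S \<Otimes>\<^sub>M borel)"
    unfolding h_def[abs_def] by (rule borel_measurable_cSUP[OF Q(1)]) (use fm fb in auto)
  have h_gt: "r < h x \<longleftrightarrow> (\<exists>q\<in>Q. r < q \<and> ennreal (snd x) < G q (fst x))" if "0 \<le> r" for r x
    unfolding h_def using that Q by (subst less_cSUP_iff[OF _ fb]) (auto simp: f_def)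
  have h0: "0 \<le> h x" for x
    unfolding h_def using cSUP_upper[OF Q(2) fb, of x] by (auto simp: f_def split: if_splits)
  have slice: "emeasure unif01 {u. r < h (s, u)} = (SUP n. G (q n) s)"
    if sl: "0 \<le> r" "\<And>n. q n \<in> Q" "\<And>n. r < q n" "q \<longlonglongrightarrow> r"
      "\<And>n q'. q' \<in> Q \<Longrightarrow> q n \<le> q' \<Longrightarrow> G q' s \<le> G (q n) s" "\<And>n. G (q n) s \<le> 1" for r q s
  proof -
    have "{u. r < h (s, u)} = {u. ennreal u < (SUP n. G (q n) s)}"
    proof (intro set_eqI iffI; clarsimp)
      fix u assume "r < h (s, u)"
      then obtain q' where q': "q' \<in> Q" "r < q'" "ennreal u < G q' s" using h_gt[OF sl(1)] by auto
      from order_tendstoD(2)[OF sl(4) q'(2)] obtain n where "q n < q'"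
        by (auto simp: eventually_sequentially)
      then have "ennreal u < G (q n) s" using sl(5)[OF q'(1), of n] q'(3) by auto
      then show "ennreal u < (SUP n. G (q n) s)" by (auto simp: less_SUP_iff)
    next
      fix u assume "ennreal u < (SUP n. G (q n) s)"
      then show "r < h (s, u)" using sl(2,3) by (auto simp: less_SUP_iff h_gt[OF sl(1)])
    qed
    then show ?thesis using sl(6) by (simp add: unif01_below SUP_least)
  qed
  define L where "L = distr (\<gamma> \<Otimes>\<^sub>M unif01) (S \<Otimes>\<^sub>M borel) (\<lambda>(s, u). (s, h (s, u)))"
  have hm' [measurable]: "h \<in> borel_measurable (\<gamma> \<Otimes>\<^sub>M unif01)"
    using hm by (subst measurable_cong_sets[OF _ refl]) (auto intro!: sets_pair_measure_cong)
  have Lmap [measurable]: "(\<lambda>(s, u). (s, h (s, u))) \<in> \<gamma> \<Otimes>\<^sub>M unif01 \<rightarrow>\<^sub>M S \<Otimes>\<^sub>M borel" by measurable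
  interpret \<gamma>U: pair_prob_space \<gamma> unif01 ..
  interpret L: prob_space L unfolding L_def by (rule \<gamma>U.prob_space_distr) measurable
  note L_Times = emeasure_distr_graph[OF hm sg, folded L_def]
  have tails: "emeasure L (A \<times> {r<..}) = emeasure \<Gamma> (A \<times> {r<..})" if A: "A \<in> sets S" for A r
  proof -
    consider "r < 0" | "0 \<le> r" "K \<le> r" | "0 \<le> r" "r < K" by linarith
    then show ?thesis
    proof cases
      case 1
      have "emeasure \<Gamma> (A \<times> {r<..}) = emeasure \<Gamma> (A \<times> UNIV)"
        using bd 1 by (intro emeasure_eq_AE tail A) (auto elim!: eventually_mono)
      moreover have "emeasure L (A \<times> {r<..}) = (\<integral>\<^sup>+s\<in>A. 1 \<partial>\<gamma>)"
      proof -
        have "{u. h (s, u) \<in> {r<..}} = space unif01" for s using h0[of "(s, _)"] 1 by (auto intro: less_le_trans)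
        then show ?thesis using L_Times[OF A, of "{r<..}"] U.emeasure_space_1 by simp
      qed
      ultimately show ?thesis using A by (simp add: g_emeasure)
    next
      case 2
      have "emeasure \<Gamma> (A \<times> {r<..}) = emeasure \<Gamma> {}"
      proof (intro emeasure_eq_AE tail A)
        show "AE x in \<Gamma>. x \<in> A \<times> {r<..} \<longleftrightarrow> x \<in> {}"
          using bd by eventually_elim (use 2 in auto)
      qed auto
      moreover have "{u. h (s, u) \<in> {r<..}} = {}" for s
        using 2 by (auto simp: h_gt[OF 2(1)] Q_def)
      then have "emeasure L (A \<times> {r<..}) = 0" using L_Times[OF A, of "{r<..}"] by simp
      ultimately show ?thesis by simp
    next
      case 3
      have "\<exists>q. (\<forall>n. q n \<in> Q \<and> r < q n \<and> q n < r + 1 / Suc n) \<and> (\<forall>n. q (Suc n) < q n)"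
      proof -
        have ex: "\<exists>x. x \<in> Q \<and> r < x \<and> x < e" if "r < e" for e
        proof -
          have "r < min e K" using that 3 by simp
          from Rats_dense_in_real[OF this] show ?thesis using 3 by (force simp: Q_def)
        qed
        have "\<exists>q. \<forall>n. (q n \<in> Q \<and> r < q n \<and> q n < r + 1 / Suc n) \<and> q (Suc n) < q n"
        proof (rule dependent_nat_choice)
          show "\<exists>x. x \<in> Q \<and> r < x \<and> x < r + 1 / Suc 0" by (rule ex) simp
          fix x n assume x: "x \<in> Q \<and> r < x \<and> x < r + 1 / Suc n"
          have "r < min x (r + 1 / Suc (Suc n))" using x by simp
          from ex[OF this] show "\<exists>y. (y \<in> Q \<and> r < y \<and> y < r + 1 / Suc (Suc n)) \<and> y < x" by auto
        qed
        then show ?thesis by blast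
      qed
      then obtain q where q: "\<And>n. q n \<in> Q" "\<And>n. r < q n" "\<And>n. q n < r + 1 / Suc n" "\<And>n. q (Suc n) < q n" by blast
      have qlim: "q \<longlonglongrightarrow> r"
      proof (rule real_tendsto_sandwich[OF always_eventually always_eventually tendsto_const])
        show "(\<lambda>n. r + 1 / Suc n) \<longlonglongrightarrow> r"
          using tendsto_add[OF tendsto_const LIMSEQ_Suc[OF lim_1_over_n]] by (simp add: inverse_eq_divide)
      qed (use q in \<open>auto simp: less_imp_le\<close>)
      have ae: "AE s in \<gamma>. (\<forall>n. \<forall>q'\<in>Q. q n \<le> q' \<longrightarrow> G q' s \<le> G (q n) s) \<and> (\<forall>n. G (q n) s \<le> 1)"
        using Q Gmono G1 by (auto simp: AE_all_countable AE_ball_countable AE_impI)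
      have "emeasure L (A \<times> {r<..}) = (\<integral>\<^sup>+s. (SUP n. G (q n) s * indicator A s) \<partial>\<gamma>)"
      proof (subst L_Times[OF A], simp, rule nn_integral_cong_AE)
        show "AE s in \<gamma>. emeasure unif01 {u. h (s, u) \<in> {r<..}} * indicator A s = (SUP n. G (q n) s * indicator A s)"
          using ae
        proof eventually_elim
          case (elim s)
          then have "emeasure unif01 {u. r < h (s, u)} = (SUP n. G (q n) s)"
            using q qlim 3 by (intro slice) auto
          then show ?case by (auto simp: indicator_def)
        qed
      qed
      also have "\<dots> = (SUP n. \<integral>\<^sup>+s. G (q n) s * indicator A s \<partial>\<gamma>)"
      proof (rule nn_integral_monotone_convergence_SUP_AE)
        show "AE s in \<gamma>. G (q n) s * indicator A s \<le> G (q (Suc n)) s * indicator A s" for n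
          using ae q(1,4) by (elim eventually_mono) (auto intro!: mult_right_mono simp: less_imp_le)
      qed (use A in measurable)
      also have "\<dots> = (SUP n. emeasure \<Gamma> (A \<times> {q n<..}))" by (simp add: GN[OF A])
      also have "\<dots> = emeasure \<Gamma> (\<Union>n. A \<times> {q n<..})"
      proof (rule SUP_emeasure_incseq)
        show "range (\<lambda>n. A \<times> {q n<..}) \<subseteq> sets \<Gamma>" using tail[OF A] by auto
        show "incseq (\<lambda>n. A \<times> {q n<..})" using q(4) by (intro incseq_SucI) (fastforce intro: less_trans)
      qed
      also have "(\<Union>n. A \<times> {q n<..}) = A \<times> {r<..}"
      proof (intro set_eqI iffI)
        fix x assume "x \<in> A \<times> {r<..}"
        then have "r < snd x" "fst x \<in> A" by auto
        with eventually_happens'[OF sequentially_bot order_tendstoD(2)[OF qlim]]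
        obtain n where "q n < snd x" "fst x \<in> A" by blast
        then show "x \<in> (\<Union>n. A \<times> {q n<..})" by (cases x) auto
      qed (use q(2) in \<open>auto intro: less_trans\<close>)
      finally show ?thesis .
    qed
  qed
  have "L = \<Gamma>"
  proof (rule measure_eqI_Times)
    show "finite_measure L" by unfold_locales
    show sL: "sets L = sets (S \<Otimes>\<^sub>M borel)" by (simp add: L_def)
    show "sets \<Gamma> = sets (S \<Otimes>\<^sub>M borel)" by fact
    fix A :: "'s set" and B :: "real set" assume A: "A \<in> sets S" and B: "B \<in> sets borel"
    have slice_measure: "emeasure (distr (density M (indicator (A \<times> UNIV))) borel snd) B' = emeasure M (A \<times> B')"
      if M: "sets M = sets (S \<Otimes>\<^sub>M borel)" and B': "B' \<in> sets borel" for M B'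
    proof -
      note [measurable_cong] = M
      have spM: "space M = space S \<times> UNIV" using sets_eq_imp_space_eq[OF M] by (simp add: space_pair_measure)
      have [measurable]: "A \<times> UNIV \<in> sets M" "space S \<times> B' \<in> sets M" "A \<times> B' \<in> sets M" using A B' M by auto
      have "emeasure (distr (density M (indicator (A \<times> UNIV))) borel snd) B'
          = emeasure (density M (indicator (A \<times> UNIV))) (space S \<times> B')"
        using B' by (subst emeasure_distr) (auto simp: spM intro!: arg_cong2[where f = emeasure])
      also have "\<dots> = (\<integral>\<^sup>+x. indicator (A \<times> UNIV) x * indicator (space S \<times> B') x \<partial>M)"
        by (subst emeasure_density) auto
      also have "\<dots> = (\<integral>\<^sup>+x. indicator (A \<times> B') x \<partial>M)"
        using sets.sets_into_space[OF A] by (intro nn_integral_cong) (auto simp: indicator_def)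
      finally show ?thesis by simp
    qed
    have "distr (density L (indicator (A \<times> UNIV))) borel snd = distr (density \<Gamma> (indicator (A \<times> UNIV))) borel snd"
    proof (rule measure_eqI_lessThan)
      fix x :: real
      show "emeasure (distr (density L (indicator (A \<times> UNIV))) borel snd) {x<..} < \<infinity>"
        by (subst slice_measure[OF sL]) (auto simp: less_top[symmetric])
      show "emeasure (distr (density L (indicator (A \<times> UNIV))) borel snd) {x<..}
          = emeasure (distr (density \<Gamma> (indicator (A \<times> UNIV))) borel snd) {x<..}"
        by (simp add: slice_measure[OF sL] slice_measure[OF \<Gamma>(2)] tails[OF A])
    qed auto
    then show "emeasure L (A \<times> B) = emeasure \<Gamma> (A \<times> B)"
      using slice_measure[OF sL B] slice_measure[OF \<Gamma>(2) B] by simp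
  qed
  then show thesis using that[OF hm] by (simp add: L_def \<gamma>_def)
qed

text \<open>Transport the real case along the coding of \<open>euclidean_borel_code\<close>.\<close>

theorem disintegration_unif01:
  fixes \<Gamma> :: "('s \<times> 'a::euclidean_space) measure"
  assumes \<Gamma>: "prob_space \<Gamma>" "sets \<Gamma> = sets (S \<Otimes>\<^sub>M borel)"
  obtains h where "h \<in> borel_measurable (S \<Otimes>\<^sub>M borel)"
    "distr (distr \<Gamma> S fst \<Otimes>\<^sub>M unif01) (S \<Otimes>\<^sub>M borel) (\<lambda>(s, u). (s, h (s, u))) = \<Gamma>"
proof -
  interpret \<Gamma>: prob_space \<Gamma> by fact
  note [measurable_cong] = \<Gamma>(2)
  obtain e :: "'a \<Rightarrow> real" and g where [measurable]: "e \<in> borel_measurable borel" "g \<in> borel_measurable borel"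
    and ge: "\<And>x. g (e x) = x" and e01: "\<And>x. 0 \<le> e x" "\<And>x. e x \<le> 2"
    by (rule euclidean_borel_code) blast
  define \<Gamma>' where "\<Gamma>' = distr \<Gamma> (S \<Otimes>\<^sub>M borel) (\<lambda>(s, x). (s, e x))"
  have "prob_space \<Gamma>'" unfolding \<Gamma>'_def by (rule \<Gamma>.prob_space_distr) measurable
  moreover have "sets \<Gamma>' = sets (S \<Otimes>\<^sub>M borel)" by (simp add: \<Gamma>'_def)
  moreover have "AE x in \<Gamma>'. 0 \<le> snd x \<and> snd x \<le> 2"
    unfolding \<Gamma>'_def by (subst AE_distr_iff) (auto simp: e01)
  ultimately obtain h where h [measurable]: "h \<in> borel_measurable (S \<Otimes>\<^sub>M borel)"
    and eq: "distr (distr \<Gamma>' S fst \<Otimes>\<^sub>M unif01) (S \<Otimes>\<^sub>M borel) (\<lambda>(s, u). (s, h (s, u))) = \<Gamma>'"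
    by (rule real_disintegration)
  have fst: "distr \<Gamma>' S fst = distr \<Gamma> S fst"
    unfolding \<Gamma>'_def by (subst distr_distr) (auto simp: comp_def split_beta')
  have sets_prod: "sets (distr \<Gamma> S fst \<Otimes>\<^sub>M unif01) = sets (S \<Otimes>\<^sub>M borel)"
    by (intro sets_pair_measure_cong) auto
  note [measurable_cong] = sets_prod
  have "\<Gamma> = distr \<Gamma> (S \<Otimes>\<^sub>M borel) (\<lambda>x. x)" by (rule distr_id2[symmetric]) (simp add: \<Gamma>)
  also have "\<dots> = distr \<Gamma>' (S \<Otimes>\<^sub>M borel) (\<lambda>(s, r). (s, g r))"
    unfolding \<Gamma>'_def by (subst distr_distr) (auto simp: comp_def split_beta' ge)
  also have "\<dots> = distr (distr \<Gamma> S fst \<Otimes>\<^sub>M unif01) (S \<Otimes>\<^sub>M borel) (\<lambda>(s, u). (s, g (h (s, u))))"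
  proof -
    have "distr (distr (distr \<Gamma> S fst \<Otimes>\<^sub>M unif01) (S \<Otimes>\<^sub>M borel) (\<lambda>(s, u). (s, h (s, u))))
        (S \<Otimes>\<^sub>M borel) (\<lambda>(s, r). (s, g r))
      = distr (distr \<Gamma> S fst \<Otimes>\<^sub>M unif01) (S \<Otimes>\<^sub>M borel) (\<lambda>(s, u). (s, g (h (s, u))))"
      by (subst distr_distr) (auto simp: comp_def split_beta')
    then show ?thesis by (simp only: eq[unfolded fst])
  qed
  finally show thesis by (intro that[of "\<lambda>x. g (h x)"]) (auto simp: split_beta')
qed

section \<open>Kernels from joint laws\<close>

lemma measurable_unif01_kernel:
  assumes [measurable]: "h \<in> borel_measurable (borel \<Otimes>\<^sub>M borel)"
  shows "(\<lambda>x. distr unif01 borel (\<lambda>u. h (x, u))) \<in> kernels"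
proof -
  interpret U: prob_space unif01 by (rule prob_space_unif01)
  have [measurable]: "unif01 \<in> space (subprob_algebra borel)"
    using U.M_in_subprob subprob_algebra_cong[OF sets_unif01] by simp
  have "(\<lambda>x. distr unif01 borel (\<lambda>u. h (x, u))) \<in> borel \<rightarrow>\<^sub>M subprob_algebra borel"
    by (rule measurable_distr2[where M = borel]) measurable
  moreover have "prob_space (distr unif01 borel (\<lambda>u. h (x, u)))" for x
    by (rule U.prob_space_distr) measurable
  ultimately show ?thesis unfolding kernels_def by (intro measurable_prob_algebraI) auto
qed

lemma sets_kernel_joint:
  assumes "prob_space \<mu>" "sets \<mu> = sets borel" "\<psi> \<in> kernels"
  shows "sets (kernel_joint \<mu> \<psi>) = sets (borel \<Otimes>\<^sub>M borel)"
    and "prob_space (kernel_joint \<mu> \<psi>)"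
proof -
  interpret prob_space \<mu> by fact
  note [measurable_cong] = assms(2)
  have psi: "\<psi> \<in> borel \<rightarrow>\<^sub>M prob_algebra borel" using assms by (simp add: kernels_def)
  then have [measurable]: "\<psi> \<in> \<mu> \<rightarrow>\<^sub>M prob_algebra borel" by measurable
  have m: "(\<lambda>x. distr (\<psi> x) (borel \<Otimes>\<^sub>M borel) (Pair x)) \<in> \<mu> \<rightarrow>\<^sub>M prob_algebra (borel \<Otimes>\<^sub>M borel)"
    by (rule measurable_distr_prob_space2[where M = borel]) measurable
  show "sets (kernel_joint \<mu> \<psi>) = sets (borel \<Otimes>\<^sub>M borel)"
    unfolding kernel_joint_def using m not_empty
    by (subst sets_bind[where N = "borel \<Otimes>\<^sub>M borel"]) (auto dest: measurable_space simp: space_prob_algebra)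
  show "prob_space (kernel_joint \<mu> \<psi>)"
    unfolding kernel_joint_def
    by (rule prob_space_bind'[OF _ m]) (auto simp: space_prob_algebra assms)
qed

lemma kernel_exists:
  fixes L :: "('a::euclidean_space \<times> 'a) measure"
  assumes L: "prob_space L" "sets L = sets (borel \<Otimes>\<^sub>M borel)"
  obtains \<psi> where "\<psi> \<in> kernels" "kernel_joint (distr L borel fst) \<psi> = L"
proof -
  interpret L: prob_space L by fact
  interpret U: prob_space unif01 by (rule prob_space_unif01)
  note [measurable_cong] = L(2)
  define \<mu> where "\<mu> = distr L borel fst"
  have \<mu>: "prob_space \<mu>" "sets \<mu> = sets borel"
    unfolding \<mu>_def by (auto intro!: L.prob_space_distr)
  obtain h where h [measurable]: "h \<in> borel_measurable (borel \<Otimes>\<^sub>M borel)"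
    and eq: "distr (\<mu> \<Otimes>\<^sub>M unif01) (borel \<Otimes>\<^sub>M borel) (\<lambda>(s, u). (s, h (s, u))) = L"
    by (rule disintegration_unif01[OF L, folded \<mu>_def])
  define \<psi> where "\<psi> x = distr unif01 borel (\<lambda>u. h (x, u))" for x
  have \<psi>: "\<psi> \<in> kernels" unfolding \<psi>_def using measurable_unif01_kernel[OF h] .
  have sets_prod: "sets (\<mu> \<Otimes>\<^sub>M unif01) = sets (borel \<Otimes>\<^sub>M borel)"
    using \<mu> by (intro sets_pair_measure_cong) auto
  note [measurable_cong] = sets_prod \<mu>(2)
  interpret K: prob_space "kernel_joint \<mu> \<psi>" by (rule sets_kernel_joint[OF \<mu> \<psi>])
  have "kernel_joint \<mu> \<psi> = L"
  proof (rule measure_eqI_Times)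
    show "finite_measure (kernel_joint \<mu> \<psi>)" by unfold_locales
    show "sets (kernel_joint \<mu> \<psi>) = sets (borel \<Otimes>\<^sub>M borel)" by (rule sets_kernel_joint[OF \<mu> \<psi>])
    fix A B :: "'a set" assume [measurable]: "A \<in> sets borel" "B \<in> sets borel"
    have "emeasure (\<psi> x) B = emeasure unif01 {u. h (x, u) \<in> B}" for x
      unfolding \<psi>_def by (subst emeasure_distr) (auto simp: vimage_def)
    then show "emeasure (kernel_joint \<mu> \<psi>) (A \<times> B) = emeasure L (A \<times> B)"
      using emeasure_distr_graph[OF h \<mu>(2), of A B]
      by (simp add: emeasure_kernel_joint[OF \<mu> \<psi>] eq)
  qed (use L in auto)
  with \<psi> show thesis using that by (simp add: \<mu>_def)
qed

lemma kernel_joint_uminus: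
  fixes \<mu> :: "'a::euclidean_space measure"
  assumes "prob_space \<mu>" "sets \<mu> = sets borel" "\<psi> \<in> kernels"
  shows "kernel_joint \<mu> (\<lambda>x. distr (\<psi> x) borel uminus)
    = distr (kernel_joint \<mu> \<psi>) (borel \<Otimes>\<^sub>M borel) (\<lambda>(x, z). (x, - z))"
proof -
  interpret prob_space \<mu> by fact
  note [measurable_cong] = assms(2)
  have psi [measurable]: "\<psi> \<in> borel \<rightarrow>\<^sub>M subprob_algebra borel"
    using assms(3) measurable_prob_algebraD unfolding kernels_def by blast
  have psi_sets [simp]: "sets (\<psi> x) = sets borel" for x
    using measurable_space[OF psi, of x] by (simp add: space_subprob_algebra)
  have m: "(\<lambda>x. distr (\<psi> x) (borel \<Otimes>\<^sub>M borel) (Pair x)) \<in> \<mu> \<rightarrow>\<^sub>M subprob_algebra (borel \<Otimes>\<^sub>M borel)"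
    by (rule measurable_distr2[where M = borel]) measurable
  have neg: "(\<lambda>(x :: 'a, z :: 'a). (x, - z)) \<in> borel \<Otimes>\<^sub>M borel \<rightarrow>\<^sub>M borel \<Otimes>\<^sub>M borel" by measurable
  have "distr (distr (\<psi> x) borel uminus) (borel \<Otimes>\<^sub>M borel) (Pair x)
      = distr (distr (\<psi> x) (borel \<Otimes>\<^sub>M borel) (Pair x)) (borel \<Otimes>\<^sub>M borel) (\<lambda>(x, z). (x, - z))" for x
  proof -
    have "uminus \<in> \<psi> x \<rightarrow>\<^sub>M borel" "Pair x \<in> \<psi> x \<rightarrow>\<^sub>M borel \<Otimes>\<^sub>M borel"
      by (simp_all add: measurable_cong_sets[OF psi_sets refl])
    then show ?thesis by (simp add: distr_distr[OF neg] distr_distr comp_def)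
  qed
  then show ?thesis
    unfolding kernel_joint_def by (simp only: distr_bind[OF m not_empty neg])
qed

section \<open>A probability space that never runs out of noise\<close>

text \<open>The product of uncountably many copies of the unit interval. A random variable with values in a
second countable space depends on countably many coordinates only, so some coordinate is
independent of it. This is why every coupling of the law of \<open>X\<close> with a second law
is the joint law of \<open>X\<close> and another random variable on the same space.\<close>

definition cube :: "(real \<Rightarrow> real) measure" where
  "cube = PiM UNIV (\<lambda>_. unif01)"

abbreviation law where
  "law X \<equiv> distr cube borel X"

lemma prob_space_cube: "prob_space cube"
  unfolding cube_def by (intro prob_space_PiM prob_space_unif01)

lemma space_cube [simp]: "space cube = UNIV"
  by (simp add: cube_def space_PiM)

lemma cube_set_countable_support:
  assumes "A \<in> sets cube"
  shows "\<exists>J. countable J \<and> (\<forall>w w'. (\<forall>j\<in>J. w j = w' j) \<longrightarrow> (w \<in> A \<longleftrightarrow> w' \<in> A))"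
proof -
  have "A \<in> sigma_sets UNIV {{f. f i \<in> B} |i B. B \<in> sets borel}"
    using assms by (simp add: cube_def sets_PiM_single)
  then show ?thesis
  proof (induction rule: sigma_sets.induct)
    case (Basic a)
    then obtain i B where "a = {f. f i \<in> B}" by blast
    then show ?case by (intro exI[of _ "{i}"]) auto
  next
    case Empty
    then show ?case by auto
  next
    case (Compl a)
    then show ?case by auto
  next
    case (Union a)
    then have "\<forall>i. \<exists>J. countable J \<and> (\<forall>w w'. (\<forall>j\<in>J. w j = w' j) \<longrightarrow> (w \<in> a i \<longleftrightarrow> w' \<in> a i))" by blast
    then obtain J where J: "\<And>i. countable (J i)"
      "\<And>i w w'. (\<forall>j\<in>J i. w j = w' j) \<Longrightarrow> (w \<in> a i \<longleftrightarrow> w' \<in> a i)" by (metis (no_types, lifting))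
    have "w \<in> \<Union> (range a) \<longleftrightarrow> w' \<in> \<Union> (range a)" if "\<forall>j\<in>\<Union> (range J). w j = w' j" for w w'
    proof -
      have "w \<in> a i \<longleftrightarrow> w' \<in> a i" for i using that by (intro J(2)) auto
      then show ?thesis by simp
    qed
    moreover have "countable (\<Union> (range J))" using J(1) by auto
    ultimately show ?case by blast
  qed
qed

lemma cube_rv_fresh_coordinate:
  fixes X :: "(real \<Rightarrow> real) \<Rightarrow> 'c::{second_countable_topology, t0_space}"
  assumes X: "X \<in> borel_measurable cube"
  obtains i where "\<And>w v. X (w(i := v)) = X w"
proof -
  obtain \<B> :: "'c set set" where \<B>: "countable \<B>" "topological_basis \<B>" using ex_countable_basis by blast
  have "X -` B \<in> sets cube" if "B \<in> \<B>" for B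
    using measurable_sets[OF X borel_open[OF topological_basis_open[OF \<B>(2) that]]] by simp
  then have "\<forall>B\<in>\<B>. \<exists>J. countable J \<and> (\<forall>w w'. (\<forall>j\<in>J. w j = w' j) \<longrightarrow> (X w \<in> B \<longleftrightarrow> X w' \<in> B))"
    using cube_set_countable_support unfolding vimage_eq[symmetric] by blast
  then obtain J where J: "\<And>B. B \<in> \<B> \<Longrightarrow> countable (J B)"
    "\<And>B w w'. B \<in> \<B> \<Longrightarrow> (\<forall>j\<in>J B. w j = w' j) \<Longrightarrow> (X w \<in> B \<longleftrightarrow> X w' \<in> B)"
    by (metis (no_types, lifting))
  have "countable (\<Union>B\<in>\<B>. J B)" using \<B> J by auto
  then have "(\<Union>B\<in>\<B>. J B) \<noteq> UNIV" using uncountable_UNIV_real by metis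
  then obtain i where i: "i \<notin> (\<Union>B\<in>\<B>. J B)" by auto
  have "X (w(i := v)) = X w" for w v
  proof (rule ccontr)
    assume "X (w(i := v)) \<noteq> X w"
    then obtain O' where O': "open O'" "(X (w(i := v)) \<in> O') \<noteq> (X w \<in> O')"
      using separation_t0[of "X (w(i := v))" "X w"] by auto
    have agree: "(X (w(i := v)) \<in> B) = (X w \<in> B)" if "B \<in> \<B>" for B
      using i that by (intro J(2)[OF that]) auto
    have "y \<in> O' \<Longrightarrow> \<exists>B\<in>\<B>. y \<in> B \<and> B \<subseteq> O'" for y
      using topological_basisE[OF \<B>(2) O'(1)] by metis
    then show False using O'(2) agree by blast
  qed
  then show thesis using that by blast
qed

text \<open>Resampling the coordinate \<open>i\<close> does not change the product measure, and it does not change \<open>X\<close>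
if \<open>X\<close> does not depend on that coordinate.\<close>

lemma cube_independent_uniform:
  fixes X :: "(real \<Rightarrow> real) \<Rightarrow> 'c::{second_countable_topology, t0_space}"
  assumes X [measurable]: "X \<in> borel_measurable cube"
  obtains \<xi> where "\<xi> \<in> borel_measurable cube"
    "distr cube (borel \<Otimes>\<^sub>M borel) (\<lambda>w. (X w, \<xi> w)) = law X \<Otimes>\<^sub>M unif01"
proof -
  interpret P: prob_space cube by (rule prob_space_cube)
  interpret U: prob_space unif01 by (rule prob_space_unif01)
  obtain i where i: "\<And>w v. X (w(i := v)) = X w" by (rule cube_rv_fresh_coordinate[OF X]) blast
  have \<xi> [measurable]: "(\<lambda>w. w i) \<in> borel_measurable cube"
    unfolding cube_def by (subst measurable_cong_sets[OF refl sets_unif01[symmetric]]) measurable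
  have upd [measurable]: "(\<lambda>(v, w). w(i := v)) \<in> unif01 \<Otimes>\<^sub>M cube \<rightarrow>\<^sub>M cube"
  proof -
    have c: "(\<lambda>x. (snd x) j) \<in> unif01 \<Otimes>\<^sub>M cube \<rightarrow>\<^sub>M unif01" for j
      unfolding cube_def by measurable
    have "(\<lambda>x. ((snd x)(i := fst x)) j) \<in> unif01 \<Otimes>\<^sub>M cube \<rightarrow>\<^sub>M unif01" for j
      using c[of j] by (cases "j = i") simp_all
    then have "(\<lambda>x. (snd x)(i := fst x)) \<in> unif01 \<Otimes>\<^sub>M cube \<rightarrow>\<^sub>M PiM UNIV (\<lambda>_. unif01)"
      by (intro measurable_PiM_single') auto
    then show ?thesis by (simp add: cube_def split_beta')
  qed
  have resample: "distr (unif01 \<Otimes>\<^sub>M cube) cube (\<lambda>(v, w). w(i := v)) = cube"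
    using distr_pair_PiM_eq_PiM[of UNIV "\<lambda>_. unif01" i] prob_space_unif01 by (simp add: cube_def)
  interpret UP: pair_prob_space unif01 cube ..
  have "distr cube (borel \<Otimes>\<^sub>M borel) (\<lambda>w. (X w, w i))
     = distr (distr (unif01 \<Otimes>\<^sub>M cube) cube (\<lambda>(v, w). w(i := v))) (borel \<Otimes>\<^sub>M borel) (\<lambda>w. (X w, w i))"
    by (simp only: resample)
  also have "\<dots> = distr (unif01 \<Otimes>\<^sub>M cube) (borel \<Otimes>\<^sub>M borel) (\<lambda>(v, w). (X w, v))"
    by (subst distr_distr) (auto simp: comp_def split_beta' i)
  also have "\<dots> = law X \<Otimes>\<^sub>M unif01"
  proof -
    have idm: "(\<lambda>x. x) \<in> borel_measurable unif01" by (rule measurable_ident_sets) simp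
    have "law X \<Otimes>\<^sub>M distr unif01 borel (\<lambda>x. x)
        = distr (cube \<Otimes>\<^sub>M unif01) (borel \<Otimes>\<^sub>M borel) (\<lambda>(x, y). (X x, y))"
      by (rule pair_measure_distr) (auto intro!: idm prob_space_imp_sigma_finite U.prob_space_distr)
    also have "\<dots> = distr (distr (cube \<Otimes>\<^sub>M unif01) (unif01 \<Otimes>\<^sub>M cube) (\<lambda>(x, y). (y, x)))
        (borel \<Otimes>\<^sub>M borel) (\<lambda>(v, w). (X w, v))"
      by (subst distr_distr) (auto simp: comp_def split_beta')
    also have "\<dots> = distr (unif01 \<Otimes>\<^sub>M cube) (borel \<Otimes>\<^sub>M borel) (\<lambda>(v, w). (X w, v))"
      by (simp only: UP.distr_pair_swap[symmetric])
    also have "distr unif01 borel (\<lambda>x. x) = unif01" by (rule distr_id2) simp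
    finally show ?thesis by simp
  qed
  finally show thesis using that[OF \<xi>] by simp
qed

text \<open>Feed a coordinate independent of \<open>X\<close> into the disintegration of the coupling.\<close>

lemma cube_realise_coupling:
  fixes X :: "(real \<Rightarrow> real) \<Rightarrow> 'c::{second_countable_topology, t0_space}"
    and \<Gamma> :: "('c \<times> 'a::euclidean_space) measure"
  assumes X [measurable]: "X \<in> borel_measurable cube"
    and \<Gamma>: "prob_space \<Gamma>" "sets \<Gamma> = sets (borel \<Otimes>\<^sub>M borel)" "distr \<Gamma> borel fst = law X"
  obtains Y where "Y \<in> borel_measurable cube" "distr cube (borel \<Otimes>\<^sub>M borel) (\<lambda>w. (X w, Y w)) = \<Gamma>"
proof -
  obtain h where h [measurable]: "h \<in> borel_measurable (borel \<Otimes>\<^sub>M borel)"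
    and eq: "distr (law X \<Otimes>\<^sub>M unif01) (borel \<Otimes>\<^sub>M borel) (\<lambda>(s, u). (s, h (s, u))) = \<Gamma>"
    by (rule disintegration_unif01[OF \<Gamma>(1,2), unfolded \<Gamma>(3)])
  obtain \<xi> where [measurable]: "\<xi> \<in> borel_measurable cube"
    and \<xi>: "distr cube (borel \<Otimes>\<^sub>M borel) (\<lambda>w. (X w, \<xi> w)) = law X \<Otimes>\<^sub>M unif01"
    by (rule cube_independent_uniform[OF X])
  have "distr cube (borel \<Otimes>\<^sub>M borel) (\<lambda>w. (X w, h (X w, \<xi> w))) = \<Gamma>"
    unfolding eq[symmetric] \<xi>[symmetric] by (subst distr_distr) (auto simp: comp_def)
  then show thesis by (intro that[of "\<lambda>w. h (X w, \<xi> w)"]) auto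
qed

lemma cube_realise_law:
  fixes \<mu> :: "'a::euclidean_space measure"
  assumes \<mu>: "prob_space \<mu>" "sets \<mu> = sets borel"
  obtains Y where "Y \<in> borel_measurable cube" "law Y = \<mu>"
proof -
  interpret \<mu>: prob_space \<mu> by fact
  interpret P: prob_space cube by (rule prob_space_cube)
  note [measurable_cong] = \<mu>(2)
  define \<Gamma> where "\<Gamma> = distr \<mu> (borel \<Otimes>\<^sub>M borel) (\<lambda>x. (0::real, x))"
  have "prob_space \<Gamma>" unfolding \<Gamma>_def by (rule \<mu>.prob_space_distr) measurable
  moreover have "distr \<Gamma> borel fst = law (\<lambda>_. 0::real)"
    unfolding \<Gamma>_def by (subst distr_distr) (auto simp: comp_def P.emeasure_space_1 \<mu>.emeasure_space_1 emeasure_distr intro!: measure_eqI)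
  ultimately obtain Y where [measurable]: "Y \<in> borel_measurable cube"
    and Y: "distr cube (borel \<Otimes>\<^sub>M borel) (\<lambda>w. (0::real, Y w)) = \<Gamma>"
    using cube_realise_coupling[of "\<lambda>_. 0::real" \<Gamma>] by (auto simp: \<Gamma>_def)
  have "law Y = distr \<Gamma> borel snd"
    unfolding Y[symmetric] by (subst distr_distr) (auto simp: comp_def)
  also have "\<dots> = \<mu>" unfolding \<Gamma>_def by (subst distr_distr) (auto simp: comp_def \<mu> intro: distr_id2)
  finally show thesis by (intro that) auto
qed

section \<open>Powers as moduli of continuity\<close>

lemma conj_exponent_gt_1: "1 < p \<Longrightarrow> 1 < conj_exponent p"
  by (simp add: conj_exponent_def)

lemma mult_le_powr_conj:
  assumes "1 < p" "0 \<le> x" "0 \<le> y"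
  shows "x * y \<le> x powr conj_exponent p + y powr p"
proof -
  have "x * y \<le> x powr conj_exponent p / conj_exponent p + y powr p / p"
    using assms by (intro Youngs_inequality) (auto simp: conj_exponent_def field_simps)
  also have "\<dots> \<le> x powr conj_exponent p + y powr p"
    using assms mult_right_mono[of 1 p "y powr p"]
      mult_right_mono[of 1 "conj_exponent p" "x powr conj_exponent p"] conj_exponent_gt_1[of p]
    by (intro add_mono) (auto simp: field_simps)
  finally show ?thesis .
qed

lemma iterated_deriv_powr:
  fixes K \<alpha> :: real
  shows "\<exists>c. \<forall>r>0. (deriv ^^ k) (\<lambda>r. K * r powr \<alpha>) r = c * r powr (\<alpha> - real k)"
proof (induction k)
  case 0
  then show ?case by auto
next
  case (Suc k)
  then obtain c where c: "\<And>r. r > 0 \<Longrightarrow> (deriv ^^ k) (\<lambda>r. K * r powr \<alpha>) r = c * r powr (\<alpha> - real k)" by blast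
  have "(deriv ^^ Suc k) (\<lambda>r. K * r powr \<alpha>) r = (c * (\<alpha> - k)) * r powr (\<alpha> - real (Suc k))" if r: "r > 0" for r
  proof -
    have "\<forall>\<^sub>F x in nhds r. x \<in> {0<..}" using r by (intro eventually_nhds_in_open) auto
    then have "deriv ((deriv ^^ k) (\<lambda>r. K * r powr \<alpha>)) r = deriv (\<lambda>x. c * x powr (\<alpha> - real k)) r"
      by (intro deriv_cong_ev) (auto elim!: eventually_mono simp: c)
    also have "\<dots> = c * ((\<alpha> - real k) * r powr (\<alpha> - real k - 1))"
      by (intro DERIV_imp_deriv DERIV_cmult has_real_derivative_powr r)
    finally show ?thesis by (simp add: algebra_simps)
  qed
  then show ?case by blast
qed

text \<open>Concavity on the closed half-line follows from the tangent inequality at the positive point \<open>z\<close>, which is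
Young's inequality for the ratio \<open>w / z\<close>.\<close>

lemma modulus_of_continuity_powr:
  fixes K \<alpha> :: real
  assumes "0 \<le> K" "0 < \<alpha>" "\<alpha> \<le> 1"
  shows "modulus_of_continuity (\<lambda>r. K * r powr \<alpha>)"
  unfolding modulus_of_continuity_def
proof (intro conjI allI)
  show "continuous_on {0..} (\<lambda>r. K * r powr \<alpha>)"
    using assms by (intro continuous_intros continuous_on_powr') auto
  show "mono_on {0..} (\<lambda>r. K * r powr \<alpha>)"
    using assms by (intro mono_onI mult_left_mono powr_mono2) auto
  show "concave_on {0..} (\<lambda>r. K * r powr \<alpha>)"
  proof -
    have "convex_on {0..} (\<lambda>r. - (r powr \<alpha>))"
    proof (rule convex_on_linorderI)
      fix s x y :: real assume s: "0 < s" "s < 1" and x: "x \<in> {0..}" and y: "y \<in> {0..}" and xy: "x < y"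
      define z where "z = (1 - s) * x + s * y"
      have z: "0 < z" unfolding z_def using s x xy by (intro add_nonneg_pos) auto
      have tangent: "w powr \<alpha> \<le> z powr \<alpha> + \<alpha> * z powr (\<alpha> - 1) * (w - z)" if w: "0 \<le> w" for w
      proof -
        define q where "q = w / z"
        have q: "0 \<le> q" using w z by (simp add: q_def)
        have "q powr \<alpha> \<le> 1 + \<alpha> * (q - 1)"
        proof (cases "\<alpha> = 1")
          case False
          then have "q powr \<alpha> * 1 \<le> (q powr \<alpha>) powr (1 / \<alpha>) / (1 / \<alpha>) + 1 powr (1 / (1 - \<alpha>)) / (1 / (1 - \<alpha>))"
            using assms q by (intro Youngs_inequality) (auto simp: field_simps)
          then show ?thesis using assms q by (simp add: powr_powr algebra_simps)
        qed (use q in simp)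
        then have "z powr \<alpha> * q powr \<alpha> \<le> z powr \<alpha> * (1 + \<alpha> * (q - 1))" by (intro mult_left_mono) auto
        also have "z powr \<alpha> * q powr \<alpha> = w powr \<alpha>"
          using w z q by (simp flip: powr_mult) (simp add: q_def)
        also have "z powr \<alpha> * (1 + \<alpha> * (q - 1)) = z powr \<alpha> + \<alpha> * z powr (\<alpha> - 1) * (w - z)"
          using z by (simp add: powr_diff q_def field_simps)
        finally show ?thesis .
      qed
      have "(1 - s) * x powr \<alpha> + s * y powr \<alpha>
        \<le> (1 - s) * (z powr \<alpha> + \<alpha> * z powr (\<alpha> - 1) * (x - z)) + s * (z powr \<alpha> + \<alpha> * z powr (\<alpha> - 1) * (y - z))"
        using s x y tangent by (intro add_mono mult_left_mono) auto
      also have "\<dots> = z powr \<alpha> + \<alpha> * z powr (\<alpha> - 1) * ((1 - s) * (x - z) + s * (y - z))" by (simp add: algebra_simps)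
      also have "(1 - s) * (x - z) + s * (y - z) = 0" by (simp add: z_def algebra_simps)
      finally show "- (((1 - s) *\<^sub>R x + s *\<^sub>R y) powr \<alpha>) \<le> (1 - s) * - (x powr \<alpha>) + s * - (y powr \<alpha>)"
        by (simp add: z_def)
    qed auto
    then have "convex_on {0..} (\<lambda>r. K * - (r powr \<alpha>))"
      using assms by (intro convex_on_cmul) auto
    then show ?thesis by (simp add: concave_on_def)
  qed
  show "K * 0 powr \<alpha> = 0" by simp
  fix k
  obtain c where c: "\<And>r. r > 0 \<Longrightarrow> (deriv ^^ k) (\<lambda>r. K * r powr \<alpha>) r = c * r powr (\<alpha> - real k)"
    using iterated_deriv_powr[where K = K and \<alpha> = \<alpha>] by blast
  show "(deriv ^^ k) (\<lambda>r. K * r powr \<alpha>) differentiable_on {0<..}"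
    unfolding differentiable_on_def
  proof
    fix r :: real assume r: "r \<in> {0<..}"
    have "((\<lambda>r. c * r powr (\<alpha> - real k)) has_real_derivative c * ((\<alpha> - real k) * r powr (\<alpha> - real k - 1))) (at r)"
      using r by (intro DERIV_cmult has_real_derivative_powr) auto
    then have "(\<lambda>r. c * r powr (\<alpha> - real k)) differentiable (at r within {0<..})"
      by (meson differentiable_at_withinI real_differentiable_def)
    then show "(deriv ^^ k) (\<lambda>r. K * r powr \<alpha>) differentiable (at r within {0<..})"
      by (rule differentiable_transform_within[where d = 1]) (use r c in auto)
  qed
qed

section \<open>From touching random variables to superdifferentials\<close>

lemma emeasure_space_cube [simp]: "emeasure cube UNIV = 1"
  using prob_space.emeasure_space_1[OF prob_space_cube] by simp

lemma integrable_const_cube [simp]: "integrable cube (\<lambda>_. a :: 'b :: {banach, second_countable_topology})"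
  using prob_space.finite_measure[OF prob_space_cube] by (rule finite_measure.integrable_const)

lemma law_in_Pp:
  fixes X :: "(real \<Rightarrow> real) \<Rightarrow> 'a::euclidean_space"
  assumes X: "X \<in> Lp cube p"
  shows "law X \<in> Pp p"
proof -
  interpret prob_space cube by (rule prob_space_cube)
  have [measurable]: "X \<in> borel_measurable cube" using X by (simp add: Lp_def)
  show ?thesis using X unfolding Pp_def
    by (auto simp: Lp_def integrable_distr_eq intro!: prob_space_distr)
qed

lemma Lp_of_law:
  fixes X :: "(real \<Rightarrow> real) \<Rightarrow> 'a::euclidean_space"
  assumes X: "X \<in> borel_measurable cube" "law X \<in> Pp p"
  shows "X \<in> Lp cube p"
  using X by (auto simp: Lp_def Pp_def integrable_distr_eq)

lemma wasserstein_nonneg: "0 \<le> wasserstein p \<mu> \<nu>"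
  by (simp add: wasserstein_def)

lemma wasserstein_law_le:
  fixes X Y :: "(real \<Rightarrow> real) \<Rightarrow> 'a::euclidean_space"
  assumes p: "0 < p" and X: "X \<in> Lp cube p" and Y: "Y \<in> Lp cube p"
  shows "wasserstein p (law X) (law Y) \<le> pdist cube p X Y powr (1 / p)"
proof -
  interpret prob_space cube by (rule prob_space_cube)
  have [measurable]: "X \<in> borel_measurable cube" "Y \<in> borel_measurable cube" using X Y by (auto simp: Lp_def)
  define \<gamma> where "\<gamma> = distr cube (borel \<Otimes>\<^sub>M borel) (\<lambda>w. (X w, Y w))"
  have "\<gamma> \<in> couplings (law X) (law Y)"
    unfolding couplings_def \<gamma>_def
    by (auto simp: distr_distr comp_def intro!: prob_space_distr sets_pair_measure_cong)
       (auto simp: distr_distr comp_def cong: distr_cong)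
  moreover have "(\<integral>(x, y). norm (x - y) powr p \<partial>\<gamma>) = pdist cube p X Y"
    unfolding \<gamma>_def pdist_def split_beta' by (subst integral_distr) auto
  moreover have "bdd_below ((\<lambda>\<gamma>. \<integral>(x, y). norm (x - y) powr p \<partial>\<gamma>) ` couplings (law X) (law Y))"
    by (rule bdd_belowI[of _ 0]) (auto intro!: integral_nonneg_AE)
  ultimately have le: "(INF \<gamma>\<in>couplings (law X) (law Y). \<integral>(x, y). norm (x - y) powr p \<partial>\<gamma>)
      \<le> pdist cube p X Y"
    by (metis (no_types, lifting) cINF_lower)
  have "0 \<le> (INF \<gamma>\<in>couplings (law X) (law Y). \<integral>(x, y). norm (x - y) powr p \<partial>\<gamma>)"
    using \<open>\<gamma> \<in> _\<close> by (intro cINF_greatest) (auto intro!: integral_nonneg_AE)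
  then show ?thesis unfolding wasserstein_def using p le by (intro powr_mono2) auto
qed

lemma integrable_inner_conj:
  fixes Z h :: "'w \<Rightarrow> 'a::euclidean_space"
  assumes p: "1 < p" and Z: "Z \<in> borel_measurable M" "integrable M (\<lambda>w. norm (Z w) powr conj_exponent p)"
    and h: "h \<in> Lp M p"
  shows "integrable M (\<lambda>w. Z w \<bullet> h w)"
    and "0 < r \<Longrightarrow> (\<integral>w. norm (h w) powr p \<partial>M) \<le> r powr p \<Longrightarrow>
      - (r * ((\<integral>w. norm (Z w) powr conj_exponent p \<partial>M) + 1)) \<le> (\<integral>w. Z w \<bullet> h w \<partial>M)"
proof -
  have [measurable]: "Z \<in> borel_measurable M" "h \<in> borel_measurable M" using Z h by (auto simp: Lp_def)
  have hi: "integrable M (\<lambda>w. norm (h w) powr p)" using h by (simp add: Lp_def)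
  have le: "\<bar>Z w \<bullet> h w\<bar> \<le> r * (norm (Z w) powr conj_exponent p + norm (h w) powr p / r powr p)" if r: "0 < r" for r w
  proof -
    have "\<bar>Z w \<bullet> h w\<bar> \<le> norm (Z w) * norm (h w)" by (rule Cauchy_Schwarz_ineq2)
    also have "\<dots> = r * (norm (Z w) * (norm (h w) / r))" using r by simp
    also have "\<dots> \<le> r * (norm (Z w) powr conj_exponent p + (norm (h w) / r) powr p)"
      using r p by (intro mult_left_mono mult_le_powr_conj) auto
    finally show ?thesis using r by (simp add: powr_divide)
  qed
  have int: "integrable M (\<lambda>w. r * (norm (Z w) powr conj_exponent p + norm (h w) powr p / r powr p))" for r
    using Z hi by simp
  show 1: "integrable M (\<lambda>w. Z w \<bullet> h w)"
    by (rule Bochner_Integration.integrable_bound[OF int[of 1]]) (use le[of 1] in auto)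
  assume r: "0 < r" and hr: "(\<integral>w. norm (h w) powr p \<partial>M) \<le> r powr p"
  have "(\<integral>w. - (Z w \<bullet> h w) \<partial>M) \<le> (\<integral>w. r * (norm (Z w) powr conj_exponent p + norm (h w) powr p / r powr p) \<partial>M)"
  proof (intro integral_mono int)
    show "integrable M (\<lambda>w. - (Z w \<bullet> h w))" using 1 by simp
    show "- (Z w \<bullet> h w) \<le> r * (norm (Z w) powr conj_exponent p + norm (h w) powr p / r powr p)" for w
      using le[OF r, of w] by linarith
  qed
  also have "\<dots> = r * ((\<integral>w. norm (Z w) powr conj_exponent p \<partial>M) + (\<integral>w. norm (h w) powr p \<partial>M) / r powr p)"
    using Z hi by simp
  also have "\<dots> \<le> r * ((\<integral>w. norm (Z w) powr conj_exponent p \<partial>M) + 1)"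
    using r hr by (intro mult_left_mono add_left_mono) auto
  finally show "- (r * ((\<integral>w. norm (Z w) powr conj_exponent p \<partial>M) + 1)) \<le> (\<integral>w. Z w \<bullet> h w \<partial>M)" using 1 by simp
qed

lemma summable_weighted_bounded:
  fixes c x :: "nat \<Rightarrow> real"
  assumes c: "\<And>i. 0 \<le> c i" "summable c" and x: "\<And>i. \<bar>x i\<bar> \<le> T"
  shows "summable (\<lambda>i. c i * x i)" "summable (\<lambda>i. c i * (x i)\<^sup>2)"
proof -
  show "summable (\<lambda>i. c i * x i)"
    by (rule summable_comparison_test'[OF summable_mult2[OF c(2), of T], of 0])
       (use x c(1) in \<open>auto simp: abs_mult intro!: mult_left_mono\<close>)
  have x2: "(x i)\<^sup>2 \<le> T\<^sup>2" for i using power_mono[OF x[of i], of 2] by simp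
  show "summable (\<lambda>i. c i * (x i)\<^sup>2)"
    by (rule summable_comparison_test'[OF summable_mult2[OF c(2), of "T\<^sup>2"], of 0])
       (use x2 c(1) in \<open>auto simp: abs_mult intro!: mult_left_mono\<close>)
qed

text \<open>Suppose that \<open>U\<close>, read as a function of random variables, is touched from above at \<open>(t, X)\<close> by an
affine function of time plus a weighted sum of distance powers. Then the law of \<open>X\<close> paired with the
gradient \<open>Z\<close> of that sum is \<open>\<mu>(dx) \<psi>\<^sub>x(dz)\<close> for a kernel \<open>\<psi>\<close> in the superdifferential. Any
admissible \<open>\<Gamma>\<close> is the law of \<open>((X, Z), Y)\<close> for some \<open>Y\<close>, by \<open>cube_realise_coupling\<close>, so it is
enough to compare \<open>X\<close> with random variables \<open>Y\<close>. For \<open>Y\<close> close to \<open>X\<close> this is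
\<open>grad_series_expansion\<close>; for distant \<open>Y\<close> it holds because \<open>U\<close> is bounded and
the other terms grow at most linearly.\<close>

lemma superdiff_of_touching:
  fixes X :: "(real \<Rightarrow> real) \<Rightarrow> 'a::euclidean_space" and U :: "real \<Rightarrow> 'a measure \<Rightarrow> real"
  assumes p: "1 < p" and t: "t \<in> {0..T}" and X: "X \<in> Lp cube p"
    and W: "\<And>i. W i \<in> Lp cube p" and \<tau>: "\<And>i. \<tau> i \<in> {0..T}"
    and c: "\<And>i. 0 \<le> c i" "summable c" "summable (\<lambda>i. c i powr (1 / p))"
    and sd: "summable (\<lambda>i. c i * pdist cube p X (W i))"
    and bdd: "\<And>s \<mu>. s \<in> {0..T} \<Longrightarrow> \<mu> \<in> Pp p \<Longrightarrow> \<bar>U s \<mu>\<bar> \<le> B"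
    and touch: "\<And>s Y. s \<in> {0..T} \<Longrightarrow> Y \<in> Lp cube p \<Longrightarrow> summable (\<lambda>i. c i * pdist cube p Y (W i)) \<Longrightarrow>
      U s (law Y) - l * s - (\<Sum>i. c i * pdist cube p Y (W i)) - (\<Sum>i. c i * (s - \<tau> i)\<^sup>2)
      \<le> U t (law X) - l * t - (\<Sum>i. c i * pdist cube p X (W i)) - (\<Sum>i. c i * (t - \<tau> i)\<^sup>2)"
  obtains \<psi> where "(l + 2 * (\<Sum>i. c i * (t - \<tau> i)), \<psi>) \<in> superdiff p T U t (law X)"
    "kernel_joint (law X) \<psi>
      = distr cube (borel \<Otimes>\<^sub>M borel) (\<lambda>w. (X w, grad_series p c X W w))"
proof -
  interpret P: prob_space cube by (rule prob_space_cube)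
  define \<alpha> where "\<alpha> = min 1 (p - 1)"
  have al: "0 < \<alpha>" "\<alpha> \<le> 1" using p by (auto simp: \<alpha>_def)
  define Z where "Z = grad_series p c X W"
  define \<theta> where "\<theta> = l + 2 * (\<Sum>i. c i * (t - \<tau> i))"
  have Xm [measurable]: "X \<in> borel_measurable cube" using X by (simp add: Lp_def)
  have Zm [measurable]: "Z \<in> borel_measurable cube"
    unfolding Z_def using X W by (intro grad_series_measurable) (auto simp: Lp_def)
  have Zint: "integrable cube (\<lambda>w. norm (Z w) powr conj_exponent p)"
    unfolding Z_def by (rule grad_series_Lp(1)[OF p c(1) X W c(2,3) sd])
  have st: "summable (\<lambda>i. c i * (s - \<tau> i))" "summable (\<lambda>i. c i * (s - \<tau> i)\<^sup>2)" if s: "s \<in> {0..T}" for s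
  proof -
    have "\<bar>s - \<tau> i\<bar> \<le> T" for i using s \<tau>[of i] by auto
    then show "summable (\<lambda>i. c i * (s - \<tau> i))" "summable (\<lambda>i. c i * (s - \<tau> i)\<^sup>2)"
      by (rule summable_weighted_bounded[OF c(1,2)])+
  qed
  have time: "(\<Sum>i. c i * (s - \<tau> i)\<^sup>2)
      = (\<Sum>i. c i * (t - \<tau> i)\<^sup>2) + 2 * (\<Sum>i. c i * (t - \<tau> i)) * (s - t) + (\<Sum>i. c i) * (s - t)\<^sup>2" for s
  proof -
    have "(\<Sum>i. c i * (s - \<tau> i)\<^sup>2)
        = (\<Sum>i. c i * (t - \<tau> i)\<^sup>2 + 2 * (s - t) * (c i * (t - \<tau> i)) + (s - t)\<^sup>2 * c i)"
      by (intro suminf_cong) (simp add: power2_eq_square algebra_simps)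
    also have "\<dots> = (\<Sum>i. c i * (t - \<tau> i)\<^sup>2) + 2 * (s - t) * (\<Sum>i. c i * (t - \<tau> i)) + (s - t)\<^sup>2 * (\<Sum>i. c i)"
      using st[OF t] c(2) by (simp add: suminf_add[symmetric] suminf_mult summable_add summable_mult)
    finally show ?thesis by (simp add: algebra_simps)
  qed
  define K1 where "K1 = (\<Sum>i. c i * (p * (p + 2) * (1 + 2 powr p * (pdist cube p X (W i) + 1))))"
  have local: "U s (law Y) \<le> U t (law X) + \<theta> * (s - t)
      + (\<integral>w. Z w \<bullet> (Y w - X w) \<partial>cube) + (K1 + (\<Sum>i. c i)) * r powr (1 + \<alpha>)"
    if s: "s \<in> {0..T}" and Y: "Y \<in> Lp cube p" and r: "0 < r" "r \<le> 1" "\<bar>s - t\<bar> \<le> r" "pdist cube p Y X \<le> r powr p"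
    for s Y r
  proof -
    note ex = grad_series_expansion[OF p c(1) X W c(2,3) sd Y r(1,2,4)]
    have "(s - t)\<^sup>2 \<le> r\<^sup>2" using r by (simp add: abs_le_square_iff[symmetric])
    also have "\<dots> = r powr 2" using r by simp
    also have "\<dots> \<le> r powr (1 + \<alpha>)" using r al by (intro powr_mono') auto
    finally have "(\<Sum>i. c i) * (s - t)\<^sup>2 \<le> (\<Sum>i. c i) * r powr (1 + \<alpha>)"
      by (intro mult_left_mono suminf_nonneg c)
    moreover have "U s (law Y) - l * s - (\<Sum>i. c i * pdist cube p Y (W i)) - (\<Sum>i. c i * (s - \<tau> i)\<^sup>2)
      \<le> U t (law X) - l * t - (\<Sum>i. c i * pdist cube p X (W i)) - (\<Sum>i. c i * (t - \<tau> i)\<^sup>2)"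
      by (rule touch[OF s Y ex(1)])
    ultimately show ?thesis
      using ex(2) time[of s] unfolding Z_def[symmetric] K1_def[symmetric] \<alpha>_def[symmetric] \<theta>_def
      by (simp add: algebra_simps)
  qed
  define IZ where "IZ = (\<integral>w. norm (Z w) powr conj_exponent p \<partial>cube)"
  have IZ: "0 \<le> IZ" unfolding IZ_def by (intro integral_nonneg_AE) auto
  define K where "K = \<bar>K1 + (\<Sum>i. c i)\<bar> + (2 * \<bar>B\<bar> + \<bar>\<theta>\<bar> + IZ + 1)"
  have K: "K1 + (\<Sum>i. c i) \<le> K" "2 * \<bar>B\<bar> + \<bar>\<theta>\<bar> + IZ + 1 \<le> K" "0 \<le> K"
    using IZ by (auto simp: K_def)
  have global: "U s (law Y) \<le> U t (law X) + \<theta> * (s - t)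
      + (\<integral>w. Z w \<bullet> (Y w - X w) \<partial>cube) + K * (\<bar>s - t\<bar> + pdist cube p X Y powr (1 / p)) powr (1 + \<alpha>)"
    if s: "s \<in> {0..T}" and Y: "Y \<in> Lp cube p" for s Y
  proof -
    define d where "d = pdist cube p X Y powr (1 / p)"
    define r0 where "r0 = \<bar>s - t\<bar> + d"
    have d: "pdist cube p Y X = d powr p"
      using p by (simp add: d_def powr_powr pdist_commute[of cube p Y X] pdist_nonneg)
    have r0: "0 \<le> r0" "\<bar>s - t\<bar> \<le> r0" "d \<le> r0" by (auto simp: r0_def d_def)
    have dle: "pdist cube p Y X \<le> r powr p" if "r0 \<le> r" for r
      unfolding d using r0 that p by (intro powr_mono2) (auto simp: d_def)
    have h: "(\<lambda>w. Y w - X w) \<in> Lp cube p" using Y X p by (intro Lp_diff) auto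
    let ?R = "U t (law X) + \<theta> * (s - t) + (\<integral>w. Z w \<bullet> (Y w - X w) \<partial>cube)"
    consider "r0 = 0" | "0 < r0" "r0 \<le> 1" | "1 < r0" using r0 by linarith
    then have "U s (law Y) \<le> ?R + K * r0 powr (1 + \<alpha>)"
    proof cases
      \<comment> \<open>If \<open>Y = X\<close> almost surely and \<open>s = t\<close>, every positive scale is allowed; let it tend to 0.\<close>
      case 1
      have "U s (law Y) \<le> ?R + (K1 + (\<Sum>i. c i)) * r powr (1 + \<alpha>)" if "0 < r" "r \<le> 1" for r
        using local[OF s Y that] r0 dle[of r] 1 that by simp
      then have ev: "\<forall>\<^sub>F r in at_right 0. U s (law Y) \<le> ?R + (K1 + (\<Sum>i. c i)) * r powr (1 + \<alpha>)"
        by (intro eventually_at_rightI[of 0 1]) auto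
      have "((\<lambda>r::real. r powr (1 + \<alpha>)) \<longlongrightarrow> 0) (at_right 0)"
        using al by (intro tendsto_zero_powrI[where b = "1 + \<alpha>"] tendsto_ident_at tendsto_const)
          (auto intro!: eventually_at_rightI[of 0 1])
      then have "((\<lambda>r. ?R + (K1 + (\<Sum>i. c i)) * r powr (1 + \<alpha>)) \<longlongrightarrow> ?R + (K1 + (\<Sum>i. c i)) * 0) (at_right 0)"
        by (intro tendsto_intros)
      from tendsto_lowerbound[OF this ev] 1 show ?thesis by simp
    next
      case 2
      have "U s (law Y) \<le> ?R + (K1 + (\<Sum>i. c i)) * r0 powr (1 + \<alpha>)"
        using local[OF s Y 2] r0 dle[of r0] by simp
      also have "\<dots> \<le> ?R + K * r0 powr (1 + \<alpha>)" using K by (intro add_left_mono mult_right_mono) auto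
      finally show ?thesis .
    next
      case 3
      have "- (r0 * (IZ + 1)) \<le> (\<integral>w. Z w \<bullet> (Y w - X w) \<partial>cube)"
        unfolding IZ_def using 3 dle[of r0]
        by (intro integrable_inner_conj(2)[OF p Zm Zint h]) (auto simp: pdist_def)
      moreover have "- (r0 * \<bar>\<theta>\<bar>) \<le> \<theta> * (s - t)"
      proof -
        have "\<bar>\<theta> * (s - t)\<bar> \<le> \<bar>\<theta>\<bar> * r0" unfolding abs_mult using r0 by (intro mult_left_mono) auto
        then show ?thesis by (simp add: mult.commute)
      qed
      moreover have "U s (law Y) \<le> \<bar>B\<bar>" "- \<bar>B\<bar> \<le> U t (law X)"
        using bdd[OF s law_in_Pp[OF Y]] bdd[OF t law_in_Pp[OF X]] by linarith+
      moreover have "2 * \<bar>B\<bar> \<le> r0 * (2 * \<bar>B\<bar>)" using 3 by (simp add: mult_le_cancel_right1)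
      ultimately have "U s (law Y) \<le> ?R + (2 * \<bar>B\<bar> + \<bar>\<theta>\<bar> + IZ + 1) * r0"
        by (simp add: algebra_simps)
      also have "\<dots> \<le> ?R + K * r0 powr (1 + \<alpha>)"
      proof -
        have "r0 \<le> r0 powr (1 + \<alpha>)" using 3 al powr_mono[of 1 "1 + \<alpha>" r0] by simp
        then show ?thesis using K IZ r0 by (intro add_left_mono mult_mono) auto
      qed
      finally show ?thesis .
    qed
    then show ?thesis by (simp add: r0_def d_def)
  qed
  define XZ where "XZ w = (X w, Z w)" for w
  have XZm [measurable]: "XZ \<in> borel_measurable cube"
    unfolding XZ_def borel_prod[symmetric] by measurable
  define L where "L = distr cube (borel \<Otimes>\<^sub>M borel) XZ"
  have XZm' [measurable]: "XZ \<in> cube \<rightarrow>\<^sub>M borel \<Otimes>\<^sub>M borel" unfolding borel_prod by (rule XZm)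
  have L: "prob_space L" "sets L = sets (borel \<Otimes>\<^sub>M borel)"
    unfolding L_def by (auto intro!: P.prob_space_distr)
  obtain \<psi> where \<psi>: "\<psi> \<in> kernels" "kernel_joint (distr L borel fst) \<psi> = L"
    by (rule kernel_exists[OF L])
  have Lfst: "distr L borel fst = law X"
    unfolding L_def by (subst distr_distr) (auto simp: comp_def XZ_def)
  have kj: "kernel_joint (law X) \<psi> = L" using \<psi> Lfst by simp
  have int: "integrable L (\<lambda>(x, z). norm z powr conj_exponent p)"
    unfolding L_def split_beta' by (subst integrable_distr_eq) (auto simp: XZ_def Zint)
  have modulus: "modulus_of_continuity (\<lambda>r. K * r powr \<alpha>)"
    by (rule modulus_of_continuity_powr[OF K(3) al])
  have "\<forall>s\<in>{0..T}. \<forall>\<mu>'\<in>Pp p. \<forall>\<Gamma>\<in>couplings L \<mu>'.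
      U s \<mu>' \<le> U t (law X) + \<theta> * (s - t) + (\<integral>((x, z), y). z \<bullet> (y - x) \<partial>\<Gamma>)
        + (\<bar>s - t\<bar> + Ctilde p \<Gamma>) * (K * (\<bar>s - t\<bar> + Ctilde p \<Gamma>) powr \<alpha>)"
  proof (intro ballI)
    fix s :: real and \<mu>' :: "'a measure" and \<Gamma>
    assume s: "s \<in> {0..T}" and \<mu>': "\<mu>' \<in> Pp p" and \<Gamma>: "\<Gamma> \<in> couplings L \<mu>'"
    have smu: "sets \<mu>' = sets borel" using \<mu>' by (simp add: Pp_def)
    have sG: "sets \<Gamma> = sets ((borel \<Otimes>\<^sub>M borel) \<Otimes>\<^sub>M borel)"
      using \<Gamma> L(2) smu by (auto simp: couplings_def cong: sets_pair_measure_cong)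
    have G: "prob_space \<Gamma>" "sets \<Gamma> = sets (borel \<Otimes>\<^sub>M borel)"
      using \<Gamma> sG by (simp add: couplings_def, simp only: borel_prod)
    have "distr \<Gamma> borel fst = distr \<Gamma> L fst"
      by (rule distr_cong) (simp_all only: L(2) borel_prod)
    also have "\<dots> = L" using \<Gamma> by (simp add: couplings_def)
    also have "\<dots> = law XZ" unfolding L_def borel_prod ..
    finally obtain Y where Ym [measurable]: "Y \<in> borel_measurable cube"
      and Y: "distr cube (borel \<Otimes>\<^sub>M borel) (\<lambda>w. (XZ w, Y w)) = \<Gamma>"
      by (rule cube_realise_coupling[OF XZm G])
    have "law Y = distr \<Gamma> borel snd"
      unfolding Y[symmetric] by (subst distr_distr) (auto simp: comp_def)
    also have "\<dots> = distr \<Gamma> \<mu>' snd" by (rule distr_cong) (auto simp: smu)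
    also have "\<dots> = \<mu>'" using \<Gamma> by (simp add: couplings_def)
    finally have lawY: "law Y = \<mu>'" .
    then have YL: "Y \<in> Lp cube p" using Lp_of_law[OF Ym] \<mu>' by simp
    have map [measurable]: "(\<lambda>w. (XZ w, Y w)) \<in> cube \<rightarrow>\<^sub>M (borel \<Otimes>\<^sub>M borel) \<Otimes>\<^sub>M borel" by measurable
    have \<Gamma>eq: "\<Gamma> = distr cube ((borel \<Otimes>\<^sub>M borel) \<Otimes>\<^sub>M borel) (\<lambda>w. (XZ w, Y w))"
      using Y by (simp add: borel_prod)
    have C: "Ctilde p \<Gamma> = pdist cube p X Y powr (1 / p)"
      unfolding Ctilde_def \<Gamma>eq split_beta' pdist_def by (subst integral_distr[OF map]) (auto simp: XZ_def)
    have I: "(\<integral>((x, z), y). z \<bullet> (y - x) \<partial>\<Gamma>) = (\<integral>w. Z w \<bullet> (Y w - X w) \<partial>cube)"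
      unfolding \<Gamma>eq split_beta' by (subst integral_distr[OF map]) (auto simp: XZ_def)
    define r where "r = \<bar>s - t\<bar> + pdist cube p X Y powr (1 / p)"
    have eq: "r * (K * r powr \<alpha>) = K * r powr (1 + \<alpha>)" by (simp add: r_def powr_add)
    show "U s \<mu>' \<le> U t (law X) + \<theta> * (s - t) + (\<integral>((x, z), y). z \<bullet> (y - x) \<partial>\<Gamma>)
        + (\<bar>s - t\<bar> + Ctilde p \<Gamma>) * (K * (\<bar>s - t\<bar> + Ctilde p \<Gamma>) powr \<alpha>)"
      using global[OF s YL] unfolding C I lawY r_def[symmetric] eq .
  qed
  with \<psi>(1) int modulus have "(\<theta>, \<psi>) \<in> superdiff p T U t (law X)"
    unfolding superdiff_def mem_Collect_eq case_prod_conv kj by blast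
  then show thesis using kj by (intro that) (auto simp: \<theta>_def L_def XZ_def[abs_def] Z_def)
qed

section \<open>Doubling of variables\<close>

lemma pdist_tendsto2:
  fixes X Y :: "nat \<Rightarrow> 'w \<Rightarrow> 'a::euclidean_space"
  assumes p: "1 < p" and X: "\<And>n. X n \<in> Lp M p" "X' \<in> Lp M p" and Y: "\<And>n. Y n \<in> Lp M p" "Y' \<in> Lp M p"
    and lim: "(\<lambda>n. pdist M p (X n) X') \<longlonglongrightarrow> 0" "(\<lambda>n. pdist M p (Y n) Y') \<longlonglongrightarrow> 0"
  shows "(\<lambda>n. pdist M p (X n) (Y n)) \<longlonglongrightarrow> pdist M p X' Y'"
proof -
  define D where "D n w = X n w - Y n w" for n w
  define D' where "D' w = X' w - Y' w" for w
  have D: "D n \<in> Lp M p" "D' \<in> Lp M p" "(\<lambda>_. 0 :: 'a) \<in> Lp M p" for n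
    unfolding D_def D'_def using X Y p Lp_diff[OF X(2) X(2)] by (auto intro!: Lp_diff)
  have bound: "pdist M p (D n) D' \<le> 2 powr p * (pdist M p (X n) X' + pdist M p (Y n) Y')" for n
  proof -
    have "norm (D n w - D' w) powr p \<le> 2 powr p * (norm (X n w - X' w) powr p + norm (Y n w - Y' w) powr p)" for w
    proof -
      have "norm (D n w - D' w) \<le> norm (X n w - X' w) + norm (Y n w - Y' w)"
        using norm_triangle_ineq4[of "X n w - X' w" "Y n w - Y' w"] by (simp add: D_def D'_def algebra_simps)
      then have "norm (D n w - D' w) powr p \<le> (norm (X n w - X' w) + norm (Y n w - Y' w)) powr p"
        using p by (intro powr_mono2) auto
      also have "\<dots> \<le> 2 powr p * (norm (X n w - X' w) powr p + norm (Y n w - Y' w) powr p)"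
        using p by (intro powr_add_le) auto
      finally show ?thesis .
    qed
    then have "pdist M p (D n) D' \<le> (\<integral>w. 2 powr p * (norm (X n w - X' w) powr p + norm (Y n w - Y' w) powr p) \<partial>M)"
      unfolding pdist_def using p X Y D
      by (intro integral_mono integrable_mult_right Bochner_Integration.integrable_add Lp_integrable_diff) auto
    also have "\<dots> = 2 powr p * (pdist M p (X n) X' + pdist M p (Y n) Y')"
      unfolding pdist_def using p X Y by (simp add: Lp_integrable_diff)
    finally show ?thesis .
  qed
  have "(\<lambda>n. 2 powr p * (pdist M p (X n) X' + pdist M p (Y n) Y')) \<longlonglongrightarrow> 2 powr p * (0 + 0)"
    by (intro tendsto_intros lim)
  then have lim0: "(\<lambda>n. 2 powr p * (pdist M p (X n) X' + pdist M p (Y n) Y')) \<longlonglongrightarrow> 0" by simp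
  have "(\<lambda>n. pdist M p (D n) D') \<longlonglongrightarrow> 0"
    by (rule Lim_null_comparison[OF _ lim0]) (use bound in \<open>simp add: abs_of_nonneg[OF pdist_nonneg]\<close>)
  from pdist_tendsto[OF p D this] show ?thesis by (simp add: D_def[abs_def] D'_def[abs_def] pdist_def)
qed

text \<open>\<open>wasserstein_law_le\<close> turns continuity in the Wasserstein distance into continuity in \<open>L\<^sup>p\<close>.\<close>

lemma uniformly_continuous_law:
  fixes U :: "real \<Rightarrow> 'a::euclidean_space measure \<Rightarrow> real"
  assumes "1 < p" "uniformly_continuous_on_Pp p T U" "0 < e"
  obtains \<delta> where "0 < \<delta>" "\<And>t s X Y. t \<in> {0..T} \<Longrightarrow> s \<in> {0..T} \<Longrightarrow> X \<in> Lp cube p \<Longrightarrow> Y \<in> Lp cube p \<Longrightarrow>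
     \<bar>t - s\<bar> < \<delta> \<Longrightarrow> pdist cube p X Y < \<delta> \<Longrightarrow> \<bar>U t (law X) - U s (law Y)\<bar> < e"
proof -
  obtain d where d: "0 < d" and uc: "\<And>t \<mu> t' \<mu>'. t \<in> {0..T} \<Longrightarrow> \<mu> \<in> Pp p \<Longrightarrow> t' \<in> {0..T} \<Longrightarrow> \<mu>' \<in> Pp p \<Longrightarrow>
      \<bar>t' - t\<bar> + wasserstein p \<mu> \<mu>' < d \<Longrightarrow> \<bar>U t' \<mu>' - U t \<mu>\<bar> < e"
    using assms unfolding uniformly_continuous_on_Pp_def by metis
  show thesis
  proof (rule that[of "min (d / 2) ((d / 2) powr p)"])
    show "0 < min (d / 2) ((d / 2) powr p)" using d by simp
    fix t s :: real and X Y :: "(real \<Rightarrow> real) \<Rightarrow> 'a"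
    assume *: "t \<in> {0..T}" "s \<in> {0..T}" "X \<in> Lp cube p" "Y \<in> Lp cube p"
      "\<bar>t - s\<bar> < min (d / 2) ((d / 2) powr p)" "pdist cube p X Y < min (d / 2) ((d / 2) powr p)"
    have "wasserstein p (law Y) (law X) \<le> pdist cube p Y X powr (1 / p)"
      using assms * by (intro wasserstein_law_le) auto
    also have "\<dots> \<le> ((d / 2) powr p) powr (1 / p)"
      using assms * by (intro powr_mono2) (auto simp: pdist_nonneg pdist_commute[of cube p Y X])
    also have "\<dots> = d / 2" using assms d by (simp add: powr_powr)
    finally have "\<bar>t - s\<bar> + wasserstein p (law Y) (law X) < d" using * by linarith
    from uc[OF *(2) law_in_Pp[OF *(4)] *(1) law_in_Pp[OF *(3)] this]
    show "\<bar>U t (law X) - U s (law Y)\<bar> < e" .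
  qed
qed

lemma uniformly_continuous_law_tendsto:
  fixes U :: "real \<Rightarrow> 'a::euclidean_space measure \<Rightarrow> real"
  assumes p: "1 < p" and U: "uniformly_continuous_on_Pp p T U"
    and t: "\<And>n. t n \<in> {0..T}" "t' \<in> {0..T}" and X: "\<And>n. X n \<in> Lp cube p" "X' \<in> Lp cube p"
    and lim: "t \<longlonglongrightarrow> t'" "(\<lambda>n. pdist cube p (X n) X') \<longlonglongrightarrow> 0"
  shows "(\<lambda>n. U (t n) (law (X n))) \<longlonglongrightarrow> U t' (law X')"
proof (rule LIMSEQ_I)
  fix e :: real assume "0 < e"
  then obtain \<delta> where \<delta>: "0 < \<delta>" "\<And>t s X Y. t \<in> {0..T} \<Longrightarrow> s \<in> {0..T} \<Longrightarrow> X \<in> Lp cube p \<Longrightarrow> Y \<in> Lp cube p \<Longrightarrow>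
     \<bar>t - s\<bar> < \<delta> \<Longrightarrow> pdist cube p X Y < \<delta> \<Longrightarrow> \<bar>U t (law X) - U s (law Y)\<bar> < e"
    by (rule uniformly_continuous_law[OF p U]) blast
  obtain N1 where N1: "\<And>n. n \<ge> N1 \<Longrightarrow> \<bar>t n - t'\<bar> < \<delta>" using LIMSEQ_D[OF lim(1) \<delta>(1)] by auto
  obtain N2 where N2: "\<And>n. n \<ge> N2 \<Longrightarrow> pdist cube p (X n) X' < \<delta>"
    using LIMSEQ_D[OF lim(2) \<delta>(1)] by (auto simp: abs_of_nonneg[OF pdist_nonneg])
  show "\<exists>no. \<forall>n\<ge>no. norm (U (t n) (law (X n)) - U t' (law X')) < e"
    using N1 N2 \<delta>(2) t X by (intro exI[of _ "max N1 N2"]) auto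
qed

lemma Cauchy_of_geometric_squares:
  fixes t :: "nat \<Rightarrow> real"
  assumes "\<And>n. (t (Suc n) - t n)\<^sup>2 \<le> (1/4) ^ n"
  shows "convergent t"
proof -
  have "\<bar>t (Suc n) - t n\<bar> \<le> (1/2) ^ n" for n
  proof -
    have "(t (Suc n) - t n)\<^sup>2 \<le> ((1/2) ^ n)\<^sup>2"
      using assms[of n] by (simp add: power2_eq_square flip: power_mult_distrib)
    then show ?thesis by (simp add: abs_le_square_iff[symmetric])
  qed
  then have "\<exists>N. \<forall>n\<ge>N. norm (t (Suc n) - t n) \<le> (1/2) ^ n" by auto
  then have "summable (\<lambda>n. t (Suc n) - t n)"
    by (rule summable_comparison_test) (rule summable_geometric, simp)
  then have "convergent (\<lambda>n. (\<Sum>i<n. t (Suc i) - t i) + t 0)"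
    by (intro convergent_add convergent_const) (simp add: summable_iff_convergent)
  then show ?thesis by (simp add: sum_lessThan_telescope)
qed

text \<open>The penalty uses the distance between the random variables, not between their laws. It dominates
the Wasserstein distance and depends smoothly on each variable, whatever the coupling of \<open>X\<close> and \<open>Y\<close> is.\<close>

definition doubled_gap where
  "doubled_gap p U V \<epsilon> l t X s Y = U t (law X) - V s (law Y)
     - (pdist cube p X Y + (t - s)\<^sup>2) / \<epsilon> - l * t"

definition doubled_gauge where
  "doubled_gauge p t X s Y t' X' s' Y'
     = (pdist cube p X X' + (t - t')\<^sup>2) + (pdist cube p Y Y' + (s - s')\<^sup>2)"

lemma doubling_maximum:
  fixes U V :: "real \<Rightarrow> 'a::euclidean_space measure \<Rightarrow> real"
  assumes p: "1 < p" and T: "0 < T" and e: "0 < \<epsilon>" and \<eta>: "0 < \<eta>" and l: "0 \<le> l"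
    and U: "uniformly_continuous_on_Pp p T U" and V: "uniformly_continuous_on_Pp p T V"
    and UB: "\<And>s \<mu>. s \<in> {0..T} \<Longrightarrow> \<mu> \<in> Pp p \<Longrightarrow> \<bar>U s \<mu>\<bar> \<le> B"
    and VB: "\<And>s \<mu>. s \<in> {0..T} \<Longrightarrow> \<mu> \<in> Pp p \<Longrightarrow> \<bar>V s \<mu>\<bar> \<le> B"
  obtains t X s Y \<tau> A \<sigma> D where
    "t \<in> {0..T}" "X \<in> Lp cube p" "s \<in> {0..T}" "Y \<in> Lp cube p"
    "\<And>i. \<tau> i \<in> {0..T}" "\<And>i. A i \<in> Lp cube p" "\<And>i. \<sigma> i \<in> {0..T}" "\<And>i. D i \<in> Lp cube p"
    "summable (\<lambda>i. (1/2) ^ i * doubled_gauge p t X s Y (\<tau> i) (A i) (\<sigma> i) (D i))"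
    "(\<Sum>i. (1/2) ^ i * doubled_gauge p t X s Y (\<tau> i) (A i) (\<sigma> i) (D i)) \<le> \<eta>"
    "\<And>t' X' s' Y'. t' \<in> {0..T} \<Longrightarrow> X' \<in> Lp cube p \<Longrightarrow> s' \<in> {0..T} \<Longrightarrow> Y' \<in> Lp cube p \<Longrightarrow>
       doubled_gap p U V \<epsilon> l t' X' s' Y' - \<eta> \<le> doubled_gap p U V \<epsilon> l t X s Y"
    "\<And>t' X' s' Y'. t' \<in> {0..T} \<Longrightarrow> X' \<in> Lp cube p \<Longrightarrow> s' \<in> {0..T} \<Longrightarrow> Y' \<in> Lp cube p \<Longrightarrow>
       summable (\<lambda>i. (1/2) ^ i * doubled_gauge p t' X' s' Y' (\<tau> i) (A i) (\<sigma> i) (D i)) \<Longrightarrow>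
       doubled_gap p U V \<epsilon> l t' X' s' Y' - (\<Sum>i. (1/2) ^ i * doubled_gauge p t' X' s' Y' (\<tau> i) (A i) (\<sigma> i) (D i))
       \<le> doubled_gap p U V \<epsilon> l t X s Y - (\<Sum>i. (1/2) ^ i * doubled_gauge p t X s Y (\<tau> i) (A i) (\<sigma> i) (D i))"
proof -
  define S :: "((real \<times> ((real \<Rightarrow> real) \<Rightarrow> 'a)) \<times> (real \<times> ((real \<Rightarrow> real) \<Rightarrow> 'a))) set"
    where "S = ({0..T} \<times> Lp cube p) \<times> ({0..T} \<times> Lp cube p)"
  define f where "f x = doubled_gap p U V \<epsilon> l (fst (fst x)) (snd (fst x)) (fst (snd x)) (snd (snd x))"
    for x :: "(real \<times> ((real \<Rightarrow> real) \<Rightarrow> 'a)) \<times> (real \<times> ((real \<Rightarrow> real) \<Rightarrow> 'a))"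
  define R where "R x y = doubled_gauge p (fst (fst x)) (snd (fst x)) (fst (snd x)) (snd (snd x))
      (fst (fst y)) (snd (fst y)) (fst (snd y)) (snd (snd y))"
    for x y :: "(real \<times> ((real \<Rightarrow> real) \<Rightarrow> 'a)) \<times> (real \<times> ((real \<Rightarrow> real) \<Rightarrow> 'a))"
  define c :: "nat \<Rightarrow> real" where "c n = (4 powr - p) ^ n" for n
  have c: "0 < c n" "c n \<le> (1/4) ^ n" for n
  proof -
    show "0 < c n" by (simp add: c_def)
    have "(4::real) powr - p \<le> 4 powr - 1" using p by (intro powr_mono) auto
    then show "c n \<le> (1/4) ^ n" unfolding c_def by (intro power_mono) (auto simp: powr_minus)
  qed
  have c1: "c n \<le> 1" for n by (rule order_trans[OF c(2)]) (simp add: power_le_one)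
  have "(0, (\<lambda>_. 0)) \<in> {0..T} \<times> (Lp cube p :: ((real \<Rightarrow> real) \<Rightarrow> 'a) set)" using T by (simp add: Lp_def)
  then have ne: "S \<noteq> {}" unfolding S_def by blast
  have fB: "f x \<le> 2 * B" if "x \<in> S" for x
  proof -
    have "\<bar>U (fst (fst x)) (law (snd (fst x)))\<bar> \<le> B" "\<bar>V (fst (snd x)) (law (snd (snd x)))\<bar> \<le> B"
      using that by (auto simp: S_def intro!: UB VB law_in_Pp)
    moreover have "0 \<le> (pdist cube p (snd (fst x)) (snd (snd x)) + (fst (fst x) - fst (snd x))\<^sup>2) / \<epsilon>"
      using e by (simp add: pdist_nonneg)
    moreover have "0 \<le> l * fst (fst x)" using that l by (auto simp: S_def)
    ultimately show ?thesis unfolding f_def doubled_gap_def by linarith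
  qed
  have compl: "\<exists>y\<in>S. (\<lambda>n. f (x n)) \<longlonglongrightarrow> f y \<and> (\<forall>z\<in>S. (\<lambda>n. R (x n) z) \<longlonglongrightarrow> R y z)"
    if x: "\<And>n. x n \<in> S" and near: "\<And>n. R (x (Suc n)) (x n) \<le> c n" for x
  proof -
    define t X s Y where "t n = fst (fst (x n))" and "X n = snd (fst (x n))"
      and "s n = fst (snd (x n))" and "Y n = snd (snd (x n))" for n
    have mem: "t n \<in> {0..T}" "X n \<in> Lp cube p" "s n \<in> {0..T}" "Y n \<in> Lp cube p" for n
      using x[of n] by (auto simp: S_def t_def X_def s_def Y_def)
    have le: "(pdist cube p (X (Suc n)) (X n) + (t (Suc n) - t n)\<^sup>2)
        + (pdist cube p (Y (Suc n)) (Y n) + (s (Suc n) - s n)\<^sup>2) \<le> c n" for n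
      using near[of n] by (simp add: R_def doubled_gauge_def t_def X_def s_def Y_def)
    have nn: "0 \<le> pdist cube p (X (Suc n)) (X n)" "0 \<le> pdist cube p (Y (Suc n)) (Y n)"
      "0 \<le> (t (Suc n) - t n)\<^sup>2" "0 \<le> (s (Suc n) - s n)\<^sup>2" for n by (auto simp: pdist_nonneg)
    have "pdist cube p (X (Suc n)) (X n) \<le> (4 powr - p) ^ n" for n using le[of n] nn[of n] unfolding c_def by linarith
    from Lp_complete[OF p mem(2) this] obtain X' where X': "X' \<in> Lp cube p" "(\<lambda>n. pdist cube p (X n) X') \<longlonglongrightarrow> 0" by blast
    have "pdist cube p (Y (Suc n)) (Y n) \<le> (4 powr - p) ^ n" for n using le[of n] nn[of n] unfolding c_def by linarith
    from Lp_complete[OF p mem(4) this] obtain Y' where Y': "Y' \<in> Lp cube p" "(\<lambda>n. pdist cube p (Y n) Y') \<longlonglongrightarrow> 0" by blast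
    have "(t (Suc n) - t n)\<^sup>2 \<le> (1/4) ^ n" for n using le[of n] nn[of n] c(2)[of n] by linarith
    then obtain t' where t': "t \<longlonglongrightarrow> t'" using Cauchy_of_geometric_squares by (auto simp: convergent_def)
    have t'T: "t' \<in> {0..T}" using closed_sequentially[OF closed_atLeastAtMost mem(1) t'] .
    have "(s (Suc n) - s n)\<^sup>2 \<le> (1/4) ^ n" for n using le[of n] nn[of n] c(2)[of n] by linarith
    then obtain s' where s': "s \<longlonglongrightarrow> s'" using Cauchy_of_geometric_squares by (auto simp: convergent_def)
    have s'T: "s' \<in> {0..T}" using closed_sequentially[OF closed_atLeastAtMost mem(3) s'] .
    have "((t', X'), (s', Y')) \<in> S" using t'T s'T X' Y' by (simp add: S_def)
    moreover have "(\<lambda>n. f (x n)) \<longlonglongrightarrow> f ((t', X'), (s', Y'))"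
      unfolding f_def doubled_gap_def t_def[symmetric] X_def[symmetric] s_def[symmetric] Y_def[symmetric] fst_conv snd_conv
      using e
      by (intro tendsto_intros t' s' pdist_tendsto2 p mem X' Y'
          uniformly_continuous_law_tendsto[OF p U] uniformly_continuous_law_tendsto[OF p V] t'T s'T) auto
    moreover have "(\<lambda>n. R (x n) z) \<longlonglongrightarrow> R ((t', X'), (s', Y')) z" if "z \<in> S" for z
      unfolding R_def doubled_gauge_def t_def[symmetric] X_def[symmetric] s_def[symmetric] Y_def[symmetric] fst_conv snd_conv
      using that by (intro tendsto_intros t' s' pdist_tendsto p mem X' Y') (auto simp: S_def)
    ultimately show ?thesis by blast
  qed
  have R: "R x x = 0" "0 \<le> R x y" for x y by (simp_all add: R_def doubled_gauge_def pdist_nonneg)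
  have dc: "(\<lambda>n. (1/2) ^ n * c n) \<longlonglongrightarrow> 0"
  proof (rule Lim_null_comparison[OF always_eventually])
    show "\<forall>n. norm ((1/2) ^ n * c n) \<le> (1/2) ^ n"
      using c1 less_imp_le[OF c(1)] by (auto simp: abs_mult mult_left_le)
    show "(\<lambda>n. (1/2::real) ^ n) \<longlonglongrightarrow> 0" by (rule LIMSEQ_realpow_zero) auto
  qed
  have half: "0 < (1/2 :: real) ^ n" for n by simp
  obtain x y where xy: "\<And>n. x n \<in> S" "y \<in> S"
    "summable (\<lambda>i. (1/2) ^ i * R y (x i))" "(\<Sum>i. (1/2) ^ i * R y (x i)) \<le> \<eta>"
    "\<And>z. z \<in> S \<Longrightarrow> f z - \<eta> \<le> f y"
    "\<And>z. z \<in> S \<Longrightarrow> summable (\<lambda>i. (1/2) ^ i * R z (x i)) \<Longrightarrow>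
       f z - (\<Sum>i. (1/2) ^ i * R z (x i)) \<le> f y - (\<Sum>i. (1/2) ^ i * R y (x i))"
    by (rule smooth_variational_principle[OF R ne fB half c(1) dc compl \<eta>]) blast+
  show thesis
  proof (rule that[of "fst (fst y)" "snd (fst y)" "fst (snd y)" "snd (snd y)"
        "\<lambda>i. fst (fst (x i))" "\<lambda>i. snd (fst (x i))" "\<lambda>i. fst (snd (x i))" "\<lambda>i. snd (snd (x i))"])
    have xi: "x i \<in> ({0..T} \<times> Lp cube p) \<times> ({0..T} \<times> Lp cube p)" for i using xy(1) by (simp add: S_def)
    show "fst (fst (x i)) \<in> {0..T}" "snd (fst (x i)) \<in> Lp cube p" "fst (snd (x i)) \<in> {0..T}" "snd (snd (x i)) \<in> Lp cube p"
      for i using xi[of i] by (auto simp: mem_Times_iff)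
    show "fst (fst y) \<in> {0..T}" "snd (fst y) \<in> Lp cube p" "fst (snd y) \<in> {0..T}" "snd (snd y) \<in> Lp cube p"
      using xy(2) by (auto simp: mem_Times_iff S_def)
    fix t' s' :: real and X' Y' :: "(real \<Rightarrow> real) \<Rightarrow> 'a"
    assume *: "t' \<in> {0..T}" "X' \<in> Lp cube p" "s' \<in> {0..T}" "Y' \<in> Lp cube p"
    have z: "((t', X'), (s', Y')) \<in> S" using * by (simp add: S_def)
    show "doubled_gap p U V \<epsilon> l t' X' s' Y' - \<eta> \<le> doubled_gap p U V \<epsilon> l (fst (fst y)) (snd (fst y)) (fst (snd y)) (snd (snd y))"
      using xy(5)[OF z] by (simp add: f_def)
    show "doubled_gap p U V \<epsilon> l t' X' s' Y' - (\<Sum>i. (1/2) ^ i * doubled_gauge p t' X' s' Y' (fst (fst (x i))) (snd (fst (x i))) (fst (snd (x i))) (snd (snd (x i))))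
       \<le> doubled_gap p U V \<epsilon> l (fst (fst y)) (snd (fst y)) (fst (snd y)) (snd (snd y)) - (\<Sum>i. (1/2) ^ i * doubled_gauge p (fst (fst y)) (snd (fst y)) (fst (snd y)) (snd (snd y)) (fst (fst (x i))) (snd (fst (x i))) (fst (snd (x i))) (snd (snd (x i))))"
      if "summable (\<lambda>i. (1/2) ^ i * doubled_gauge p t' X' s' Y' (fst (fst (x i))) (snd (fst (x i))) (fst (snd (x i))) (snd (snd (x i))))"
      using xy(6)[OF z] that by (simp add: f_def R_def)
  qed (use xy(3,4) in \<open>simp_all add: R_def\<close>)
qed

lemma summable_half_powr: "0 < p \<Longrightarrow> summable (\<lambda>i. ((1/2 :: real) ^ i) powr (1 / p))"
proof -
  assume p: "0 < p"
  have "((1/2 :: real) ^ i) powr (1 / p) = ((1/2) powr (1 / p)) ^ i" for i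
    by (simp add: powr_power flip: powr_realpow) (simp add: powr_powr mult.commute flip: powr_realpow)
  moreover have "(1/2 :: real) powr (1 / p) < 1 powr (1 / p)" using p by (intro powr_less_mono2) auto
  ultimately show ?thesis by (simp add: summable_geometric)
qed

text \<open>At a maximum of the perturbed doubled function one freezes one pair of variables. In the other pair the penalty
with weight \<open>k\<close> and the perturbation with weights \<open>(1/2) ^ i\<close> form one weighted family, the penalty
being its member number 0, to which \<open>superdiff_of_touching\<close> applies. The gradient splits
accordingly.\<close>

lemma superdiff_of_doubling:
  fixes X :: "(real \<Rightarrow> real) \<Rightarrow> 'a::euclidean_space" and F :: "real \<Rightarrow> 'a measure \<Rightarrow> real"
  assumes p: "1 < p" and t: "t \<in> {0..T}" and X: "X \<in> Lp cube p" and s: "s \<in> {0..T}" and Y: "Y \<in> Lp cube p"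
    and A: "\<And>i. A i \<in> Lp cube p" and \<tau>: "\<And>i. \<tau> i \<in> {0..T}" and k: "0 \<le> k"
    and sd: "summable (\<lambda>i. (1/2) ^ i * pdist cube p X (A i))"
    and bdd: "\<And>s \<mu>. s \<in> {0..T} \<Longrightarrow> \<mu> \<in> Pp p \<Longrightarrow> \<bar>F s \<mu>\<bar> \<le> B"
    and touch: "\<And>t' X'. t' \<in> {0..T} \<Longrightarrow> X' \<in> Lp cube p \<Longrightarrow> summable (\<lambda>i. (1/2) ^ i * pdist cube p X' (A i)) \<Longrightarrow>
      F t' (law X') - l * t' - k * (pdist cube p X' Y + (t' - s)\<^sup>2)
        - (\<Sum>i. (1/2) ^ i * (pdist cube p X' (A i) + (t' - \<tau> i)\<^sup>2))
      \<le> F t (law X) - l * t - k * (pdist cube p X Y + (t - s)\<^sup>2)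
        - (\<Sum>i. (1/2) ^ i * (pdist cube p X (A i) + (t - \<tau> i)\<^sup>2))"
  obtains \<psi> where
    "(l + 2 * k * (t - s) + 2 * (\<Sum>i. (1/2) ^ i * (t - \<tau> i)), \<psi>) \<in> superdiff p T F t (law X)"
    "kernel_joint (law X) \<psi> = distr cube (borel \<Otimes>\<^sub>M borel)
       (\<lambda>w. (X w, k *\<^sub>R pgrad p (X w - Y w) + grad_series p (\<lambda>i. (1/2) ^ i) X A w))"
proof -
  define c :: "nat \<Rightarrow> real" where "c i = (case i of 0 \<Rightarrow> k | Suc j \<Rightarrow> (1/2) ^ j)" for i
  define W where "W i = (case i of 0 \<Rightarrow> Y | Suc j \<Rightarrow> A j)" for i
  define \<sigma> where "\<sigma> i = (case i of 0 \<Rightarrow> s | Suc j \<Rightarrow> \<tau> j)" for i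
  have [simp]: "c 0 = k" "c (Suc j) = (1/2) ^ j" "W 0 = Y" "W (Suc j) = A j" "\<sigma> 0 = s" "\<sigma> (Suc j) = \<tau> j" for j
    by (simp_all add: c_def W_def \<sigma>_def)
  have c0: "0 \<le> c i" for i by (cases i) (simp_all add: k)
  have half: "summable (\<lambda>i. (1/2 :: real) ^ i)" by (simp add: summable_geometric)
  have halfp: "summable (\<lambda>i. ((1/2 :: real) ^ i) powr (1 / p))" using p by (intro summable_half_powr) auto
  have sc: "summable c" by (subst summable_Suc_iff[symmetric]) (simp add: half)
  have scp: "summable (\<lambda>i. c i powr (1 / p))"
    using halfp by (subst summable_Suc_iff[symmetric]) simp
  have WL: "W i \<in> Lp cube p" for i by (cases i) (simp_all add: A Y)
  have \<sigma>T: "\<sigma> i \<in> {0..T}" for i using s \<tau> by (cases i) auto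
  have sW: "summable (\<lambda>i. c i * pdist cube p X' (W i)) \<longleftrightarrow> summable (\<lambda>i. (1/2) ^ i * pdist cube p X' (A i))" for X'
    by (subst summable_Suc_iff[symmetric]) simp
  have sumW: "(\<Sum>i. c i * pdist cube p X' (W i)) = k * pdist cube p X' Y + (\<Sum>i. (1/2) ^ i * pdist cube p X' (A i))"
    if "summable (\<lambda>i. (1/2) ^ i * pdist cube p X' (A i))" for X'
    using suminf_split_head[of "\<lambda>i. c i * pdist cube p X' (W i)"] that sW[of X'] by simp
  have b: "\<bar>t' - \<tau> i\<bar> \<le> T" if "t' \<in> {0..T}" for t' i using that \<tau>[of i] by auto
  have sq: "summable (\<lambda>i. (1/2) ^ i * (t' - \<tau> i)\<^sup>2)" if t': "t' \<in> {0..T}" for t'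
    by (rule summable_weighted_bounded(2)[OF _ half b[OF t']]) simp
  have sq1: "summable (\<lambda>i. (1/2) ^ i * (t - \<tau> i))"
    by (rule summable_weighted_bounded(1)[OF _ half b[OF t]]) simp
  have sqW: "(\<Sum>i. c i * (t' - \<sigma> i)\<^sup>2) = k * (t' - s)\<^sup>2 + (\<Sum>i. (1/2) ^ i * (t' - \<tau> i)\<^sup>2)" if t': "t' \<in> {0..T}" for t'
  proof -
    have "summable (\<lambda>i. c i * (t' - \<sigma> i)\<^sup>2)"
      using sq[OF t'] by (subst summable_Suc_iff[symmetric]) simp
    from suminf_split_head[OF this] show ?thesis by simp
  qed
  have sq1W: "(\<Sum>i. c i * (t - \<sigma> i)) = k * (t - s) + (\<Sum>i. (1/2) ^ i * (t - \<tau> i))"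
  proof -
    have "summable (\<lambda>i. c i * (t - \<sigma> i))"
      using sq1 by (subst summable_Suc_iff[symmetric]) simp
    from suminf_split_head[OF this] show ?thesis by simp
  qed
  have both: "(\<Sum>i. (1/2) ^ i * (pdist cube p X' (A i) + (t' - \<tau> i)\<^sup>2))
      = (\<Sum>i. (1/2) ^ i * pdist cube p X' (A i)) + (\<Sum>i. (1/2) ^ i * (t' - \<tau> i)\<^sup>2)"
    if "summable (\<lambda>i. (1/2) ^ i * pdist cube p X' (A i))" "t' \<in> {0..T}" for X' t'
    using suminf_add[OF that(1) sq[OF that(2)]] by (simp add: distrib_left)
  obtain \<psi> where \<psi>: "(l + 2 * (\<Sum>i. c i * (t - \<sigma> i)), \<psi>) \<in> superdiff p T F t (law X)"
    "kernel_joint (law X) \<psi>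
      = distr cube (borel \<Otimes>\<^sub>M borel) (\<lambda>w. (X w, grad_series p c X W w))"
  proof (rule superdiff_of_touching[where W = W and \<tau> = \<sigma> and c = c and U = F, OF p t X WL \<sigma>T c0 sc scp _ bdd])
    show "summable (\<lambda>i. c i * pdist cube p X (W i))" using sd by (simp add: sW)
    fix t' X' assume *: "t' \<in> {0..T}" "X' \<in> Lp cube p" "summable (\<lambda>i. c i * pdist cube p X' (W i))"
    then have **: "summable (\<lambda>i. (1/2) ^ i * pdist cube p X' (A i))" by (simp add: sW)
    show "F t' (law X') - l * t' - (\<Sum>i. c i * pdist cube p X' (W i)) - (\<Sum>i. c i * (t' - \<sigma> i)\<^sup>2)
      \<le> F t (law X) - l * t - (\<Sum>i. c i * pdist cube p X (W i)) - (\<Sum>i. c i * (t - \<sigma> i)\<^sup>2)"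
      using touch[OF *(1,2) **] unfolding sumW[OF **] sumW[OF sd] sqW[OF *(1)] sqW[OF t] both[OF ** *(1)] both[OF sd t]
      by (simp add: distrib_left)
  qed auto
  have sdW: "summable (\<lambda>i. c i * pdist cube p X (W i))" using sd by (simp add: sW)
  have m: "X \<in> borel_measurable cube" "Y \<in> borel_measurable cube" "A i \<in> borel_measurable cube" "W i \<in> borel_measurable cube" for i
    using X Y A WL by (auto simp: Lp_def)
  have ae: "AE w in cube. grad_series p c X W w = k *\<^sub>R pgrad p (X w - Y w) + grad_series p (\<lambda>i. (1/2) ^ i) X A w"
  proof -
    have "AE w in cube. summable (\<lambda>i. c i * norm (X w - W i w) powr p)"
      by (rule weighted_dist_series(1)[OF p c0 X WL sc scp sdW])
    then show ?thesis
    proof eventually_elim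
      case (elim w)
      have "summable (\<lambda>i. c i *\<^sub>R pgrad p (X w - W i w))"
        by (rule summable_norm_cancel[OF grad_series_pointwise(1)[where c = c and X = X and W = W and w = w, OF p c0 X WL sc scp sdW elim]])
      from suminf_split_head[OF this] show ?case by (simp add: grad_series_def)
    qed
  qed
  have kj: "kernel_joint (law X) \<psi> = distr cube (borel \<Otimes>\<^sub>M borel)
       (\<lambda>w. (X w, k *\<^sub>R pgrad p (X w - Y w) + grad_series p (\<lambda>i. (1/2) ^ i) X A w))"
    unfolding \<psi>(2)
  proof (rule distr_cong_AE)
    show "AE w in cube. (X w, grad_series p c X W w)
        = (X w, k *\<^sub>R pgrad p (X w - Y w) + grad_series p (\<lambda>i. (1/2) ^ i) X A w)"
      using ae by eventually_elim simp
    note [measurable] = m grad_series_measurable[OF m(1), of W p c] grad_series_measurable[OF m(1), of A p "\<lambda>i. (1/2) ^ i"]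
    show "(\<lambda>w. (X w, grad_series p c X W w)) \<in> cube \<rightarrow>\<^sub>M borel \<Otimes>\<^sub>M borel" using m by measurable
    show "(\<lambda>w. (X w, k *\<^sub>R pgrad p (X w - Y w) + grad_series p (\<lambda>i. (1/2) ^ i) X A w)) \<in> cube \<rightarrow>\<^sub>M borel \<Otimes>\<^sub>M borel"
      using m unfolding pgrad_def by measurable
  qed auto
  have "l + 2 * (\<Sum>i. c i * (t - \<sigma> i)) = l + 2 * k * (t - s) + 2 * (\<Sum>i. (1/2) ^ i * (t - \<tau> i))"
    by (simp add: sq1W)
  then have "(l + 2 * k * (t - s) + 2 * (\<Sum>i. (1/2) ^ i * (t - \<tau> i)), \<psi>) \<in> superdiff p T F t (law X)"
    using \<psi>(1) by (simp only:)
  from that[OF this kj] show thesis .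
qed

section \<open>The Hamiltonian along random variables\<close>

lemma gradient_bound_diff:
  fixes f :: "'a::real_inner \<Rightarrow> real"
  assumes grad: "\<And>q. norm q \<le> R \<Longrightarrow> \<exists>D. (GDERIV f q :> D) \<and> norm D \<le> L"
    and qe: "norm q \<le> R" "norm q' \<le> R"
  shows "\<bar>f q - f q'\<bar> \<le> L * norm (q - q')"
proof -
  obtain D where D: "\<And>q. norm q \<le> R \<Longrightarrow> GDERIV f q :> D q" "\<And>q. norm q \<le> R \<Longrightarrow> norm (D q) \<le> L"
    using grad by metis
  have "norm (f q - f q') \<le> L * norm (q - q')"
  proof (rule differentiable_bound[of "cball 0 R" f "\<lambda>x h. h \<bullet> D x"])
    fix x assume "x \<in> cball (0 :: 'a) R"
    then have x: "norm x \<le> R" by simp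
    show "(f has_derivative (\<lambda>h. h \<bullet> D x)) (at x within cball 0 R)"
      using D(1)[OF x] by (auto simp: gderiv_def inner_commute intro: has_derivative_at_withinI)
    have "0 \<le> L" using D(2)[OF x] norm_ge_zero order_trans by blast
    then show "onorm (\<lambda>h. h \<bullet> D x) \<le> L"
    proof (rule onorm_bound)
      fix h
      have "norm (h \<bullet> D x) \<le> norm h * norm (D x)" using Cauchy_Schwarz_ineq2[of h "D x"] by simp
      also have "\<dots> \<le> norm h * L" by (intro mult_left_mono D(2) x) auto
      finally show "norm (h \<bullet> D x) \<le> L * norm h" by (simp add: mult.commute)
    qed
  qed (use qe in auto)
  then show ?thesis by simp
qed

text \<open>A concave function lies below the ray through the origin and any of its points to the left. With this
affine bound the expectation of \<open>\<omega>\<close> can be estimated by linearity.\<close>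

lemma modulus_linear_bound:
  assumes \<omega>: "modulus_of_continuity \<omega>" and k: "0 < \<kappa>"
  obtains K where "0 \<le> K" "\<And>r. 0 \<le> r \<Longrightarrow> \<omega> r \<le> \<kappa> + K * r"
proof -
  have cont: "continuous_on {0..} \<omega>" and conc: "concave_on {0..} \<omega>" and w0: "\<omega> 0 = 0"
    using \<omega> by (auto simp: modulus_of_continuity_def)
  obtain \<delta> where \<delta>: "0 < \<delta>" "\<And>r. 0 \<le> r \<Longrightarrow> r < \<delta> \<Longrightarrow> \<bar>\<omega> r\<bar> < \<kappa>"
  proof -
    obtain d where d: "0 < d" "\<And>x'. x' \<in> {0..} \<Longrightarrow> dist x' 0 < d \<Longrightarrow> dist (\<omega> x') (\<omega> 0) < \<kappa>"
      using cont[unfolded continuous_on_iff, rule_format, of 0 \<kappa>] k by auto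
    show thesis
      by (rule that[OF d(1)]) (use d(2) w0 in \<open>force simp: dist_real_def\<close>)
  qed
  define d where "d = \<delta> / 2"
  have d: "0 < d" "d < \<delta>" using \<delta> by (auto simp: d_def)
  show thesis
  proof (rule that[of "\<kappa> / d"])
    show "0 \<le> \<kappa> / d" using k d by simp
    fix r :: real assume r: "0 \<le> r"
    show "\<omega> r \<le> \<kappa> + \<kappa> / d * r"
    proof (cases "r < \<delta>")
      case True
      moreover have "0 \<le> \<kappa> / d * r" using k d r by simp
      ultimately show ?thesis using \<delta>(2)[OF r] by (smt (verit))
    next
      case False
      then have rd: "d < r" using d by simp
      define u where "u = d / r"
      have u: "0 \<le> u" "u \<le> 1" using rd d by (auto simp: u_def)
      have "(1 - u) * \<omega> 0 + u * \<omega> r \<le> \<omega> ((1 - u) *\<^sub>R 0 + u *\<^sub>R r)"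
        using conc u r by (intro concave_onD) auto
      then have "d / r * \<omega> r \<le> \<omega> d" using w0 rd d by (simp add: u_def)
      also have "\<dots> \<le> \<kappa>" using \<delta>(2)[of d] d by auto
      finally have "\<omega> r \<le> \<kappa> / d * r" using d rd by (simp add: field_simps)
      then show ?thesis using k by simp
    qed
  qed
qed

lemma wasserstein_self:
  assumes "0 < p" "\<mu> \<in> Pp p"
  shows "wasserstein p \<mu> (\<mu> :: 'a::euclidean_space measure) = 0"
proof -
  obtain X where X: "X \<in> borel_measurable cube" "law X = \<mu>"
    using cube_realise_law[of \<mu>] assms by (auto simp: Pp_def)
  then have "X \<in> Lp cube p" using assms Lp_of_law by blast
  from wasserstein_law_le[OF assms(1) this this] show ?thesis
    using X wasserstein_nonneg[of p \<mu> \<mu>] by simp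
qed

context
  fixes p C :: real and \<omega> :: "real \<Rightarrow> real" and H :: "'a::euclidean_space \<Rightarrow> 'a \<Rightarrow> 'a measure \<Rightarrow> real"
  assumes p: "1 < p" and C: "0 < C" and \<omega>: "modulus_of_continuity \<omega>"
    and growth: "\<And>x q \<mu>. \<mu> \<in> Pp p \<Longrightarrow> \<bar>H x q \<mu>\<bar> \<le> C * (1 + norm q powr conj_exponent p)"
    and shift: "\<And>x y q \<mu> \<nu>. \<mu> \<in> Pp p \<Longrightarrow> \<nu> \<in> Pp p \<Longrightarrow>
           \<bar>H x q \<mu> - H y q \<nu>\<bar> \<le> \<omega> ((1 + norm q) * (norm (x - y) + wasserstein p \<mu> \<nu>))"
    and grad: "\<And>x q \<mu>. \<mu> \<in> Pp p \<Longrightarrow>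
           \<exists>D. (GDERIV (\<lambda>r. H x r \<mu>) q :> D) \<and> norm D \<le> C * (1 + norm q powr (conj_exponent p - 1))"
begin

lemma H_diff_le:
  assumes \<mu>: "\<mu> \<in> Pp p"
  shows "\<bar>H x (q + e) \<mu> - H x q \<mu>\<bar> \<le> C * (1 + (norm q + norm e) powr (conj_exponent p - 1)) * norm e"
proof -
  have "\<bar>H x (q + e) \<mu> - H x q \<mu>\<bar> \<le> C * (1 + (norm q + norm e) powr (conj_exponent p - 1)) * norm (q + e - q)"
  proof (rule gradient_bound_diff[where R = "norm q + norm e"])
    fix q' :: 'a assume q': "norm q' \<le> norm q + norm e"
    obtain D where "GDERIV (\<lambda>r. H x r \<mu>) q' :> D" "norm D \<le> C * (1 + norm q' powr (conj_exponent p - 1))"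
      using grad[OF \<mu>] by blast
    moreover have "C * (1 + norm q' powr (conj_exponent p - 1)) \<le> C * (1 + (norm q + norm e) powr (conj_exponent p - 1))"
      using C q' conj_exponent_gt_1[OF p] by (intro mult_left_mono add_left_mono powr_mono2) auto
    ultimately show "\<exists>D. (GDERIV (\<lambda>r. H x r \<mu>) q' :> D) \<and> norm D \<le> C * (1 + (norm q + norm e) powr (conj_exponent p - 1))"
      by fastforce
  qed (use norm_triangle_ineq[of q e] in auto)
  then show ?thesis by simp
qed

lemma H_measurable:
  assumes \<mu>: "\<mu> \<in> Pp p"
  shows "(\<lambda>z. H (fst z) (snd z) \<mu>) \<in> borel_measurable (borel \<Otimes>\<^sub>M borel)"
proof -
  have "continuous_on UNIV (\<lambda>z. H (fst z) (snd z) \<mu>)"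
  proof (intro continuous_at_imp_continuous_on ballI)
    fix z0 :: "'a \<times> 'a"
    obtain x q where z0: "z0 = (x, q)" by (cases z0)
    define g where "g z = C * (1 + (norm q + norm (snd z - q)) powr (conj_exponent p - 1)) * norm (snd z - q)
        + \<omega> ((1 + norm q) * norm (fst z - x))" for z :: "'a \<times> 'a"
    have "(snd \<longlongrightarrow> snd z0) (at z0)" "(fst \<longlongrightarrow> fst z0) (at z0)"
      unfolding z0 using tendsto_snd[OF tendsto_ident_at] tendsto_fst[OF tendsto_ident_at] by auto
    from tendsto_diff[OF this(1) tendsto_const[of q]] tendsto_diff[OF this(2) tendsto_const[of x]]
    have s: "((\<lambda>z. snd z - q) \<longlongrightarrow> q - q) (at z0)" "((\<lambda>z. fst z - x) \<longlongrightarrow> x - x) (at z0)"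
      by (simp_all add: z0)
    have "((\<lambda>z. \<omega> ((1 + norm q) * norm (fst z - x))) \<longlongrightarrow> \<omega> 0) (at z0)"
    proof (rule continuous_on_tendsto_compose[where s = "{0..}" and f = \<omega>])
      show "continuous_on {0..} \<omega>" using \<omega> by (simp add: modulus_of_continuity_def)
      have "((\<lambda>z. (1 + norm q) * norm (fst z - x)) \<longlongrightarrow> (1 + norm q) * norm (x - x)) (at z0)"
        by (intro tendsto_intros s)
      then show "((\<lambda>z. (1 + norm q) * norm (fst z - x)) \<longlongrightarrow> 0) (at z0)" by simp
    qed auto
    moreover have "((\<lambda>z. C * (1 + (norm q + norm (snd z - q)) powr (conj_exponent p - 1)) * norm (snd z - q))
        \<longlongrightarrow> C * (1 + (norm q + norm (q - q)) powr (conj_exponent p - 1)) * norm (q - q)) (at z0)"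
      using conj_exponent_gt_1[OF p]
      by (intro tendsto_intros s tendsto_powr') auto
    ultimately have g0: "(g \<longlongrightarrow> 0) (at z0)"
      unfolding g_def[abs_def] using \<omega> tendsto_add by (fastforce simp: modulus_of_continuity_def)
    have "norm (H (fst z) (snd z) \<mu> - H x q \<mu>) \<le> g z" for z
    proof -
      have "\<bar>H (fst z) (q + (snd z - q)) \<mu> - H (fst z) q \<mu>\<bar>
          \<le> C * (1 + (norm q + norm (snd z - q)) powr (conj_exponent p - 1)) * norm (snd z - q)"
        by (rule H_diff_le[OF \<mu>])
      moreover have "\<bar>H (fst z) q \<mu> - H x q \<mu>\<bar> \<le> \<omega> ((1 + norm q) * norm (fst z - x))"
        using shift[OF \<mu> \<mu>, of "fst z" q x] p by (simp add: wasserstein_self \<mu>)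
      ultimately show ?thesis by (simp add: g_def)
    qed
    then have "((\<lambda>z. H (fst z) (snd z) \<mu> - H x q \<mu>) \<longlongrightarrow> 0) (at z0)"
      by (intro Lim_null_comparison[OF always_eventually g0]) auto
    then show "isCont (\<lambda>z. H (fst z) (snd z) \<mu>) z0"
      unfolding isCont_def using LIM_zero_iff by (fastforce simp: z0)
  qed
  then show ?thesis unfolding borel_prod by (rule borel_measurable_continuous_onI)
qed

lemma H_comp_measurable:
  assumes \<mu>: "\<mu> \<in> Pp p" and [measurable]: "X \<in> borel_measurable M" "Z \<in> borel_measurable M"
  shows "(\<lambda>w. H (X w) (Z w) \<mu>) \<in> borel_measurable M"
  using measurable_compose[OF _ H_measurable[OF \<mu>], of "\<lambda>w. (X w, Z w)" M] by simp

lemma H_integrable: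
  assumes \<mu>: "\<mu> \<in> Pp p" and X: "X \<in> borel_measurable cube" and Z: "Z \<in> borel_measurable cube"
    and int: "integrable cube (\<lambda>w. norm (Z w) powr conj_exponent p)"
  shows "integrable cube (\<lambda>w. H (X w) (Z w) \<mu>)"
proof (rule Bochner_Integration.integrable_bound)
  show "integrable cube (\<lambda>w. C * (1 + norm (Z w) powr conj_exponent p))" using int by simp
  show "AE w in cube. norm (H (X w) (Z w) \<mu>) \<le> norm (C * (1 + norm (Z w) powr conj_exponent p))"
    using growth[OF \<mu>] C by (auto intro!: AE_I2 order_trans[OF _ abs_ge_self])
qed (rule H_comp_measurable[OF \<mu> X Z])

lemma powr_conj_add_integrable:
  fixes Q E :: "(real \<Rightarrow> real) \<Rightarrow> 'a"
  assumes [measurable]: "Q \<in> borel_measurable cube" "E \<in> borel_measurable cube"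
    and "integrable cube (\<lambda>w. norm (Q w) powr conj_exponent p)" "integrable cube (\<lambda>w. norm (E w) powr conj_exponent p)"
  shows "integrable cube (\<lambda>w. norm (Q w + E w) powr conj_exponent p)"
  using Lp_add[of Q cube "conj_exponent p" E] assms conj_exponent_gt_1[OF p] by (simp add: Lp_def)

text \<open>Along the segment from \<open>Q\<close> to \<open>Q + E\<close> the derivative of \<open>H\<close> grows like \<open>(norm Q + norm E) powr (p' - 1)\<close>
for the conjugate exponent \<open>p'\<close>. Its product with \<open>norm E\<close> is integrable since \<open>Q\<close> and \<open>E\<close> have finite
\<open>p'\<close>-th moments, and it is of order \<open>\<kappa>\<close> by the scaling in \<open>mult_powr_le_scaled\<close>.\<close>

lemma H_expected_perturbation:
  fixes Q E :: "(real \<Rightarrow> real) \<Rightarrow> 'a"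
  assumes \<mu>: "\<mu> \<in> Pp p" and X: "X \<in> borel_measurable cube"
    and Q: "Q \<in> borel_measurable cube" "integrable cube (\<lambda>w. norm (Q w) powr conj_exponent p)"
    and E: "E \<in> borel_measurable cube" "integrable cube (\<lambda>w. norm (E w) powr conj_exponent p)"
    and \<kappa>: "0 < \<kappa>" "(\<integral>w. norm (E w) powr conj_exponent p \<partial>cube) \<le> \<kappa> powr conj_exponent p"
  shows "\<bar>(\<integral>w. H (X w) (Q w + E w) \<mu> \<partial>cube) - (\<integral>w. H (X w) (Q w) \<mu> \<partial>cube)\<bar>
    \<le> C * \<kappa> * (3 + 2 powr conj_exponent p * ((\<integral>w. norm (Q w) powr conj_exponent p \<partial>cube) + \<kappa> powr conj_exponent p))"
proof -
  interpret prob_space cube by (rule prob_space_cube)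
  define p' where "p' = conj_exponent p"
  have p': "1 < p'" using conj_exponent_gt_1[OF p] by (simp add: p'_def)
  have QE: "(\<lambda>w. Q w + E w) \<in> borel_measurable cube" using Q E by simp
  note i1 = H_integrable[OF \<mu> X QE powr_conj_add_integrable[OF Q(1) E(1) Q(2) E(2)]]
  note i2 = H_integrable[OF \<mu> X Q]
  have le: "\<bar>H (X w) (Q w + E w) \<mu> - H (X w) (Q w) \<mu>\<bar>
      \<le> C * (\<kappa> * (1 + 2 * (norm (E w) powr p' / \<kappa> powr p') + 2 powr p' * (norm (Q w) powr p' + norm (E w) powr p')))" for w
  proof -
    define e b where "e = norm (E w)" and "b = norm (Q w) + norm (E w)"
    have 1: "e \<le> \<kappa> * ((e / \<kappa>) powr p' + 1)"
      using mult_powr_le_scaled[of e 1 \<kappa> 1 p'] \<kappa> p' by (simp add: e_def)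
    have 2: "b powr (p' - 1) * e \<le> \<kappa> * ((e / \<kappa>) powr p' + b powr p')"
      using mult_powr_le_scaled[of e b \<kappa> 1 p'] \<kappa> p' by (simp add: e_def b_def mult.commute)
    have 3: "b powr p' \<le> 2 powr p' * (norm (Q w) powr p' + norm (E w) powr p')"
      unfolding b_def using p' by (intro powr_add_le) auto
    have "\<bar>H (X w) (Q w + E w) \<mu> - H (X w) (Q w) \<mu>\<bar> \<le> C * (1 + b powr (p' - 1)) * e"
      unfolding b_def e_def p'_def by (rule H_diff_le[OF \<mu>])
    also have "\<dots> = C * (e + b powr (p' - 1) * e)" by (simp add: algebra_simps)
    also have "\<dots> \<le> C * (\<kappa> * ((e / \<kappa>) powr p' + 1) + \<kappa> * ((e / \<kappa>) powr p' + b powr p'))"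
      using C 1 2 by (intro mult_left_mono add_mono) auto
    also have "\<dots> = C * (\<kappa> * (1 + 2 * ((e / \<kappa>) powr p') + b powr p'))" by (simp add: algebra_simps)
    also have "\<dots> \<le> C * (\<kappa> * (1 + 2 * ((e / \<kappa>) powr p') + 2 powr p' * (norm (Q w) powr p' + norm (E w) powr p')))"
      using C \<kappa> 3 by (intro mult_left_mono add_left_mono) auto
    finally show ?thesis using \<kappa> by (simp add: e_def powr_divide)
  qed
  have "\<bar>(\<integral>w. H (X w) (Q w + E w) \<mu> \<partial>cube) - (\<integral>w. H (X w) (Q w) \<mu> \<partial>cube)\<bar>
      = \<bar>\<integral>w. H (X w) (Q w + E w) \<mu> - H (X w) (Q w) \<mu> \<partial>cube\<bar>" using i1 i2 by simp
  also have "\<dots> \<le> (\<integral>w. \<bar>H (X w) (Q w + E w) \<mu> - H (X w) (Q w) \<mu>\<bar> \<partial>cube)" by (rule integral_abs_bound)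
  also have "\<dots> \<le> (\<integral>w. C * (\<kappa> * (1 + 2 * (norm (E w) powr p' / \<kappa> powr p') + 2 powr p' * (norm (Q w) powr p' + norm (E w) powr p'))) \<partial>cube)"
    using i1 i2 Q E le by (intro integral_mono) (auto simp: p'_def)
  also have "\<dots> = C * (\<kappa> * (1 + 2 * ((\<integral>w. norm (E w) powr p' \<partial>cube) / \<kappa> powr p')
      + 2 powr p' * ((\<integral>w. norm (Q w) powr p' \<partial>cube) + (\<integral>w. norm (E w) powr p' \<partial>cube))))"
    using Q E prob_space by (simp add: p'_def)
  also have "\<dots> \<le> C * (\<kappa> * (1 + 2 * 1 + 2 powr p' * ((\<integral>w. norm (Q w) powr p' \<partial>cube) + \<kappa> powr p')))"
    using C \<kappa> by (intro mult_left_mono add_mono) (auto simp: p'_def)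
  finally show ?thesis by (simp add: p'_def)
qed

text \<open>Here the momentum \<open>Q = k *\<^sub>R pgrad p (X - Y)\<close> is the same for both measures. The
modulus sees \<open>(1 + norm Q) * (norm (X - Y) + r)\<close>, and \<open>norm Q * norm (X - Y)\<close> is \<open>p\<close> times the
penalty \<open>k * norm (X - Y) powr p\<close>. So the difference is controlled by the distance and by the
penalty, not by the size of \<open>Q\<close>, which may be large.\<close>

lemma H_expected_shift:
  fixes X Y :: "(real \<Rightarrow> real) \<Rightarrow> 'a"
  assumes X: "X \<in> Lp cube p" and Y: "Y \<in> Lp cube p" and r: "0 < r" "pdist cube p X Y \<le> r powr p"
    and k: "0 \<le> k" and K: "0 \<le> K" "\<And>u. 0 \<le> u \<Longrightarrow> \<omega> u \<le> \<kappa> + K * u"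
  shows "integrable cube (\<lambda>w. norm (k *\<^sub>R pgrad p (X w - Y w)) powr conj_exponent p)"
    and "(\<integral>w. norm (k *\<^sub>R pgrad p (X w - Y w)) powr conj_exponent p \<partial>cube) = (k * p) powr conj_exponent p * pdist cube p X Y"
    and "\<bar>(\<integral>w. H (X w) (k *\<^sub>R pgrad p (X w - Y w)) (law X) \<partial>cube)
        - (\<integral>w. H (Y w) (k *\<^sub>R pgrad p (X w - Y w)) (law Y) \<partial>cube)\<bar>
      \<le> \<kappa> + K * (3 * r + 3 * p * (k * r powr p))"
proof -
  interpret prob_space cube by (rule prob_space_cube)
  define \<mu> \<nu> where "\<mu> = law X" and "\<nu> = law Y"
  have \<mu>\<nu>: "\<mu> \<in> Pp p" "\<nu> \<in> Pp p" unfolding \<mu>_def \<nu>_def using X Y by (auto intro: law_in_Pp)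
  have [measurable]: "X \<in> borel_measurable cube" "Y \<in> borel_measurable cube" using X Y by (auto simp: Lp_def)
  define Q where "Q w = k *\<^sub>R pgrad p (X w - Y w)" for w
  have Qm: "Q \<in> borel_measurable cube" unfolding Q_def[abs_def] pgrad_def by measurable
  have nQ: "norm (Q w) = k * p * norm (X w - Y w) powr (p - 1)" for w
    using k p by (simp add: Q_def norm_pgrad)
  have di: "integrable cube (\<lambda>w. norm (X w - Y w) powr p)" using X Y p by (intro Lp_integrable_diff) auto
  have Qp: "norm (Q w) powr conj_exponent p = (k * p) powr conj_exponent p * norm (X w - Y w) powr p" for w
    unfolding nQ using k p by (simp add: powr_mult powr_powr conj_exponent_def)
  show Qi: "integrable cube (\<lambda>w. norm (k *\<^sub>R pgrad p (X w - Y w)) powr conj_exponent p)"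
    unfolding Q_def[symmetric] Qp using di by simp
  show "(\<integral>w. norm (k *\<^sub>R pgrad p (X w - Y w)) powr conj_exponent p \<partial>cube) = (k * p) powr conj_exponent p * pdist cube p X Y"
    unfolding Q_def[symmetric] Qp pdist_def by simp
  have W: "wasserstein p \<mu> \<nu> \<le> r"
  proof -
    have "wasserstein p \<mu> \<nu> \<le> pdist cube p X Y powr (1 / p)"
      unfolding \<mu>_def \<nu>_def using p X Y by (intro wasserstein_law_le) auto
    also have "\<dots> \<le> (r powr p) powr (1 / p)" using r p by (intro powr_mono2) (auto simp: pdist_nonneg)
    finally show ?thesis using r p by (simp add: powr_powr)
  qed
  have i1: "integrable cube (\<lambda>w. H (X w) (Q w) \<mu>)" "integrable cube (\<lambda>w. H (Y w) (Q w) \<nu>)"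
    using Qi unfolding Q_def[symmetric] by (auto intro: H_integrable[OF \<mu>\<nu>(1) _ Qm] H_integrable[OF \<mu>\<nu>(2) _ Qm])
  define B where "B w = 2 * r + r * (norm (X w - Y w) powr p / r powr p) + 2 * (k * p) * norm (X w - Y w) powr p
      + k * p * r powr p" for w
  have le: "\<bar>H (X w) (Q w) \<mu> - H (Y w) (Q w) \<nu>\<bar> \<le> \<kappa> + K * B w" for w
  proof -
    define a where "a = norm (X w - Y w)"
    have a: "0 \<le> a" by (simp add: a_def)
    have a1: "a \<le> r + r * (a powr p / r powr p)"
      using mult_powr_le_scaled[of a 1 r 1 p] a r p by (simp add: powr_divide algebra_simps)
    have a2: "a powr (p - 1) * a = a powr p" using a p powr_mult_base[of a "p - 1"] by (simp add: mult.commute)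
    have a3: "a powr (p - 1) * r \<le> a powr p + r powr p"
      using powr_mult_le_powr_add[of a r "p - 1" 1] a r p by simp
    have nn: "0 \<le> norm (X w - Y w) + wasserstein p \<mu> \<nu>" by (simp add: wasserstein_nonneg)
    have "\<bar>H (X w) (Q w) \<mu> - H (Y w) (Q w) \<nu>\<bar> \<le> \<omega> ((1 + norm (Q w)) * (a + wasserstein p \<mu> \<nu>))"
      unfolding a_def by (rule shift[OF \<mu>\<nu>])
    also have "\<dots> \<le> \<kappa> + K * ((1 + norm (Q w)) * (a + wasserstein p \<mu> \<nu>))"
      using nn by (intro K(2)) (simp add: a_def)
    also have "\<dots> \<le> \<kappa> + K * ((1 + norm (Q w)) * (a + r))"
      using K W by (intro add_left_mono mult_left_mono) auto
    also have "(1 + norm (Q w)) * (a + r) = a + r + k * p * (a powr (p - 1) * a) + k * p * (a powr (p - 1) * r)"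
      unfolding nQ by (simp add: a_def algebra_simps)
    also have "\<dots> \<le> (r + r * (a powr p / r powr p)) + r + k * p * a powr p + k * p * (a powr p + r powr p)"
      unfolding a2 using a1 a3 k p by (intro add_mono mult_left_mono) auto
    also have "\<dots> = B w" by (simp add: B_def a_def algebra_simps)
    finally show ?thesis using K(1) by (simp add: mult_left_mono)
  qed
  have Bi: "integrable cube B" unfolding B_def[abs_def] using di by simp
  have IB: "integral\<^sup>L cube B \<le> 3 * r + 3 * p * (k * r powr p)"
  proof -
    have "integral\<^sup>L cube B = 2 * r + r * (pdist cube p X Y / r powr p) + 2 * (k * p) * pdist cube p X Y + k * p * r powr p"
      unfolding B_def[abs_def] pdist_def using di prob_space by simp
    also have "\<dots> \<le> 2 * r + r * 1 + 2 * (k * p) * r powr p + k * p * r powr p"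
      using r k p by (intro add_mono mult_left_mono) auto
    finally show ?thesis by (simp add: algebra_simps)
  qed
  have "\<bar>(\<integral>w. H (X w) (Q w) \<mu> \<partial>cube) - (\<integral>w. H (Y w) (Q w) \<nu> \<partial>cube)\<bar>
      = \<bar>\<integral>w. H (X w) (Q w) \<mu> - H (Y w) (Q w) \<nu> \<partial>cube\<bar>" using i1 by simp
  also have "\<dots> \<le> (\<integral>w. \<bar>H (X w) (Q w) \<mu> - H (Y w) (Q w) \<nu>\<bar> \<partial>cube)" by (rule integral_abs_bound)
  also have "\<dots> \<le> (\<integral>w. \<kappa> + K * B w \<partial>cube)" using i1 Bi le by (intro integral_mono) auto
  also have "\<dots> = \<kappa> + K * integral\<^sup>L cube B" using Bi prob_space by simp
  also have "\<dots> \<le> \<kappa> + K * (3 * r + 3 * p * (k * r powr p))" using IB K by (intro add_left_mono mult_left_mono)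
  finally show "\<bar>(\<integral>w. H (X w) (k *\<^sub>R pgrad p (X w - Y w)) (law X) \<partial>cube)
        - (\<integral>w. H (Y w) (k *\<^sub>R pgrad p (X w - Y w)) (law Y) \<partial>cube)\<bar>
      \<le> \<kappa> + K * (3 * r + 3 * p * (k * r powr p))"
    by (simp add: Q_def \<mu>_def \<nu>_def)
qed

end

section \<open>The comparison principle\<close>

lemma bounded_on_PpD:
  assumes "bounded_on_Pp p T U"
  obtains B where "\<And>t \<mu>. t \<in> {0..T} \<Longrightarrow> \<mu> \<in> Pp p \<Longrightarrow> \<bar>U t \<mu>\<bar> \<le> B"
  using assms unfolding bounded_on_Pp_def bounded_iff by fastforce

text \<open>The time derivative of the perturbation is small because the perturbation itself is:
\<open>\<bar>x\<bar> \<le> sqrt \<eta> + x\<^sup>2 / sqrt \<eta>\<close>, summed with total weight 2.\<close>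

lemma weighted_first_moment_le:
  fixes x :: "nat \<Rightarrow> real"
  assumes sm: "summable (\<lambda>i. (1/2) ^ i * (x i)\<^sup>2)" and le: "(\<Sum>i. (1/2) ^ i * (x i)\<^sup>2) \<le> \<eta>" and \<eta>: "0 < \<eta>"
  shows "\<bar>\<Sum>i. (1/2) ^ i * x i\<bar> \<le> 3 * sqrt \<eta>"
proof -
  have half: "summable (\<lambda>i. (1/2 :: real) ^ i)" "(\<Sum>i. (1/2 :: real) ^ i) = 2"
    by (simp_all add: summable_geometric suminf_geometric)
  have pt: "\<bar>(1/2) ^ i * x i\<bar> \<le> (1/2) ^ i * sqrt \<eta> + (1/2) ^ i * (x i)\<^sup>2 / sqrt \<eta>" for i
  proof -
    have "0 \<le> (\<bar>x i\<bar> - sqrt \<eta>)\<^sup>2" by simp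
    then have "2 * \<bar>x i\<bar> * sqrt \<eta> \<le> (x i)\<^sup>2 + (sqrt \<eta>)\<^sup>2" by (simp add: power2_diff)
    moreover have "0 \<le> \<bar>x i\<bar> * sqrt \<eta>" using \<eta> by simp
    ultimately have "\<bar>x i\<bar> * sqrt \<eta> \<le> (x i)\<^sup>2 + (sqrt \<eta>)\<^sup>2" by linarith
    then have "\<bar>x i\<bar> \<le> sqrt \<eta> + (x i)\<^sup>2 / sqrt \<eta>"
      using \<eta> by (simp add: field_simps power2_eq_square)
    then have "(1/2) ^ i * \<bar>x i\<bar> \<le> (1/2) ^ i * (sqrt \<eta> + (x i)\<^sup>2 / sqrt \<eta>)" by (intro mult_left_mono) auto
    then show ?thesis by (simp add: abs_mult distrib_left)
  qed
  have s2: "summable (\<lambda>i. (1/2) ^ i * sqrt \<eta> + (1/2) ^ i * (x i)\<^sup>2 / sqrt \<eta>)"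
    by (intro summable_add summable_mult2 summable_divide half sm)
  have s1: "summable (\<lambda>i. \<bar>(1/2) ^ i * x i\<bar>)"
    by (rule summable_comparison_test'[OF s2, of 0]) (use pt in auto)
  have "\<bar>\<Sum>i. (1/2) ^ i * x i\<bar> \<le> (\<Sum>i. \<bar>(1/2) ^ i * x i\<bar>)" by (rule summable_rabs[OF s1])
  also have "\<dots> \<le> (\<Sum>i. (1/2) ^ i * sqrt \<eta> + (1/2) ^ i * (x i)\<^sup>2 / sqrt \<eta>)" by (intro suminf_le pt s1 s2)
  also have "\<dots> = 2 * sqrt \<eta> + (\<Sum>i. (1/2) ^ i * (x i)\<^sup>2) / sqrt \<eta>"
    using sm half by (subst suminf_add[symmetric]) (auto simp: suminf_mult2[symmetric] suminf_divide summable_mult2 summable_divide)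
  also have "\<dots> \<le> 2 * sqrt \<eta> + \<eta> / sqrt \<eta>" using \<eta> le by (intro add_left_mono divide_right_mono) auto
  also have "\<eta> / sqrt \<eta> = sqrt \<eta>" using \<eta> by (simp add: real_div_sqrt)
  finally show ?thesis by simp
qed

lemma eventually_small_penalty:
  fixes P P0 K d a p :: real
  assumes "0 < d" "0 < a" "1 < p"
  obtains \<epsilon> where "0 < \<epsilon>" "\<epsilon> * P0 < d" "\<epsilon> * P0 < d\<^sup>2" "K * (\<epsilon> * \<bar>P\<bar>) powr (1 / p) < a"
proof -
  have i: "((\<lambda>\<epsilon>::real. \<epsilon>) \<longlongrightarrow> 0) (at_right 0)" by (rule tendsto_ident_at)
  have "((\<lambda>\<epsilon>. \<epsilon> * P0) \<longlongrightarrow> 0 * P0) (at_right 0)" by (intro tendsto_intros i)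
  then have t1: "((\<lambda>\<epsilon>. \<epsilon> * P0) \<longlongrightarrow> 0) (at_right 0)" by simp
  have "((\<lambda>\<epsilon>. \<epsilon> * \<bar>P\<bar>) \<longlongrightarrow> 0 * \<bar>P\<bar>) (at_right 0)" by (intro tendsto_intros i)
  then have "((\<lambda>\<epsilon>. (\<epsilon> * \<bar>P\<bar>) powr (1 / p)) \<longlongrightarrow> 0) (at_right 0)"
    using assms by (intro tendsto_zero_powrI[where b = "1 / p"]) (auto intro!: eventually_at_rightI[of 0 1])
  then have t2: "((\<lambda>\<epsilon>. K * (\<epsilon> * \<bar>P\<bar>) powr (1 / p)) \<longlongrightarrow> 0) (at_right 0)" by (rule tendsto_mult_right_zero)
  have "0 < d\<^sup>2" using assms by simp
  have "\<forall>\<^sub>F \<epsilon> in at_right (0::real). 0 < \<epsilon> \<and> \<epsilon> * P0 < d \<and> \<epsilon> * P0 < d\<^sup>2 \<and> K * (\<epsilon> * \<bar>P\<bar>) powr (1 / p) < a"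
    by (intro eventually_conj order_tendstoD(2)[OF t1] order_tendstoD(2)[OF t2] \<open>0 < d\<^sup>2\<close> assms eventually_at_right_less)
  from eventually_happens'[OF _ this] show thesis using that by auto
qed

text \<open>The number \<open>\<kappa>\<close> is the bound that \<open>grad_series_Lp\<close> gives for the dual norm of the gradient of a
perturbation of size \<open>\<eta>\<close>.\<close>

lemma eventually_small_perturbation:
  fixes C R S Q a b p :: real
  assumes p: "1 < p" and pos: "0 < a" "0 < b" and S: "0 < S"
  obtains \<eta> \<kappa> where "0 < \<eta>" "\<eta> < a" "0 < \<kappa>" "\<kappa> powr conj_exponent p = (p * S) powr conj_exponent p * \<eta>"
    "12 * sqrt \<eta> + 2 * (C * \<kappa> * (3 + R * (Q + \<kappa> powr conj_exponent p))) < b"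
proof -
  define p' where "p' = conj_exponent p"
  have p': "1 < p'" using conj_exponent_gt_1[OF p] by (simp add: p'_def)
  define \<kappa> where "\<kappa> \<eta> = p * S * \<eta> powr (1 / p')" for \<eta>
  have i: "((\<lambda>\<eta>::real. \<eta>) \<longlongrightarrow> 0) (at_right 0)" by (rule tendsto_ident_at)
  have "((\<lambda>\<eta>. \<eta> powr (1 / p')) \<longlongrightarrow> 0) (at_right 0)"
    using p' i by (intro tendsto_zero_powrI[where b = "1 / p'"]) (auto intro!: eventually_at_rightI[of 0 1])
  then have k: "(\<kappa> \<longlongrightarrow> 0) (at_right 0)" unfolding \<kappa>_def[abs_def] by (rule tendsto_mult_right_zero)
  have "((\<lambda>\<eta>. \<kappa> \<eta> powr p') \<longlongrightarrow> 0) (at_right 0)"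
    by (rule tendsto_zero_powrI[OF k tendsto_const]) (use p p' S in \<open>simp_all add: \<kappa>_def\<close>)
  then have "((\<lambda>\<eta>. 12 * sqrt \<eta> + 2 * (C * \<kappa> \<eta> * (3 + R * (Q + \<kappa> \<eta> powr p'))))
      \<longlongrightarrow> 12 * sqrt 0 + 2 * (C * 0 * (3 + R * (Q + 0)))) (at_right 0)"
    by (intro tendsto_intros k i)
  then have t: "((\<lambda>\<eta>. 12 * sqrt \<eta> + 2 * (C * \<kappa> \<eta> * (3 + R * (Q + \<kappa> \<eta> powr p')))) \<longlongrightarrow> 0) (at_right 0)" by simp
  have "\<forall>\<^sub>F \<eta> in at_right (0::real). 0 < \<eta> \<and> \<eta> < a
      \<and> 12 * sqrt \<eta> + 2 * (C * \<kappa> \<eta> * (3 + R * (Q + \<kappa> \<eta> powr p'))) < b"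
    by (intro eventually_conj order_tendstoD(2)[OF t] order_tendstoD(2)[OF i] pos eventually_at_right_less)
  from eventually_happens'[OF _ this] obtain \<eta> where \<eta>: "0 < \<eta>" "\<eta> < a"
    "12 * sqrt \<eta> + 2 * (C * \<kappa> \<eta> * (3 + R * (Q + \<kappa> \<eta> powr p'))) < b" by auto
  show thesis
  proof (rule that[of \<eta> "\<kappa> \<eta>"])
    show "0 < \<kappa> \<eta>" using p S \<eta> by (simp add: \<kappa>_def)
    show "\<kappa> \<eta> powr conj_exponent p = (p * S) powr conj_exponent p * \<eta>"
      using p S \<eta> p' unfolding p'_def[symmetric] by (simp add: \<kappa>_def powr_mult powr_powr)
  qed (use \<eta> in \<open>simp_all add: p'_def\<close>)
qed

theorem theorem12p19:
  fixes p p' T C :: real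
    and \<omega> :: "real \<Rightarrow> real"
    and H :: "'a::euclidean_space \<Rightarrow> 'a \<Rightarrow> 'a measure \<Rightarrow> real"
    and U V :: "real \<Rightarrow> 'a measure \<Rightarrow> real"
  assumes "1 < p" and "p' = conj_exponent p" and "0 < T"
    and "0 < C" and "modulus_of_continuity \<omega>"
    and "\<And>x q \<mu>. \<mu> \<in> Pp p \<Longrightarrow> \<bar>H x q \<mu>\<bar> \<le> C * (1 + norm q powr p')"
    and "\<And>x y q \<mu> \<nu>. \<mu> \<in> Pp p \<Longrightarrow> \<nu> \<in> Pp p \<Longrightarrow>
           \<bar>H x q \<mu> - H y q \<nu>\<bar> \<le> \<omega> ((1 + norm q) * (norm (x - y) + wasserstein p \<mu> \<nu>))"
    and "\<And>x q \<mu>. \<mu> \<in> Pp p \<Longrightarrow>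
           \<exists>D. (GDERIV (\<lambda>r. H x r \<mu>) q :> D) \<and> norm D \<le> C * (1 + norm q powr (p' - 1))"
    and "bounded_on_Pp p T U" and "uniformly_continuous_on_Pp p T U"
    and "bounded_on_Pp p T V" and "uniformly_continuous_on_Pp p T V"
    and "viscosity_subsolution p T H U" and "viscosity_supersolution p T H V"
    and "\<And>\<mu>. \<mu> \<in> Pp p \<Longrightarrow> U 0 \<mu> - V 0 \<mu> \<le> 0"
  shows "\<forall>t\<in>{0..T}. \<forall>\<mu>\<in>Pp p. U t \<mu> \<le> V t \<mu>"
proof (rule ccontr)
  note p = assms(1) and T = assms(3) and C = assms(4) and \<omega> = assms(5)
  note Hh = assms(1,4,5,6-8)[unfolded assms(2)]
  note ucU = assms(10) and ucV = assms(12) and init = assms(15)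
  define p'' where "p'' = conj_exponent p"
  assume "\<not> (\<forall>t\<in>{0..T}. \<forall>\<mu>\<in>Pp p. U t \<mu> \<le> V t \<mu>)"
  then obtain t0 \<mu>0 where t0: "t0 \<in> {0..T}" and \<mu>0: "\<mu>0 \<in> Pp p" and gap: "V t0 \<mu>0 < U t0 \<mu>0" by force
  define m where "m = U t0 \<mu>0 - V t0 \<mu>0"
  \<comment> \<open>The slope \<open>l\<close> makes the subsolution strict and takes at most a quarter of the gap.\<close>
  define l where "l = m / (4 * T)"
  have m: "0 < m" using gap by (simp add: m_def)
  have l: "0 < l" "l * t0 \<le> m / 4"
  proof -
    show "0 < l" using m T by (simp add: l_def)
    then have "l * t0 \<le> l * T" using t0 by (intro mult_left_mono) auto
    then show "l * t0 \<le> m / 4" using T by (simp add: l_def)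
  qed
  obtain X0 where X0: "X0 \<in> borel_measurable cube" "law X0 = \<mu>0"
    using cube_realise_law[of \<mu>0] \<mu>0 by (auto simp: Pp_def)
  have X0L: "X0 \<in> Lp cube p" using Lp_of_law[OF X0(1)] X0(2) \<mu>0 by simp
  obtain BU where BU: "\<And>t \<mu>. t \<in> {0..T} \<Longrightarrow> \<mu> \<in> Pp p \<Longrightarrow> \<bar>U t \<mu>\<bar> \<le> BU" by (rule bounded_on_PpD[OF assms(9)]) blast
  obtain BV where BV: "\<And>t \<mu>. t \<in> {0..T} \<Longrightarrow> \<mu> \<in> Pp p \<Longrightarrow> \<bar>V t \<mu>\<bar> \<le> BV" by (rule bounded_on_PpD[OF assms(11)]) blast
  define B where "B = max BU BV"
  have UB: "\<bar>U t \<mu>\<bar> \<le> B" and VB: "\<bar>V t \<mu>\<bar> \<le> B" if "t \<in> {0..T}" "\<mu> \<in> Pp p" for t \<mu>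
    using BU[OF that] BV[OF that] by (auto simp: B_def)
  have VB': "\<bar>- V t \<mu>\<bar> \<le> B" if "t \<in> {0..T}" "\<mu> \<in> Pp p" for t \<mu> using VB[OF that] by simp
  obtain K where K: "0 \<le> K" "\<And>r. 0 \<le> r \<Longrightarrow> \<omega> r \<le> l / 8 + K * r"
    using modulus_linear_bound[OF \<omega>, of "l / 8"] l by auto
  \<comment> \<open>\<open>P\<close> will bound the penalty at the maximum; its contribution to \<open>H_expected_shift\<close> is at most \<open>l / 8\<close>.\<close>
  define P where "P = l / (24 * p * (K + 1))"
  have P: "0 < P" using l p K by (simp add: P_def)
  have KP: "K * (3 * p * P) \<le> l / 8"
  proof -
    have "K + 1 \<noteq> 0" using K by linarith
    then have "3 * p * P = (l / 8) / (K + 1)" using p by (simp add: P_def divide_simps)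
    then have "K * (3 * p * P) = (l / 8) * (K / (K + 1))" by simp
    also have "\<dots> \<le> (l / 8) * 1" using l K by (intro mult_left_mono) auto
    finally show ?thesis by simp
  qed
  define e where "e = min (P / 2) (m / 4)"
  have e: "0 < e" "e \<le> P / 2" "e \<le> m / 4" using P m by (auto simp: e_def)
  obtain \<delta>U where \<delta>U: "0 < \<delta>U" "\<And>t s X Y. t \<in> {0..T} \<Longrightarrow> s \<in> {0..T} \<Longrightarrow> X \<in> Lp cube p \<Longrightarrow> Y \<in> Lp cube p \<Longrightarrow>
     \<bar>t - s\<bar> < \<delta>U \<Longrightarrow> pdist cube p X Y < \<delta>U \<Longrightarrow> \<bar>U t (law X) - U s (law Y)\<bar> < e"
    by (rule uniformly_continuous_law[OF p ucU e(1)]) blast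
  obtain \<delta>V where \<delta>V: "0 < \<delta>V" "\<And>t s X Y. t \<in> {0..T} \<Longrightarrow> s \<in> {0..T} \<Longrightarrow> X \<in> Lp cube p \<Longrightarrow> Y \<in> Lp cube p \<Longrightarrow>
     \<bar>t - s\<bar> < \<delta>V \<Longrightarrow> pdist cube p X Y < \<delta>V \<Longrightarrow> \<bar>V t (law X) - V s (law Y)\<bar> < e"
    by (rule uniformly_continuous_law[OF p ucV e(1)]) blast
  define \<delta> where "\<delta> = min \<delta>U \<delta>V"
  have \<delta>: "0 < \<delta>" using \<delta>U(1) \<delta>V(1) by (simp add: \<delta>_def)
  have l8: "0 < l / 8" using l by simp
  obtain \<epsilon> where \<epsilon>: "0 < \<epsilon>" "\<epsilon> * (2 * B + 1) < \<delta>" "\<epsilon> * (2 * B + 1) < \<delta>\<^sup>2" "3 * K * (\<epsilon> * \<bar>P\<bar>) powr (1 / p) < l / 8"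
    by (rule eventually_small_penalty[OF \<delta> l8 p])
  define k where "k = 1 / \<epsilon>"
  have k: "0 \<le> k" using \<epsilon> by (simp add: k_def)
  define r where "r = (\<epsilon> * P) powr (1 / p)"
  have r: "0 < r" "r powr p = \<epsilon> * P" "3 * K * r < l / 8" "k * r powr p = P"
    using \<epsilon> P p by (auto simp: r_def powr_powr k_def)
  define S where "S = (\<Sum>i. ((1/2 :: real) ^ i) powr (1 / p))"
  have halfp: "summable (\<lambda>i. ((1/2 :: real) ^ i) powr (1 / p))" using p by (intro summable_half_powr) auto
  have half: "summable (\<lambda>i. (1/2 :: real) ^ i)" by (simp add: summable_geometric)
  have S: "0 < S" unfolding S_def by (intro suminf_pos2[OF halfp, of 0]) auto
  define Q0 where "Q0 = (k * p) powr p'' * (\<epsilon> * P)"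
  have amin: "0 < Min {P / 2, m / 4, 1}" and b: "0 < l / 2" using P m l by auto
  obtain \<eta> \<kappa> where \<eta>: "0 < \<eta>" "\<eta> < Min {P / 2, m / 4, 1}" and \<kappa>: "0 < \<kappa>" "\<kappa> powr p'' = (p * S) powr p'' * \<eta>"
    and small: "12 * sqrt \<eta> + 2 * (C * \<kappa> * (3 + 2 powr p'' * (Q0 + \<kappa> powr p''))) < l / 2"
    unfolding p''_def by (rule eventually_small_perturbation[OF p amin b S])
  have \<eta>': "\<eta> < P / 2" "\<eta> < m / 4" "\<eta> < 1" using \<eta>(2) by auto
  obtain t X s Y \<tau> A \<sigma> D where
    mem: "t \<in> {0..T}" "X \<in> Lp cube p" "s \<in> {0..T}" "Y \<in> Lp cube p"
      "\<And>i. \<tau> i \<in> {0..T}" "\<And>i. A i \<in> Lp cube p" "\<And>i. \<sigma> i \<in> {0..T}" "\<And>i. D i \<in> Lp cube p"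
    and sums: "summable (\<lambda>i. (1/2) ^ i * doubled_gauge p t X s Y (\<tau> i) (A i) (\<sigma> i) (D i))"
      "(\<Sum>i. (1/2) ^ i * doubled_gauge p t X s Y (\<tau> i) (A i) (\<sigma> i) (D i)) \<le> \<eta>"
    and near: "\<And>t' X' s' Y'. t' \<in> {0..T} \<Longrightarrow> X' \<in> Lp cube p \<Longrightarrow> s' \<in> {0..T} \<Longrightarrow> Y' \<in> Lp cube p \<Longrightarrow>
       doubled_gap p U V \<epsilon> l t' X' s' Y' - \<eta> \<le> doubled_gap p U V \<epsilon> l t X s Y"
    and maxi: "\<And>t' X' s' Y'. t' \<in> {0..T} \<Longrightarrow> X' \<in> Lp cube p \<Longrightarrow> s' \<in> {0..T} \<Longrightarrow> Y' \<in> Lp cube p \<Longrightarrow>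
       summable (\<lambda>i. (1/2) ^ i * doubled_gauge p t' X' s' Y' (\<tau> i) (A i) (\<sigma> i) (D i)) \<Longrightarrow>
       doubled_gap p U V \<epsilon> l t' X' s' Y'
         - (\<Sum>i. (1/2) ^ i * doubled_gauge p t' X' s' Y' (\<tau> i) (A i) (\<sigma> i) (D i))
       \<le> doubled_gap p U V \<epsilon> l t X s Y
         - (\<Sum>i. (1/2) ^ i * doubled_gauge p t X s Y (\<tau> i) (A i) (\<sigma> i) (D i))"
    by (rule doubling_maximum[OF p T \<epsilon>(1) \<eta>(1) less_imp_le[OF l(1)] ucU ucV UB VB]) blast+
  note near = near[unfolded doubled_gap_def] and sums = sums[unfolded doubled_gauge_def]
    and maxi = maxi[unfolded doubled_gap_def doubled_gauge_def]
  define \<mu> \<nu> where "\<mu> = law X" and "\<nu> = law Y"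
  have \<mu>\<nu>: "\<mu> \<in> Pp p" "\<nu> \<in> Pp p" unfolding \<mu>_def \<nu>_def using mem by (auto intro: law_in_Pp)
  define pen where "pen = (pdist cube p X Y + (t - s)\<^sup>2) / \<epsilon>"
  have pen_nn: "0 \<le> pen" using \<epsilon> by (simp add: pen_def pdist_nonneg)
  have pen_eq: "pdist cube p X Y + (t - s)\<^sup>2 = \<epsilon> * pen" using \<epsilon> by (simp add: pen_def)
  \<comment> \<open>Compare with the diagonal point \<open>(t, X, t, X)\<close>, where the penalty vanishes.\<close>
  have pen1: "pen \<le> V t \<mu> - V s \<nu> + \<eta>"
    using near[OF mem(1,2,1,2)] unfolding \<mu>_def[symmetric] \<nu>_def[symmetric] pen_def[symmetric] by simp
  have close: "pdist cube p X Y < \<delta>" "\<bar>t - s\<bar> < \<delta>"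
  proof -
    have "pen \<le> 2 * B + 1" using pen1 VB[OF mem(1) \<mu>\<nu>(1)] VB[OF mem(3) \<mu>\<nu>(2)] \<eta>' by linarith
    then have "\<epsilon> * pen \<le> \<epsilon> * (2 * B + 1)" using \<epsilon> by (intro mult_left_mono) auto
    then have "pdist cube p X Y + (t - s)\<^sup>2 < \<delta>" "pdist cube p X Y + (t - s)\<^sup>2 < \<delta>\<^sup>2"
      unfolding pen_eq using \<epsilon> by linarith+
    moreover have "0 \<le> pdist cube p X Y" "0 \<le> (t - s)\<^sup>2" by (simp_all add: pdist_nonneg)
    ultimately have lt: "pdist cube p X Y < \<delta>" "(t - s)\<^sup>2 < \<delta>\<^sup>2" by linarith+
    show "pdist cube p X Y < \<delta>" by (rule lt(1))
    show "\<bar>t - s\<bar> < \<delta>" using lt(2) abs_le_square_iff[of \<delta> "t - s"] \<delta> by linarith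
  qed
  \<comment> \<open>The gap is still at least \<open>m / 2\<close>; at \<open>t = 0\<close> or \<open>s = 0\<close> it would be below \<open>m / 4\<close>.\<close>
  have near0: "m - m / 4 - \<eta> \<le> U t \<mu> - V s \<nu>"
  proof -
    have "m - l * t0 - \<eta> \<le> U t \<mu> - V s \<nu> - pen - l * t"
      using near[OF t0 X0L t0 X0L] unfolding \<mu>_def[symmetric] \<nu>_def[symmetric] pen_def[symmetric] X0(2) m_def by simp
    moreover have "0 \<le> l * t" using l mem by simp
    ultimately show ?thesis using l(2) pen_nn by linarith
  qed
  have dV: "\<bar>V t \<mu> - V s \<nu>\<bar> < e" unfolding \<mu>_def \<nu>_def
    using close by (intro \<delta>V(2) mem) (auto simp: \<delta>_def)
  have dU: "\<bar>U t \<mu> - U s \<nu>\<bar> < e" unfolding \<mu>_def \<nu>_def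
    using close by (intro \<delta>U(2) mem) (auto simp: \<delta>_def)
  have tpos: "t \<in> {0<..T}"
  proof (rule ccontr)
    assume "t \<notin> {0<..T}"
    then have "t = 0" using mem(1) by auto
    then show False using init[OF \<mu>\<nu>(1)] dV near0 e(3) \<eta>'(2) m by simp
  qed
  have spos: "s \<in> {0<..T}"
  proof (rule ccontr)
    assume "s \<notin> {0<..T}"
    then have "s = 0" using mem(3) by auto
    then show False using init[OF \<mu>\<nu>(2)] dU near0 e(3) \<eta>'(2) m by simp
  qed
  have penP: "pen \<le> P" using pen1 dV e(2) \<eta>'(1) by linarith
  have XYr: "pdist cube p X Y \<le> r powr p"
  proof -
    have "\<epsilon> * pen \<le> \<epsilon> * P" using penP \<epsilon> by (intro mult_left_mono) auto
    then show ?thesis using pen_eq r(2) zero_le_power2[of "t - s"] by linarith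
  qed
  have part: "summable (\<lambda>i. (1/2) ^ i * g i) \<and> (\<Sum>i. (1/2) ^ i * g i) \<le> \<eta>"
    if g: "\<And>i. 0 \<le> g i" "\<And>i. g i \<le> (pdist cube p X (A i) + (t - \<tau> i)\<^sup>2) + (pdist cube p Y (D i) + (s - \<sigma> i)\<^sup>2)" for g
  proof -
    have le: "(1/2) ^ i * g i \<le> (1/2) ^ i * ((pdist cube p X (A i) + (t - \<tau> i)\<^sup>2) + (pdist cube p Y (D i) + (s - \<sigma> i)\<^sup>2))" for i
      by (intro mult_left_mono g) auto
    have sm: "summable (\<lambda>i. (1/2) ^ i * g i)"
      by (rule summable_comparison_test'[OF sums(1), of 0]) (use le g(1) in \<open>simp add: abs_mult\<close>)
    moreover have "(\<Sum>i. (1/2) ^ i * g i) \<le> \<eta>" using suminf_le[OF le sm sums(1)] sums(2) by linarith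
    ultimately show ?thesis by blast
  qed
  have nn: "0 \<le> pdist cube p X (A i)" "0 \<le> (t - \<tau> i)\<^sup>2" "0 \<le> pdist cube p Y (D i)" "0 \<le> (s - \<sigma> i)\<^sup>2" for i
    by (simp_all add: pdist_nonneg)
  have sA: "summable (\<lambda>i. (1/2) ^ i * pdist cube p X (A i))" "(\<Sum>i. (1/2) ^ i * pdist cube p X (A i)) \<le> \<eta>"
    using part[of "\<lambda>i. pdist cube p X (A i)"] nn by (auto simp: add_increasing add_increasing2)
  have sD: "summable (\<lambda>i. (1/2) ^ i * pdist cube p Y (D i))" "(\<Sum>i. (1/2) ^ i * pdist cube p Y (D i)) \<le> \<eta>"
    using part[of "\<lambda>i. pdist cube p Y (D i)"] nn by (auto simp: add_increasing add_increasing2)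
  have s\<tau>: "summable (\<lambda>i. (1/2) ^ i * (t - \<tau> i)\<^sup>2)" "(\<Sum>i. (1/2) ^ i * (t - \<tau> i)\<^sup>2) \<le> \<eta>"
    using part[of "\<lambda>i. (t - \<tau> i)\<^sup>2"] nn by (auto simp: add_increasing add_increasing2)
  have s\<sigma>: "summable (\<lambda>i. (1/2) ^ i * (s - \<sigma> i)\<^sup>2)" "(\<Sum>i. (1/2) ^ i * (s - \<sigma> i)\<^sup>2) \<le> \<eta>"
    using part[of "\<lambda>i. (s - \<sigma> i)\<^sup>2"] nn by (auto simp: add_increasing add_increasing2)
  have sq: "summable (\<lambda>i. (1/2) ^ i * (u - \<zeta> i)\<^sup>2)" if "u \<in> {0..T}" "\<And>i. \<zeta> i \<in> {0..T}" for u and \<zeta> :: "nat \<Rightarrow> real"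
  proof -
    have "\<bar>u - \<zeta> i\<bar> \<le> T" for i using that(1) that(2)[of i] by auto
    from summable_weighted_bounded(2)[OF _ half this] show ?thesis by simp
  qed
  have pairA: "summable (\<lambda>i. (1/2) ^ i * (pdist cube p X' (A i) + (t' - \<tau> i)\<^sup>2))"
    if "t' \<in> {0..T}" "summable (\<lambda>i. (1/2) ^ i * pdist cube p X' (A i))" for t' X'
    using summable_add[OF that(2) sq[OF that(1) mem(5)]] by (simp add: distrib_left)
  have pairD: "summable (\<lambda>i. (1/2) ^ i * (pdist cube p Y' (D i) + (s' - \<sigma> i)\<^sup>2))"
    if "s' \<in> {0..T}" "summable (\<lambda>i. (1/2) ^ i * pdist cube p Y' (D i))" for s' Y'
    using summable_add[OF that(2) sq[OF that(1) mem(7)]] by (simp add: distrib_left)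
  have addAD: "summable (\<lambda>i. (1/2) ^ i * (f i + g i))"
      "(\<Sum>i. (1/2) ^ i * (f i + g i)) = (\<Sum>i. (1/2) ^ i * f i) + (\<Sum>i. (1/2) ^ i * g i)"
    if "summable (\<lambda>i. (1/2) ^ i * f i)" "summable (\<lambda>i. (1/2) ^ i * g i)" for f g :: "nat \<Rightarrow> real"
    using summable_add[OF that] suminf_add[OF that] by (simp_all add: distrib_left)
  define Q where "Q w = k *\<^sub>R pgrad p (X w - Y w)" for w
  define E1 where "E1 = grad_series p (\<lambda>i. (1/2) ^ i) X A"
  define E2 where "E2 = grad_series p (\<lambda>i. (1/2) ^ i) Y D"
  \<comment> \<open>Both gradients contain the same \<open>Q\<close>: the penalty depends on \<open>X - Y\<close> and \<open>pgrad\<close> is odd.\<close>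
  obtain \<psi>1 where \<psi>1: "(l + 2 * k * (t - s) + 2 * (\<Sum>i. (1/2) ^ i * (t - \<tau> i)), \<psi>1) \<in> superdiff p T U t \<mu>"
    "kernel_joint \<mu> \<psi>1 = distr cube (borel \<Otimes>\<^sub>M borel) (\<lambda>w. (X w, Q w + E1 w))"
    unfolding \<mu>_def Q_def E1_def
  proof (rule superdiff_of_doubling[where F = U and l = l, OF p mem(1,2,3,4,6,5) k sA(1) UB])
    fix t' X' assume *: "t' \<in> {0..T}" "X' \<in> Lp cube p" "summable (\<lambda>i. (1/2) ^ i * pdist cube p X' (A i))"
    note a = addAD[OF pairA[OF *(1,3)] pairD[OF mem(3) sD(1)]]
      and b = addAD[OF pairA[OF mem(1) sA(1)] pairD[OF mem(3) sD(1)]]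
    show "U t' (law X') - l * t' - k * (pdist cube p X' Y + (t' - s)\<^sup>2)
        - (\<Sum>i. (1/2) ^ i * (pdist cube p X' (A i) + (t' - \<tau> i)\<^sup>2))
      \<le> U t (law X) - l * t - k * (pdist cube p X Y + (t - s)\<^sup>2)
        - (\<Sum>i. (1/2) ^ i * (pdist cube p X (A i) + (t - \<tau> i)\<^sup>2))"
      using maxi[OF *(1,2) mem(3,4) a(1)] unfolding a(2) b(2) by (simp add: k_def)
  qed blast+
  obtain \<psi>2 where \<psi>2: "(0 + 2 * k * (s - t) + 2 * (\<Sum>i. (1/2) ^ i * (s - \<sigma> i)), \<psi>2) \<in> superdiff p T (\<lambda>u \<rho>. - V u \<rho>) s \<nu>"
    "kernel_joint \<nu> \<psi>2 = distr cube (borel \<Otimes>\<^sub>M borel) (\<lambda>w. (Y w, k *\<^sub>R pgrad p (Y w - X w) + E2 w))"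
    unfolding \<nu>_def E2_def
  proof (rule superdiff_of_doubling[where F = "\<lambda>u \<rho>. - V u \<rho>" and l = 0, OF p mem(3,4,1,2,8,7) k sD(1) VB'])
    fix s' Y' assume *: "s' \<in> {0..T}" "Y' \<in> Lp cube p" "summable (\<lambda>i. (1/2) ^ i * pdist cube p Y' (D i))"
    note a = addAD[OF pairA[OF mem(1) sA(1)] pairD[OF *(1,3)]]
      and b = addAD[OF pairA[OF mem(1) sA(1)] pairD[OF mem(3) sD(1)]]
    show "- V s' (law Y') - 0 * s' - k * (pdist cube p Y' X + (s' - t)\<^sup>2)
        - (\<Sum>i. (1/2) ^ i * (pdist cube p Y' (D i) + (s' - \<sigma> i)\<^sup>2))
      \<le> - V s (law Y) - 0 * s - k * (pdist cube p Y X + (s - t)\<^sup>2)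
        - (\<Sum>i. (1/2) ^ i * (pdist cube p Y (D i) + (s - \<sigma> i)\<^sup>2))"
      using maxi[OF mem(1,2) *(1,2) a(1)] unfolding a(2) b(2)
      by (simp add: k_def pdist_commute[of cube p Y' X] pdist_commute[of cube p Y X] power2_commute[of s' t] power2_commute[of s t])
  qed blast+
  have m\<mu>\<nu>: "prob_space \<nu>" "sets \<nu> = sets borel" using \<mu>\<nu> by (auto simp: Pp_def)
  have Xm: "X \<in> borel_measurable cube" "Y \<in> borel_measurable cube" "\<And>i. A i \<in> borel_measurable cube" "\<And>i. D i \<in> borel_measurable cube"
    using mem by (auto simp: Lp_def)
  have Qm: "Q \<in> borel_measurable cube" unfolding Q_def[abs_def] pgrad_def using Xm by measurable
  have E1m: "E1 \<in> borel_measurable cube" unfolding E1_def by (rule grad_series_measurable[OF Xm(1,3)])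
  have E2m: "E2 \<in> borel_measurable cube" unfolding E2_def by (rule grad_series_measurable[OF Xm(2,4)])
  have hnn: "0 \<le> (1/2 :: real) ^ i" for i by simp
  have Ei: "integrable cube (\<lambda>w. norm (grad_series p (\<lambda>i. (1/2) ^ i) Z W w) powr conj_exponent p)"
    "(\<integral>w. norm (grad_series p (\<lambda>i. (1/2) ^ i) Z W w) powr conj_exponent p \<partial>cube) \<le> \<kappa> powr conj_exponent p"
    if ZW: "Z \<in> Lp cube p" "\<And>i. W i \<in> Lp cube p"
      and sW: "summable (\<lambda>i. (1/2) ^ i * pdist cube p Z (W i))" "(\<Sum>i. (1/2) ^ i * pdist cube p Z (W i)) \<le> \<eta>"
    for Z :: "(real \<Rightarrow> real) \<Rightarrow> 'a" and W
  proof -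
    note g = grad_series_Lp[where c = "\<lambda>i. (1/2) ^ i" and X = Z and W = W, OF p hnn ZW half halfp sW(1)]
    show "integrable cube (\<lambda>w. norm (grad_series p (\<lambda>i. (1/2) ^ i) Z W w) powr conj_exponent p)" by (rule g(1))
    have "(p * S) powr conj_exponent p * (\<Sum>i. (1/2) ^ i * pdist cube p Z (W i)) \<le> (p * S) powr conj_exponent p * \<eta>"
      by (intro mult_left_mono sW(2)) simp
    then show "(\<integral>w. norm (grad_series p (\<lambda>i. (1/2) ^ i) Z W w) powr conj_exponent p \<partial>cube) \<le> \<kappa> powr conj_exponent p"
      using g(2) \<kappa>(2) unfolding S_def p''_def by linarith
  qed
  note E1i = Ei[OF mem(2,6) sA, folded E1_def] and E2i = Ei[OF mem(4,8) sD, folded E2_def]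
  note sh = H_expected_shift[where H = H and \<kappa> = "l / 8", OF Hh mem(2,4) r(1) XYr k K]
  have Qi: "integrable cube (\<lambda>w. norm (Q w) powr conj_exponent p)" unfolding Q_def by (rule sh(1))
  have QI: "(\<integral>w. norm (Q w) powr conj_exponent p \<partial>cube) \<le> Q0"
  proof -
    have "(k * p) powr conj_exponent p * pdist cube p X Y \<le> (k * p) powr conj_exponent p * (\<epsilon> * P)"
      using XYr r(2) by (intro mult_left_mono) auto
    then show ?thesis using sh(2) unfolding Q_def Q0_def p''_def by linarith
  qed
  \<comment> \<open>\<open>I1\<close> and \<open>I4\<close> occur in the viscosity inequalities; \<open>I2\<close> and \<open>I3\<close> have the common momentum \<open>Q\<close>.\<close>
  define I1 where "I1 = (\<integral>w. H (X w) (Q w + E1 w) \<mu> \<partial>cube)"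
  define I2 where "I2 = (\<integral>w. H (X w) (Q w) \<mu> \<partial>cube)"
  define I3 where "I3 = (\<integral>w. H (Y w) (Q w) \<nu> \<partial>cube)"
  define I4 where "I4 = (\<integral>w. H (Y w) (Q w + - E2 w) \<nu> \<partial>cube)"
  define R where "R = C * \<kappa> * (3 + 2 powr p'' * (Q0 + \<kappa> powr p''))"
  have R: "C * \<kappa> * (3 + 2 powr conj_exponent p * ((\<integral>w. norm (Q w) powr conj_exponent p \<partial>cube) + \<kappa> powr conj_exponent p)) \<le> R"
    unfolding R_def p''_def using C \<kappa> QI by (intro mult_left_mono add_left_mono add_right_mono) auto
  have I12: "\<bar>I1 - I2\<bar> \<le> R"
    unfolding I1_def I2_def
    by (rule order_trans[OF H_expected_perturbation[where H = H, OF Hh \<mu>\<nu>(1) Xm(1) Qm Qi E1m E1i(1) \<kappa>(1) E1i(2)] R])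
  have I34: "\<bar>I4 - I3\<bar> \<le> R"
  proof -
    have "(\<lambda>w. - E2 w) \<in> borel_measurable cube" "integrable cube (\<lambda>w. norm (- E2 w) powr conj_exponent p)"
      "(\<integral>w. norm (- E2 w) powr conj_exponent p \<partial>cube) \<le> \<kappa> powr conj_exponent p"
      using E2m E2i by simp_all
    from H_expected_perturbation[where H = H, OF Hh \<mu>\<nu>(2) Xm(2) Qm Qi this(1,2) \<kappa>(1) this(3)]
    show ?thesis unfolding I4_def I3_def using R by linarith
  qed
  have I23: "\<bar>I2 - I3\<bar> \<le> 3 * l / 8"
  proof -
    have "\<bar>I2 - I3\<bar> \<le> l / 8 + K * (3 * r + 3 * p * (k * r powr p))"
      using sh(3) unfolding I2_def I3_def Q_def \<mu>_def \<nu>_def .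
    also have "\<dots> = l / 8 + 3 * K * r + K * (3 * p * P)" unfolding r(4) by (simp add: algebra_simps)
    finally show ?thesis using r(3) KP by linarith
  qed
  have sub: "l + 2 * k * (t - s) + 2 * (\<Sum>i. (1/2) ^ i * (t - \<tau> i)) + I1 \<le> 0"
  proof -
    have "l + 2 * k * (t - s) + 2 * (\<Sum>i. (1/2) ^ i * (t - \<tau> i)) + (\<integral>(x, z). H x z \<mu> \<partial>kernel_joint \<mu> \<psi>1) \<le> 0"
      using assms(13) tpos \<mu>\<nu>(1) \<psi>1(1) unfolding viscosity_subsolution_def by fast
    moreover have "(\<integral>(x, z). H x z \<mu> \<partial>kernel_joint \<mu> \<psi>1) = I1"
      unfolding \<psi>1(2) I1_def split_beta'
      using H_measurable[where H = H, OF Hh \<mu>\<nu>(1)] Xm Qm E1m by (subst integral_distr) auto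
    ultimately show ?thesis by simp
  qed
  have super: "0 \<le> - (0 + 2 * k * (s - t) + 2 * (\<Sum>i. (1/2) ^ i * (s - \<sigma> i))) + I4"
  proof -
    have \<psi>2k: "\<psi>2 \<in> kernels" using \<psi>2(1) by (simp add: superdiff_def)
    have "(- (0 + 2 * k * (s - t) + 2 * (\<Sum>i. (1/2) ^ i * (s - \<sigma> i))), \<lambda>x. distr (\<psi>2 x) borel uminus) \<in> subdiff p T V s \<nu>"
      unfolding subdiff_def using \<psi>2(1) by blast
    then have "0 \<le> - (0 + 2 * k * (s - t) + 2 * (\<Sum>i. (1/2) ^ i * (s - \<sigma> i)))
        + (\<integral>(x, z). H x z \<nu> \<partial>kernel_joint \<nu> (\<lambda>x. distr (\<psi>2 x) borel uminus))"
      using assms(14) spos \<mu>\<nu>(2) unfolding viscosity_supersolution_def by fast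
    moreover have "(\<integral>(x, z). H x z \<nu> \<partial>kernel_joint \<nu> (\<lambda>x. distr (\<psi>2 x) borel uminus)) = I4"
    proof -
      have neg: "- (k *\<^sub>R pgrad p (Y w - X w)) = Q w" for w
        using pgrad_minus[of p "X w - Y w"] by (simp add: Q_def)
      have jm: "(\<lambda>w. (Y w, k *\<^sub>R pgrad p (Y w - X w) + E2 w)) \<in> cube \<rightarrow>\<^sub>M borel \<Otimes>\<^sub>M borel"
        using Xm E2m unfolding pgrad_def by measurable
      have "kernel_joint \<nu> (\<lambda>x. distr (\<psi>2 x) borel uminus)
          = distr cube (borel \<Otimes>\<^sub>M borel) (\<lambda>w. (Y w, Q w + - E2 w))"
        unfolding kernel_joint_uminus[OF m\<mu>\<nu> \<psi>2k] \<psi>2(2)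
        using jm by (subst distr_distr) (auto simp: comp_def neg)
      then show ?thesis
        unfolding I4_def split_beta'
        using H_measurable[where H = H, OF Hh \<mu>\<nu>(2)] Xm Qm E2m by (simp add: integral_distr)
    qed
    ultimately show ?thesis by simp
  qed
  \<comment> \<open>The derivatives of \<open>(t - s)\<^sup>2 / \<epsilon>\<close> cancel, so \<open>l\<close> is bounded by the error terms.\<close>
  have "\<bar>\<Sum>i. (1/2) ^ i * (t - \<tau> i)\<bar> \<le> 3 * sqrt \<eta>" by (rule weighted_first_moment_le[OF s\<tau> \<eta>(1)])
  moreover have "\<bar>\<Sum>i. (1/2) ^ i * (s - \<sigma> i)\<bar> \<le> 3 * sqrt \<eta>" by (rule weighted_first_moment_le[OF s\<sigma> \<eta>(1)])
  moreover have "2 * k * (t - s) + 2 * k * (s - t) = 0" by (simp add: algebra_simps)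
  moreover have "12 * sqrt \<eta> + 2 * R < l / 2" using small by (simp add: R_def)
  ultimately show False using sub super I12 I23 I34 l(1) by linarith
qed

end
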